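(* Let $\mathcal M=(M,<,+,0,\ldots)$ be a definably complete locally o-minimal expansion of an ordered group and let $(X,\tau)$ be a definable topological space. The following are equivalent: (1) for every definable curve $\gamma:(a,b)\to X$ with $a\in M\cup\{-\infty\}$, $b\in M\cup\{\infty\}$, both $\operatorname{Conv}_{\mathrm{right}}(\gamma)$ and $\operatorname{Conv}_{\mathrm{left}}(\gamma)$ are nonempty; (2) every definable net in $X$ has a convergent definable subnet; (3) every definable filtered collection of nonempty closed subsets of $X$ has nonempty intersection.
   Context: "Definable" means definable in $\mathcal M$ with parameters. $\mathcal M$ is an expansion of an ordered group with dense order without endpoints; locally o-minimal: for every definable $Y\subseteq M$ and $a\in M$ there is an open interval $I\ni a$ with $Y\cap I$ a finite union of points and open intervals; definably complete: every definable subset of $M$ has sup and inf in $M\cup\{\pm\infty\}$. A family $\{S_t:t\in T\}$ is definable if $T$ and $\bigcup_t\{t\}\times S_t$ are definable; it is a filtered collection if for any two members some member lies in their intersection. A definable topological space is a definable set with a topology having a definable family as open base. A definable directed set is a definable nonempty set $\Omega$ with a definable preorder $\preceq$ such that every finite subset has a common lower bound. A definable net in $X$ is a definable map $\gamma:(\Omega,\preceq)\to X$ from a definable directed set; it converges to $x$ if for every definable neighborhood $A$ of $x$ there is $u_A$ with $\gamma(u)\in A$ whenever $u\preceq u_A$. A definable subnet of $\gamma$ is $\gamma\circ f$ where $f:(\Omega',\preceq')\to(\Omega,\preceq)$ is a definable map from a definable directed set which is downward cofinal (for each $u\in\Omega$ there is $v\in\Omega'$ with $w\preceq' v\Rightarrow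 f(w)\preceq u$). A definable curve is a definable (not necessarily continuous) map from an open interval. For $\gamma:(a,b)\to X$: $\operatorname{Conv}_{\mathrm{right}}(\gamma)$ is the set of $x\in X$ such that for every $t\in(a,b)$ and every definable neighborhood $A$ of $x$, $\gamma((t,b))\cap A\ne\emptyset$; $\operatorname{Conv}_{\mathrm{left}}(\gamma)$ is defined likewise with $\gamma((a,t))$. *)

theory Defs
  imports "HOL-Analysis.Analysis"
begin

text \<open>
  A first-order structure on a set M (here: the universe of the type 'a) is encoded,
  following van den Dries, by the sequence of its definable (with parameters) sets:
  S n is the collection of definable subsets of M^n, where M^n is represented by
  lists of length n.
\<close>

definition is_structure :: "(nat \<Rightarrow> 'a list set set) \<Rightarrow> bool" where
  "is_structure S \<longleftrightarrow>
     (\<forall>n. \<forall>A\<in>S n. A \<subseteq> {x. length x = n}) \<and>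
     (\<forall>n. {x. length x = n} \<in> S n) \<and>
     (\<forall>n A B. A \<in> S n \<longrightarrow> B \<in> S n \<longrightarrow> A - B \<in> S n \<and> A \<union> B \<in> S n) \<and>
     (\<forall>n A. A \<in> S n \<longrightarrow> {x @ [y] | x y. x \<in> A} \<in> S (Suc n)
                      \<and> {y # x | x y. x \<in> A} \<in> S (Suc n)) \<and>
     (\<forall>n i j. i < n \<longrightarrow> j < n \<longrightarrow> {x. length x = n \<and> x ! i = x ! j} \<in> S n) \<and>
     (\<forall>n A. A \<in> S (Suc n) \<longrightarrow> butlast ` A \<in> S n)"

definition definable1 :: "(nat \<Rightarrow> 'a list set set) \<Rightarrow> 'a set \<Rightarrow> bool" where
  "definable1 S Y \<longleftrightarrow> (\<lambda>y. [y]) ` Y \<in> S 1"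

definition expands_ordered_group :: "(nat \<Rightarrow> ('a::{group_add,linorder}) list set set) \<Rightarrow> bool" where
  "expands_ordered_group S \<longleftrightarrow>
     (\<forall>a. {[a]} \<in> S 1) \<and>
     {[x, y] | x y. x < y} \<in> S 2 \<and>
     {[x, y, x + y] | x y. True} \<in> S 3"

definition locally_o_minimal :: "(nat \<Rightarrow> ('a::linorder) list set set) \<Rightarrow> bool" where
  "locally_o_minimal S \<longleftrightarrow>
     (\<forall>Y a. definable1 S Y \<longrightarrow>
        (\<exists>l u. l < a \<and> a < u \<and>
           (\<exists>P Q. finite P \<and> finite Q \<and>
              Y \<inter> {l<..<u} = P \<union> (\<Union>(p, q)\<in>Q. {p<..<q}))))"

definition definably_complete :: "(nat \<Rightarrow> ('a::linorder) list set set) \<Rightarrow> bool" where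
  "definably_complete S \<longleftrightarrow>
     (\<forall>Y. definable1 S Y \<longrightarrow> Y \<noteq> {} \<longrightarrow> (\<exists>b. \<forall>y\<in>Y. y \<le> b) \<longrightarrow>
        (\<exists>s. (\<forall>y\<in>Y. y \<le> s) \<and> (\<forall>b. (\<forall>y\<in>Y. y \<le> b) \<longrightarrow> s \<le> b))) \<and>
     (\<forall>Y. definable1 S Y \<longrightarrow> Y \<noteq> {} \<longrightarrow> (\<exists>b. \<forall>y\<in>Y. b \<le> y) \<longrightarrow>
        (\<exists>s. (\<forall>y\<in>Y. s \<le> y) \<and> (\<forall>b. (\<forall>y\<in>Y. b \<le> y) \<longrightarrow> b \<le> s)))"

definition definable_family ::
  "(nat \<Rightarrow> 'a list set set) \<Rightarrow> nat \<Rightarrow> nat \<Rightarrow> 'a list set \<Rightarrow> ('a list \<Rightarrow> 'a list set) \<Rightarrow> bool" where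
  "definable_family S m n I F \<longleftrightarrow>
     I \<in> S m \<and> (\<forall>t\<in>I. F t \<subseteq> {x. length x = n}) \<and>
     {t @ x | t x. t \<in> I \<and> x \<in> F t} \<in> S (m + n)"

definition definable_map ::
  "(nat \<Rightarrow> 'a list set set) \<Rightarrow> nat \<Rightarrow> nat \<Rightarrow> 'a list set \<Rightarrow> ('a list \<Rightarrow> 'a list) \<Rightarrow> bool" where
  "definable_map S k n D f \<longleftrightarrow>
     D \<in> S k \<and> (\<forall>x\<in>D. length (f x) = n) \<and> {x @ f x | x. x \<in> D} \<in> S (k + n)"

definition definable_top_space ::
  "(nat \<Rightarrow> 'a list set set) \<Rightarrow> nat \<Rightarrow> 'a list set \<Rightarrow> 'a list topology \<Rightarrow> bool" where
  "definable_top_space S n X T \<longleftrightarrow>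
     X \<in> S n \<and> topspace T = X \<and>
     (\<exists>m I B. definable_family S m n I B \<and> (\<forall>t\<in>I. openin T (B t)) \<and>
        (\<forall>U. openin T U \<longrightarrow> (\<exists>J\<subseteq>I. U = \<Union>(B ` J))))"

definition definable_nbhd ::
  "(nat \<Rightarrow> 'a list set set) \<Rightarrow> nat \<Rightarrow> 'a list topology \<Rightarrow> 'a list set \<Rightarrow> 'a list \<Rightarrow> bool" where
  "definable_nbhd S n T A x \<longleftrightarrow>
     A \<in> S n \<and> A \<subseteq> topspace T \<and> (\<exists>U. openin T U \<and> x \<in> U \<and> U \<subseteq> A)"

definition definable_directed ::
  "(nat \<Rightarrow> 'a list set set) \<Rightarrow> nat \<Rightarrow> 'a list set \<Rightarrow> ('a list \<Rightarrow> 'a list \<Rightarrow> bool) \<Rightarrow> bool" where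
  "definable_directed S k \<Omega> le \<longleftrightarrow>
     \<Omega> \<in> S k \<and> \<Omega> \<noteq> {} \<and>
     {u @ v | u v. u \<in> \<Omega> \<and> v \<in> \<Omega> \<and> le u v} \<in> S (k + k) \<and>
     (\<forall>u\<in>\<Omega>. le u u) \<and>
     (\<forall>u\<in>\<Omega>. \<forall>v\<in>\<Omega>. \<forall>w\<in>\<Omega>. le u v \<longrightarrow> le v w \<longrightarrow> le u w) \<and>
     (\<forall>F. finite F \<longrightarrow> F \<subseteq> \<Omega> \<longrightarrow> (\<exists>w\<in>\<Omega>. \<forall>u\<in>F. le w u))"

definition definable_net ::
  "(nat \<Rightarrow> 'a list set set) \<Rightarrow> nat \<Rightarrow> 'a list set \<Rightarrow> nat \<Rightarrow> 'a list set \<Rightarrow>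
   ('a list \<Rightarrow> 'a list \<Rightarrow> bool) \<Rightarrow> ('a list \<Rightarrow> 'a list) \<Rightarrow> bool" where
  "definable_net S n X k \<Omega> le \<gamma> \<longleftrightarrow>
     definable_directed S k \<Omega> le \<and> definable_map S k n \<Omega> \<gamma> \<and> \<gamma> ` \<Omega> \<subseteq> X"

definition net_converges ::
  "(nat \<Rightarrow> 'a list set set) \<Rightarrow> nat \<Rightarrow> 'a list topology \<Rightarrow> 'a list set \<Rightarrow>
   ('a list \<Rightarrow> 'a list \<Rightarrow> bool) \<Rightarrow> ('a list \<Rightarrow> 'a list) \<Rightarrow> 'a list \<Rightarrow> bool" where
  "net_converges S n T \<Omega> le \<gamma> x \<longleftrightarrow>
     (\<forall>A. definable_nbhd S n T A x \<longrightarrow>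
        (\<exists>uA\<in>\<Omega>. \<forall>u\<in>\<Omega>. le u uA \<longrightarrow> \<gamma> u \<in> A))"

definition downward_cofinal ::
  "'b set \<Rightarrow> ('b \<Rightarrow> 'b \<Rightarrow> bool) \<Rightarrow> 'c set \<Rightarrow> ('c \<Rightarrow> 'c \<Rightarrow> bool) \<Rightarrow> ('b \<Rightarrow> 'c) \<Rightarrow> bool" where
  "downward_cofinal \<Omega>' le' \<Omega> le f \<longleftrightarrow>
     f ` \<Omega>' \<subseteq> \<Omega> \<and> (\<forall>u\<in>\<Omega>. \<exists>v\<in>\<Omega>'. \<forall>w\<in>\<Omega>'. le' w v \<longrightarrow> le (f w) u)"

text \<open>Open interval (a,b) with a in M \<union> {-\<infinity>} and b in M \<union> {+\<infinity>} (None = infinite endpoint).\<close>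
definition oint :: "('a::linorder) option \<Rightarrow> 'a option \<Rightarrow> 'a set" where
  "oint a b = {t. (case a of None \<Rightarrow> True | Some a' \<Rightarrow> a' < t) \<and>
                  (case b of None \<Rightarrow> True | Some b' \<Rightarrow> t < b')}"

definition definable_curve ::
  "(nat \<Rightarrow> ('a::linorder) list set set) \<Rightarrow> nat \<Rightarrow> 'a list set \<Rightarrow> 'a option \<Rightarrow> 'a option \<Rightarrow>
   ('a \<Rightarrow> 'a list) \<Rightarrow> bool" where
  "definable_curve S n X a b \<gamma> \<longleftrightarrow>
     oint a b \<noteq> {} \<and> \<gamma> ` oint a b \<subseteq> X \<and>
     {[t] @ \<gamma> t | t. t \<in> oint a b} \<in> S (1 + n)"

definition conv_right ::
  "(nat \<Rightarrow> ('a::linorder) list set set) \<Rightarrow> nat \<Rightarrow> 'a list topology \<Rightarrow> 'a option \<Rightarrow> 'a option \<Rightarrow>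
   ('a \<Rightarrow> 'a list) \<Rightarrow> 'a list set" where
  "conv_right S n T a b \<gamma> = {x \<in> topspace T. \<forall>t\<in>oint a b. \<forall>A. definable_nbhd S n T A x \<longrightarrow>
       \<gamma> ` oint (Some t) b \<inter> A \<noteq> {}}"

definition conv_left ::
  "(nat \<Rightarrow> ('a::linorder) list set set) \<Rightarrow> nat \<Rightarrow> 'a list topology \<Rightarrow> 'a option \<Rightarrow> 'a option \<Rightarrow>
   ('a \<Rightarrow> 'a list) \<Rightarrow> 'a list set" where
  "conv_left S n T a b \<gamma> = {x \<in> topspace T. \<forall>t\<in>oint a b. \<forall>A. definable_nbhd S n T A x \<longrightarrow>
       \<gamma> ` oint a (Some t) \<inter> A \<noteq> {}}"

definition definable_filtered_closed ::
  "(nat \<Rightarrow> 'a list set set) \<Rightarrow> nat \<Rightarrow> 'a list topology \<Rightarrow> nat \<Rightarrow> 'a list set \<Rightarrow>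
   ('a list \<Rightarrow> 'a list set) \<Rightarrow> bool" where
  "definable_filtered_closed S n T m I F \<longleftrightarrow>
     definable_family S m n I F \<and> I \<noteq> {} \<and>
     (\<forall>t\<in>I. closedin T (F t) \<and> F t \<noteq> {}) \<and>
     (\<forall>s\<in>I. \<forall>t\<in>I. \<exists>r\<in>I. F r \<subseteq> F s \<inter> F t)"

end

theory Submission
  imports Defs
begin

text \<open>
  Only the passage from curves to filtered families is hard.  For tame coordinates, a definable
  filtered family is extended to a definable type obtained by iterating limits along definable
  curves.  Curve completeness gives definable maps into the space a limit along each such type, and
  the limit of the identity lies in every closed member of the family.  The extension needs
  two substitutes for o-minimality: definable sets are tame at every point from either
  side, and a preorder whose definable subsets have extremal classes keeps this property in the
  limit along a type; the latter rests on the argument behind the monotonicity theorem.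

  Coordinates are tame if they are bounded, or if every definable subset of the line is eventually
  constant at infinity.  If the latter fails, there is an unbounded definable closed discrete
  set, and induction along it shows that a definable family of subsets of a bounded box has
  all its members already over bounded parameters.  So, for each \<open>u\<close>, the members of the filtered
  family indexed by the box of size \<open>u\<close> have a common point; a point depending definably on
  \<open>u\<close> is a curve, and its cluster point as \<open>u\<close> tends to infinity lies in all the members.
\<close>

section \<open>Definability relative to an encoding of environments\<close>

text \<open>The types have to be iterated limits along curves, because curves are the only maps for
  which the hypothesis supplies limits. Such a type cannot decide sets one at a time: each new
  coordinate is a definable function of the earlier ones and of at most one parameter, and it must
  end up in the fibres of all members at once. If the lower ends of these fibres keep moving, the
  fibre of a given member may alternate between in and out along them. The preorder
  \<open>cmp\<close> collapses the stretches without alternation, and a greatest class of its limit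
  yields a member beyond which the alternation is over for almost all values of the earlier
  coordinates; this is why \<open>pw\<close> and \<open>PW\<close> are needed. Local o-minimality by
  itself gives no bounds uniform in a parameter. Uniformity comes from
  \<open>monotone_cover\<close>, a Baire property of definable chains, and from induction along
  closed discrete sets, whose bounded parts behave like finite sets. Definable choice, which uses
  the group, turns existence statements into definable maps throughout.\<close>

definition tup :: "nat \<Rightarrow> 'a list set" where
  "tup k = {x. length x = k}"

lemma in_tup [simp]: "x \<in> tup k \<longleftrightarrow> length x = k"
  by (simp add: tup_def)

locale fo_structure =
  fixes S :: "nat \<Rightarrow> 'a list set set"
  assumes struct: "is_structure S"
begin

lemmas structD = struct[unfolded is_structure_def]

lemma S_length: "A \<in> S n \<Longrightarrow> x \<in> A \<Longrightarrow> length x = n"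
  using structD[THEN conjunct1] by fast

lemma S_lists: "{x. length x = n} \<in> S n"
  using structD[THEN conjunct2, THEN conjunct1] by simp

lemma S_tup: "tup n \<in> S n"
  unfolding tup_def by (rule S_lists)

lemma S_diff: "A \<in> S n \<Longrightarrow> B \<in> S n \<Longrightarrow> A - B \<in> S n"
  and S_Un: "A \<in> S n \<Longrightarrow> B \<in> S n \<Longrightarrow> A \<union> B \<in> S n"
  using structD[THEN conjunct2, THEN conjunct2, THEN conjunct1] by simp_all

lemma S_Int: "A \<in> S n \<Longrightarrow> B \<in> S n \<Longrightarrow> A \<inter> B \<in> S n"
  by (metis Diff_Diff_Int S_diff)

lemma S_cons: "A \<in> S n \<Longrightarrow> {y # x | x y. x \<in> A} \<in> S (Suc n)"
  using structD[THEN conjunct2, THEN conjunct2, THEN conjunct2, THEN conjunct1] by simp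

lemma S_eq: "i < n \<Longrightarrow> j < n \<Longrightarrow> {x. length x = n \<and> x ! i = x ! j} \<in> S n"
  using structD[THEN conjunct2, THEN conjunct2, THEN conjunct2, THEN conjunct2, THEN conjunct1]
  by simp

lemma S_butlast: "A \<in> S (Suc n) \<Longrightarrow> butlast ` A \<in> S n"
  using structD[THEN conjunct2, THEN conjunct2, THEN conjunct2, THEN conjunct2, THEN conjunct2]
  by simp

section \<open>Projections and changes of variables in a structure\<close>

lemma S_prepend: "A \<in> S k \<Longrightarrow> {x @ y | x y. x \<in> tup N \<and> y \<in> A} \<in> S (N + k)"
proof (induction N)
  case (Suc N)
  have "{x @ y | x y. x \<in> tup (Suc N) \<and> y \<in> A}
      = {z # w | w z. w \<in> {x @ y | x y. x \<in> tup N \<and> y \<in> A}}"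
    (is "?L = ?R")
  proof (intro set_eqI iffI)
    fix v assume "v \<in> ?L"
    then obtain x y where "v = x @ y" "length x = Suc N" "y \<in> A" by auto
    then have "v = hd x # (tl x @ y)" "tl x \<in> tup N" by (cases x; simp)+
    then show "v \<in> ?R" using \<open>y \<in> A\<close> by blast
  next
    fix v assume "v \<in> ?R"
    then obtain z x y where "v = (z # x) @ y" "length x = N" "y \<in> A" by auto
    then show "v \<in> ?L" by (intro CollectI exI[of _ "z # x"] exI[of _ y]) auto
  qed
  then show ?case using S_cons[OF Suc.IH[OF Suc.prems]] by simp
qed auto

lemma S_project: "A \<in> S (N + k) \<Longrightarrow> {x. length x = N \<and> (\<exists>y\<in>tup k. x @ y \<in> A)} \<in> S N"
proof (induction k arbitrary: A)
  case 0
  have "{x. length x = N \<and> (\<exists>y\<in>tup 0. x @ y \<in> A)} = A"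
    using S_length[OF 0] by (auto simp: tup_def)
  then show ?case using 0 by simp
next
  case (Suc k)
  have "butlast ` A \<in> S (N + k)" using S_butlast Suc.prems by simp
  then have *: "{x. length x = N \<and> (\<exists>y\<in>tup k. x @ y \<in> butlast ` A)} \<in> S N" by (rule Suc.IH)
  have "(\<exists>y\<in>tup (Suc k). x @ y \<in> A) \<longleftrightarrow> (\<exists>y\<in>tup k. x @ y \<in> butlast ` A)"
    if "length x = N" for x
  proof
    assume "\<exists>y\<in>tup (Suc k). x @ y \<in> A"
    then obtain y where y: "length y = Suc k" "x @ y \<in> A" by auto
    then have "butlast (x @ y) = x @ butlast y"
      by (metis Zero_not_Suc butlast_append list.size(3))
    then show "\<exists>y\<in>tup k. x @ y \<in> butlast ` A"
      using y by (metis diff_Suc_1 image_eqI in_tup length_butlast)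
  next
    assume "\<exists>y\<in>tup k. x @ y \<in> butlast ` A"
    then obtain y z where y: "length y = k" "z \<in> A" "x @ y = butlast z" by auto
    then have "length z = Suc (N + k)" using S_length[OF Suc.prems] by simp
    then have "z = (x @ y) @ [last z]" using y(3)
      by (metis append_butlast_last_id length_0_conv nat.distinct(1))
    then show "\<exists>y\<in>tup (Suc k). x @ y \<in> A"
      using y(1,2) by (intro bexI[of _ "y @ [last z]"]) simp_all
  qed
  then have "{x. length x = N \<and> (\<exists>y\<in>tup (Suc k). x @ y \<in> A)}
      = {x. length x = N \<and> (\<exists>y\<in>tup k. x @ y \<in> butlast ` A)}"
    by (intro Collect_cong conj_cong refl)
  then show ?case using * by simp
qed

lemma S_coord_eq:
  "length ixs = length js \<Longrightarrow> set ixs \<subseteq> {..<N} \<Longrightarrow> set js \<subseteq> {..<N} \<Longrightarrow>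
    {x. length x = N \<and> map (nth x) ixs = map (nth x) js} \<in> S N"
proof (induction ixs js rule: list_induct2)
  case Nil
  then show ?case using S_lists[of N] by simp
next
  case (Cons i ixs j js)
  have eq: "{x. length x = N \<and> map (nth x) (i # ixs) = map (nth x) (j # js)}
      = {x. length x = N \<and> x ! i = x ! j} \<inter> {x. length x = N \<and> map (nth x) ixs = map (nth x) js}"
    by auto
  show ?case unfolding eq by (rule S_Int[OF S_eq Cons.IH]) (use Cons.prems in simp_all)
qed

lemma map_nth_append_right: "length x = N \<Longrightarrow> length y = k \<Longrightarrow> map (nth (x @ y)) [N..<N + k] = y"
  by (rule nth_equalityI) (auto simp: nth_append)

lemma map_nth_append_left:
  "set ixs \<subseteq> {..<length x} \<Longrightarrow> map (nth (x @ y)) ixs = map (nth x) ixs"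
  by (auto simp: nth_append)

text \<open>Substitution of variables, with repetitions and in any order, costs only a product,
  diagonals and a projection: \<open>k\<close> fresh coordinates are taken in \<open>A\<close>,
  equated with the coordinates listed in \<open>ixs\<close>, and projected away.\<close>

lemma S_reindex:
  assumes "A \<in> S k" "length ixs = k" "set ixs \<subseteq> {..<N}"
  shows "{x. length x = N \<and> map (nth x) ixs \<in> A} \<in> S N"
proof -
  let ?B = "{x @ y | x y. x \<in> tup N \<and> y \<in> A} \<inter>
      {z. length z = N + k \<and> map (nth z) [N..<N + k] = map (nth z) ixs}"
  have "?B \<in> S (N + k)"
    by (intro S_Int S_prepend S_coord_eq) (use assms in auto)
  then have *: "{x. length x = N \<and> (\<exists>y\<in>tup k. x @ y \<in> ?B)} \<in> S N" by (rule S_project)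
  have "(\<exists>y\<in>tup k. x @ y \<in> ?B) \<longleftrightarrow> map (nth x) ixs \<in> A" if x: "length x = N" for x
  proof
    assume "\<exists>y\<in>tup k. x @ y \<in> ?B"
    then obtain y where y: "length y = k" "x @ y \<in> ?B" unfolding Bex_def in_tup by blast
    then have "map (nth (x @ y)) [N..<N + k] = map (nth (x @ y)) ixs" by blast
    then have "y = map (nth x) ixs"
      using map_nth_append_right[OF x y(1)] map_nth_append_left[of ixs x y] assms(3) x by simp
    moreover have "y \<in> A" using y x by auto
    ultimately show "map (nth x) ixs \<in> A" by simp
  next
    assume A: "map (nth x) ixs \<in> A"
    have l: "length (map (nth x) ixs) = k" using assms by simp
    have "map (nth (x @ map (nth x) ixs)) [N..<N + k] = map (nth (x @ map (nth x) ixs)) ixs"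
      using map_nth_append_right[OF x l] map_nth_append_left[of ixs x] assms(3) x by simp
    then show "\<exists>y\<in>tup k. x @ y \<in> ?B" using A l x by (intro bexI[of _ "map (nth x) ixs"]) auto
  qed
  then have "{x. length x = N \<and> (\<exists>y\<in>tup k. x @ y \<in> ?B)} = {x. length x = N \<and> map (nth x) ixs \<in> A}" by auto
  with * show ?thesis by simp
qed

text \<open>
  A predicate on environments is definable relative to an encoding \<open>c\<close> of the environments in
  \<open>U\<close> as tuples of one fixed length.  Binding a variable passes from \<open>U\<close> to a product
  \<open>U \<times> V\<close>, so that variables are compositions of projections and no index arithmetic is needed.
\<close>

definition dfb :: "'e set \<Rightarrow> ('e \<Rightarrow> 'a list) \<Rightarrow> ('e \<Rightarrow> bool) \<Rightarrow> bool" where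
  "dfb U c P \<longleftrightarrow> (\<exists>N. (\<forall>e\<in>U. length (c e) = N) \<and> (\<exists>A\<in>S N. \<forall>e\<in>U. P e \<longleftrightarrow> c e \<in> A))"

definition dt :: "'e set \<Rightarrow> ('e \<Rightarrow> 'a list) \<Rightarrow> nat \<Rightarrow> ('e \<Rightarrow> 'a list) \<Rightarrow> bool" where
  "dt U c k \<tau> \<longleftrightarrow> (\<forall>e\<in>U. length (\<tau> e) = k) \<and>
     dfb (U \<times> tup k) (\<lambda>p. c (fst p) @ snd p) (\<lambda>p. snd p = \<tau> (fst p))"

lemma dfbI:
  "(\<And>e. e \<in> U \<Longrightarrow> length (c e) = N) \<Longrightarrow> A \<in> S N \<Longrightarrow> (\<And>e. e \<in> U \<Longrightarrow> P e \<longleftrightarrow> c e \<in> A) \<Longrightarrow> dfb U c P"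
  unfolding dfb_def by (intro exI[of _ N] conjI ballI bexI[of _ A])

lemma dfbE:
  assumes "dfb U c P"
  obtains N A where "\<forall>e\<in>U. length (c e) = N" "A \<in> S N" "\<forall>e\<in>U. P e \<longleftrightarrow> c e \<in> A"
  using assms unfolding dfb_def by (elim exE conjE bexE)

lemma dfb_cong: "(\<And>e. e \<in> U \<Longrightarrow> P e \<longleftrightarrow> Q e) \<Longrightarrow> dfb U c P \<longleftrightarrow> dfb U c Q"
  unfolding dfb_def by simp

lemma dfb_transfer: "dfb U c P \<Longrightarrow> (\<And>e. e \<in> U \<Longrightarrow> P e \<longleftrightarrow> Q e) \<Longrightarrow> dfb U c Q"
  using dfb_cong by (rule iffD1)

text \<open>An empty set of environments does not determine the length of its encodings. Proofs that
  compare or subtract such lengths split this case off.\<close>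

lemma dfb_empty: "dfb {} c P"
  unfolding dfb_def using S_tup by auto

lemma dfb_conj:
  assumes "dfb U c P" "dfb U c Q"
  shows "dfb U c (\<lambda>e. P e \<and> Q e)"
proof (cases "U = {}")
  case False
  obtain N A where A: "\<forall>e\<in>U. length (c e) = N" "A \<in> S N" "\<forall>e\<in>U. P e \<longleftrightarrow> c e \<in> A"
    by (rule dfbE[OF assms(1)])
  obtain N' B where B: "\<forall>e\<in>U. length (c e) = N'" "B \<in> S N'" "\<forall>e\<in>U. Q e \<longleftrightarrow> c e \<in> B"
    by (rule dfbE[OF assms(2)])
  have "N' = N" using A(1) B(1) False by auto
  then show ?thesis using A B by (intro dfbI[of U c N "A \<inter> B"] S_Int) simp_all
qed (simp add: dfb_empty)

lemma dfb_not:
  assumes "dfb U c P"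
  shows "dfb U c (\<lambda>e. \<not> P e)"
proof -
  obtain N A where A: "\<forall>e\<in>U. length (c e) = N" "A \<in> S N" "\<forall>e\<in>U. P e \<longleftrightarrow> c e \<in> A"
    by (rule dfbE[OF assms])
  then show ?thesis by (intro dfbI[of U c N "tup N - A"] S_diff S_tup) simp_all
qed

lemma dfb_disj:
  assumes "dfb U c P" "dfb U c Q"
  shows "dfb U c (\<lambda>e. P e \<or> Q e)"
  using dfb_not[OF dfb_conj[OF dfb_not[OF assms(1)] dfb_not[OF assms(2)]]] by simp

lemma dfb_imp:
  assumes "dfb U c P" "dfb U c Q"
  shows "dfb U c (\<lambda>e. P e \<longrightarrow> Q e)"
  using dfb_disj[OF dfb_not[OF assms(1)] assms(2)] by simp

lemma dfb_iff:
  assumes "dfb U c P" "dfb U c Q"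
  shows "dfb U c (\<lambda>e. P e \<longleftrightarrow> Q e)"
  by (rule dfb_transfer[OF dfb_conj[OF dfb_imp[OF assms] dfb_imp[OF assms(2,1)]]]) auto

lemma dfb_const:
  assumes "\<And>e. e \<in> U \<Longrightarrow> length (c e) = N"
  shows "dfb U c (\<lambda>e. b)"
proof -
  have "(if b then tup N else tup N - tup N) \<in> S N" using S_diff[OF S_tup S_tup, of N] S_tup by simp
  then show ?thesis unfolding dfb_def using assms
    by (intro exI[of _ N] conjI bexI[of _ "if b then tup N else tup N - tup N"]) simp_all
qed

lemma dfb_length: "dfb U c P \<Longrightarrow> \<exists>N. \<forall>e\<in>U. length (c e) = N"
  unfolding dfb_def by (elim exE conjE) (rule exI)

lemma dfb_reindex:
  assumes "dfb U c P" and "\<And>v. v \<in> V \<Longrightarrow> g v \<in> U"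
    and "\<And>v. v \<in> V \<Longrightarrow> length (d v) = N" and "set ixs \<subseteq> {..<N}"
    and "\<And>v. v \<in> V \<Longrightarrow> c (g v) = map (nth (d v)) ixs"
  shows "dfb V d (\<lambda>v. P (g v))"
proof (cases "V = {}")
  case False
  obtain k A where A: "\<forall>e\<in>U. length (c e) = k" "A \<in> S k" "\<forall>e\<in>U. P e \<longleftrightarrow> c e \<in> A"
    by (rule dfbE[OF assms(1)])
  obtain v where "v \<in> V" using False by auto
  then have "length (map (nth (d v)) ixs) = k" using A(1)[THEN bspec, OF assms(2)] assms(5) by metis
  then have "length ixs = k" by simp
  then have "{x. length x = N \<and> map (nth x) ixs \<in> A} \<in> S N" using S_reindex A(2) assms(4) by simp
  then show ?thesis using assms(2,3,5) A(3)
    by (intro dfbI[of V d N "{x. length x = N \<and> map (nth x) ixs \<in> A}"]) simp_all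
qed (simp add: dfb_empty)

lemma dfb_weaken:
  assumes "dfb U c P" and "\<And>v. v \<in> V \<Longrightarrow> length (d v) = j"
  shows "dfb (U \<times> V) (\<lambda>p. c (fst p) @ d (snd p)) (\<lambda>p. P (fst p))"
proof -
  obtain N where N: "\<forall>e\<in>U. length (c e) = N" using dfb_length[OF assms(1)] by blast
  show ?thesis
    by (rule dfb_reindex[OF assms(1), where N = "N + j" and ixs = "[0..<N]"])
      (use N assms in \<open>auto simp: nth_append intro!: nth_equalityI\<close>)
qed

lemma dfb_weaken_mid:
  assumes "dfb (U \<times> W) (\<lambda>p. c (fst p) @ snd p) P"
    and "\<And>v. v \<in> V \<Longrightarrow> length (d v) = j" and "\<And>e. e \<in> U \<Longrightarrow> length (c e) = N"
    and "\<And>w. w \<in> W \<Longrightarrow> length w = k"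
  shows "dfb ((U \<times> V) \<times> W) (\<lambda>p. (c (fst (fst p)) @ d (snd (fst p))) @ snd p)
     (\<lambda>p. P (fst (fst p), snd p))"
  by (rule dfb_reindex[OF assms(1), where N = "N + j + k" and ixs = "[0..<N] @ [N + j..<N + j + k]"])
    (use assms in \<open>auto simp: nth_append intro!: nth_equalityI\<close>)

lemma dfb_ex_tup:
  assumes "dfb (U \<times> tup k) (\<lambda>p. c (fst p) @ snd p) (\<lambda>p. P (fst p) (snd p))"
  shows "dfb U c (\<lambda>e. \<exists>y\<in>tup k. P e y)"
proof (cases "U = {}")
  case False
  obtain N' A where A: "\<forall>p\<in>U \<times> tup k. length (c (fst p) @ snd p) = N'" "A \<in> S N'"
      "\<forall>p\<in>U \<times> tup k. P (fst p) (snd p) \<longleftrightarrow> c (fst p) @ snd p \<in> A"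
    by (rule dfbE[OF assms])
  \<comment> \<open>Any tuple of length \<open>k\<close> serves here; it only reveals the common
    length of the encodings of \<open>U\<close>.\<close>
  have N: "length (c e) + k = N'" if "e \<in> U" for e
    using A(1)[THEN bspec, of "(e, replicate k undefined)"] that by simp
  define N where "N = N' - k"
  have len: "length (c e) = N" if "e \<in> U" for e using N[OF that] N_def by simp
  obtain e where "e \<in> U" using False by auto
  then have "N' = N + k" using N[of e] len[of e] by simp
  then have "{x. length x = N \<and> (\<exists>y\<in>tup k. x @ y \<in> A)} \<in> S N" using S_project A(2) by simp
  moreover have "(\<exists>y\<in>tup k. P e y) \<longleftrightarrow> (\<exists>y\<in>tup k. c e @ y \<in> A)" if "e \<in> U" for e
    using A(3)[THEN bspec, of "(e, y)" for y] that by simp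
  ultimately show ?thesis using len
    by (intro dfbI[of U c N "{x. length x = N \<and> (\<exists>y\<in>tup k. x @ y \<in> A)}"]) simp_all
qed (simp add: dfb_empty)

lemma dfb_all_tup:
  assumes "dfb (U \<times> tup k) (\<lambda>p. c (fst p) @ snd p) (\<lambda>p. P (fst p) (snd p))"
  shows "dfb U c (\<lambda>e. \<forall>y\<in>tup k. P e y)"
  using dfb_not[OF dfb_ex_tup[OF dfb_not[OF assms]]] by simp

lemma dfb_scalar_tup:
  assumes "dfb (U \<times> UNIV) (\<lambda>p. c (fst p) @ [snd p]) P"
  shows "dfb (U \<times> tup 1) (\<lambda>p. c (fst p) @ snd p) (\<lambda>p. P (fst p, hd (snd p)))"
proof -
  have "[hd y] = y" if "length y = 1" for y :: "'a list" using that by (cases y) auto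
  moreover obtain N A where "\<forall>p\<in>U \<times> UNIV. length (c (fst p) @ [snd p]) = N" "A \<in> S N"
      "\<forall>p\<in>U \<times> UNIV. P p \<longleftrightarrow> c (fst p) @ [snd p] \<in> A"
    by (rule dfbE[OF assms])
  ultimately show ?thesis by (intro dfbI[of _ _ N A]) auto
qed

lemma dfb_ex:
  assumes "dfb (U \<times> UNIV) (\<lambda>p. c (fst p) @ [snd p]) (\<lambda>p. P (fst p) (snd p))"
  shows "dfb U c (\<lambda>e. \<exists>x. P e x)"
proof -
  have "(\<exists>y\<in>tup 1. P e (hd y)) \<longleftrightarrow> (\<exists>x. P e x)" for e
    by (metis in_tup length_Cons list.sel(1) list.size(3) One_nat_def)
  then show ?thesis
    using dfb_ex_tup[of U 1 c "\<lambda>e y. P e (hd y)"] dfb_scalar_tup[OF assms] by simp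
qed

lemma dfb_all:
  assumes "dfb (U \<times> UNIV) (\<lambda>p. c (fst p) @ [snd p]) (\<lambda>p. P (fst p) (snd p))"
  shows "dfb U c (\<lambda>e. \<forall>x. P e x)"
  using dfb_not[OF dfb_ex[OF dfb_not[OF assms]]] by simp

lemma dt_length: "dt U c k \<tau> \<Longrightarrow> e \<in> U \<Longrightarrow> length (\<tau> e) = k"
  unfolding dt_def by blast

lemma dt_context: 
  assumes "dt U c k \<tau>"
  shows "\<exists>N. \<forall>e\<in>U. length (c e) = N"
  using dfb_length[OF dfb_ex_tup[of U k c "\<lambda>e y. y = \<tau> e"]] assms unfolding dt_def by simp

text \<open>Substituting a term amounts to quantifying over a fresh variable tied to its graph, so
  function symbols need no separate treatment.\<close>

lemma dt_subst:
  assumes "dt U c k \<tau>" "dfb (U \<times> tup k) (\<lambda>p. c (fst p) @ snd p) (\<lambda>p. P (fst p) (snd p))"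
  shows "dfb U c (\<lambda>e. P e (\<tau> e))"
proof -
  have "dfb U c (\<lambda>e. \<exists>y\<in>tup k. y = \<tau> e \<and> P e y)"
    by (rule dfb_ex_tup, rule dfb_conj) (use assms in \<open>auto simp: dt_def\<close>)
  then show ?thesis by (rule dfb_transfer) (use assms in \<open>auto simp: dt_def\<close>)
qed

lemma dt_mem:
  assumes "A \<in> S k" "dt U c k \<tau>"
  shows "dfb U c (\<lambda>e. \<tau> e \<in> A)"
proof (rule dt_subst[OF assms(2)])
  obtain N where N: "\<forall>e\<in>U. length (c e) = N" using dt_context[OF assms(2)] by blast
  have "dfb (tup k) (\<lambda>x. x) (\<lambda>x. x \<in> A)" unfolding dfb_def using assms(1) by auto
  then show "dfb (U \<times> tup k) (\<lambda>p. c (fst p) @ snd p) (\<lambda>p. snd p \<in> A)"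
    by (rule dfb_reindex[where N = "N + k" and ixs = "[N..<N + k]"])
      (use N in \<open>auto simp: map_nth_append_right\<close>)
qed

lemma dt_weaken:
  assumes "dt U c k \<tau>" and "\<And>v. v \<in> V \<Longrightarrow> length (d v) = j"
  shows "dt (U \<times> V) (\<lambda>p. c (fst p) @ d (snd p)) k (\<lambda>p. \<tau> (fst p))"
proof -
  obtain N where N: "\<forall>e\<in>U. length (c e) = N" using dt_context[OF assms(1)] by blast
  have "dfb (U \<times> tup k) (\<lambda>p. c (fst p) @ snd p) (\<lambda>p. snd p = \<tau> (fst p))"
    using assms(1) unfolding dt_def by blast
  from dfb_weaken_mid[OF this, of V d j N k] show ?thesis
    using assms N unfolding dt_def by simp
qed

lemma dt_fst_tup: 
  "dt U c k \<tau> \<Longrightarrow> dt (U \<times> tup j) (\<lambda>p. c (fst p) @ snd p) k (\<lambda>p. \<tau> (fst p))"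
  by (rule dt_weaken[where d = "\<lambda>x. x"]) auto

lemma dt_fst:
  "dt U c k \<tau> \<Longrightarrow> dt (U \<times> UNIV) (\<lambda>p. c (fst p) @ [snd p]) k (\<lambda>p. \<tau> (fst p))"
  by (rule dt_weaken[where d = "\<lambda>x. [x]" and j = 1]) auto

lemma dt_coords:
  assumes "\<And>e. e \<in> U \<Longrightarrow> length (c e) = N" "length ixs = k" "set ixs \<subseteq> {..<N}"
  shows "dt U c k (\<lambda>e. map (nth (c e)) ixs)"
proof -
  have "{z. length z = N + k \<and> map (nth z) [N..<N + k] = map (nth z) ixs} \<in> S (N + k)"
    by (rule S_coord_eq) (use assms in auto)
  moreover have "(x @ y \<in> {z. length z = N + k \<and> map (nth z) [N..<N + k] = map (nth z) ixs}) \<longleftrightarrow>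
      y = map (nth x) ixs" if "length x = N" "length y = k" for x y :: "'a list"
  proof -
    have "map (nth (x @ y)) ixs = map (nth x) ixs"
      using that assms by (intro map_nth_append_left) auto
    then show ?thesis using that map_nth_append_right[of x N y k] by (simp del: map_eq_conv)
  qed
  ultimately have "dfb (U \<times> tup k) (\<lambda>p. c (fst p) @ snd p) (\<lambda>p. snd p = map (nth (c (fst p))) ixs)"
    unfolding dfb_def using assms(1)
    by (intro exI[of _ "N + k"] conjI
        bexI[of _ "{z. length z = N + k \<and> map (nth z) [N..<N + k] = map (nth z) ixs}"]) auto
  then show ?thesis unfolding dt_def using assms by simp
qed

lemma dt_cong:
  assumes "\<And>e. e \<in> U \<Longrightarrow> \<tau> e = \<sigma> e"
  shows "dt U c k \<tau> \<longleftrightarrow> dt U c k \<sigma>"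
proof -
  have "dfb (U \<times> tup k) (\<lambda>p. c (fst p) @ snd p) (\<lambda>p. snd p = \<tau> (fst p)) \<longleftrightarrow>
      dfb (U \<times> tup k) (\<lambda>p. c (fst p) @ snd p) (\<lambda>p. snd p = \<sigma> (fst p))"
    by (rule dfb_cong) (use assms in auto)
  then show ?thesis unfolding dt_def using assms by simp
qed

lemma dt_self: "dt (tup k) (\<lambda>x. x) k (\<lambda>x. x)"
proof (rule dt_cong[THEN iffD1])
  show "dt (tup k) (\<lambda>x. x) k (\<lambda>x. map (nth x) [0..<k])" by (rule dt_coords[where N = k]) auto
qed (auto simp: map_nth)

lemma dt_snd_slice:
  assumes "\<And>e. e \<in> U \<Longrightarrow> length (c e) = N" "\<And>v. v \<in> V \<Longrightarrow> length (d v) = j" "i + k \<le> j"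
  shows "dt (U \<times> V) (\<lambda>p. c (fst p) @ d (snd p)) k (\<lambda>p. take k (drop i (d (snd p))))"
proof -
  have "dt (U \<times> V) (\<lambda>p. c (fst p) @ d (snd p)) k
      (\<lambda>p. map (nth (c (fst p) @ d (snd p))) [N + i..<N + i + k])"
    by (rule dt_coords[where N = "N + j"]) (use assms in auto)
  moreover have "map (nth (x @ y)) [N + i..<N + i + k] = take k (drop i y)"
    if "length x = N" "length y = j" for x y :: "'a list"
    by (rule nth_equalityI) (use that assms(3) in \<open>auto simp: nth_append\<close>)
  ultimately show ?thesis using assms by (subst dt_cong) auto
qed

end

section \<open>Rules that derive definability from the shape of a formula\<close>

named_theorems dfi

context fo_structure
begin

definition ctx :: "'e set \<Rightarrow> ('e \<Rightarrow> 'a list) \<Rightarrow> bool" where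
  "ctx U c \<longleftrightarrow> (\<exists>N. \<forall>e\<in>U. length (c e) = N)"

text \<open>Hiding the arity leaves nothing to instantiate when the rules in \<open>dfi\<close> are
  applied by resolution. Where arities matter, as in \<open>dtm_mem\<close> and
  \<open>dtm_eq\<close>, a mismatch makes the predicate constantly false.\<close>

definition dtm :: "'e set \<Rightarrow> ('e \<Rightarrow> 'a list) \<Rightarrow> ('e \<Rightarrow> 'a list) \<Rightarrow> bool" where
  "dtm U c \<tau> \<longleftrightarrow> (\<exists>k. dt U c k \<tau>)"

definition dts :: "'e set \<Rightarrow> ('e \<Rightarrow> 'a list) \<Rightarrow> ('e \<Rightarrow> 'a) \<Rightarrow> bool" where
  "dts U c \<tau> \<longleftrightarrow> dt U c 1 (\<lambda>e. [\<tau> e])"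

lemma ctx_tup [dfi]: "ctx (tup k) (\<lambda>x. x)"
  and ctx_scalar [dfi]: "ctx UNIV (\<lambda>x. [x])"
  and ctx_ext_tup [dfi]: "ctx U c \<Longrightarrow> ctx (U \<times> tup k) (\<lambda>p. c (fst p) @ snd p)"
  and ctx_ext [dfi]: "ctx U c \<Longrightarrow> ctx (U \<times> UNIV) (\<lambda>p. c (fst p) @ [snd p])"
  unfolding ctx_def by fastforce+

lemma dfb_ctx: "dfb U c P \<Longrightarrow> ctx U c"
  unfolding ctx_def by (rule dfb_length)

lemma dt_ctx: "dt U c k \<tau> \<Longrightarrow> ctx U c"
  unfolding ctx_def by (rule dt_context)

lemma dtm_ctx: "dtm U c \<tau> \<Longrightarrow> ctx U c"
  unfolding dtm_def using dt_ctx by blast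

lemma dts_ctx: "dts U c \<tau> \<Longrightarrow> ctx U c"
  unfolding dts_def using dt_ctx by blast

lemma dfb_triv [dfi]: "ctx U c \<Longrightarrow> dfb U c (\<lambda>e. b)"
  unfolding ctx_def by (elim exE) (rule dfb_const, simp)

lemmas [dfi] = dfb_conj dfb_disj dfb_not dfb_imp dfb_iff dfb_ex dfb_all S_tup

lemma dtmE: "dtm U c \<tau> \<Longrightarrow> (\<And>e. e \<in> U \<Longrightarrow> length (\<tau> e) = k) \<Longrightarrow> U \<noteq> {} \<Longrightarrow> dt U c k \<tau>"
  unfolding dtm_def using dt_length by fastforce

lemma dt_empty: "dt {} c k \<tau>"
  unfolding dt_def by (simp add: dfb_empty)

lemma dtm_dt: "dtm U c \<tau> \<Longrightarrow> (\<And>e. e \<in> U \<Longrightarrow> length (\<tau> e) = k) \<Longrightarrow> dt U c k \<tau>"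
  by (cases "U = {}") (auto simp: dt_empty intro: dtmE)

lemma dtm_mem [dfi]:
  assumes "A \<in> S k" "dtm U c \<tau>"
  shows "dfb U c (\<lambda>e. \<tau> e \<in> A)"
proof -
  obtain j where j: "dt U c j \<tau>" using assms(2) unfolding dtm_def by blast
  show ?thesis
  proof (cases "j = k")
    case True
    then show ?thesis using dt_mem[OF assms(1)] j by simp
  next
    case False
    have "\<tau> e \<notin> A" if "e \<in> U" for e
      using dt_length[OF j that] S_length[OF assms(1), of "\<tau> e"] False by auto
    then show ?thesis by (intro dfb_transfer[OF dfb_triv[OF dt_ctx[OF j], of False]]) simp
  qed
qed

lemma dfb_tup_iff: "dfb (tup k) (\<lambda>x. x) P \<longleftrightarrow> {x. length x = k \<and> P x} \<in> S k"
proof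
  assume "dfb (tup k) (\<lambda>x. x) P"
  then obtain N A where A: "\<forall>x\<in>tup k. length (x :: 'a list) = N" "A \<in> S N" "\<forall>x\<in>tup k. P x \<longleftrightarrow> x \<in> A"
    by (rule dfbE)
  have "length (replicate k undefined :: 'a list) = N" by (rule bspec[OF A(1)]) simp
  then have k: "N = k" by simp
  have "{x. length x = k \<and> P x} = A"
  proof (intro set_eqI iffI)
    fix x assume "x \<in> {x. length x = k \<and> P x}"
    then show "x \<in> A" using bspec[OF A(3), of x] by simp
  next
    fix x assume x: "x \<in> A"
    then have "length x = k" using S_length[OF A(2)] k by simp
    then show "x \<in> {x. length x = k \<and> P x}" using bspec[OF A(3), of x] x by simp
  qed
  then show "{x. length x = k \<and> P x} \<in> S k" using A(2) k by simp
next
  assume "{x. length x = k \<and> P x} \<in> S k"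
  then show "dfb (tup k) (\<lambda>x. x) P"
    by (intro dfbI[of _ _ k "{x. length x = k \<and> P x}"]) simp_all
qed

lemma dfb_pred:
  assumes "dfb (tup k) (\<lambda>x. x) P" "dtm U c \<tau>" "\<And>e. e \<in> U \<Longrightarrow> length (\<tau> e) = k"
  shows "dfb U c (\<lambda>e. P (\<tau> e))"
proof -
  have "dfb U c (\<lambda>e. \<tau> e \<in> {x. length x = k \<and> P x})"
    using assms(1,2) unfolding dfb_tup_iff by (rule dtm_mem)
  then show ?thesis by (rule dfb_transfer) (use assms(3) in auto)
qed

lemma dfb_ball [dfi]:
  assumes "I \<in> S k" "dfb (U \<times> tup k) (\<lambda>p. c (fst p) @ snd p) (\<lambda>p. P (fst p) (snd p))"
  shows "dfb U c (\<lambda>e. \<forall>y\<in>I. P e y)"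
proof -
  have "ctx (U \<times> tup k) (\<lambda>p. c (fst p) @ snd p)" by (rule dfb_ctx[OF assms(2)])
  moreover have "dt (U \<times> tup k) (\<lambda>p. c (fst p) @ snd p) k (\<lambda>p. take k (drop 0 (snd p)))"
  proof (cases "U = {}")
    case False
    have "dfb U c (\<lambda>e. \<exists>y\<in>tup k. P e y)" using assms(2) by (rule dfb_ex_tup)
    then obtain N where "\<forall>e\<in>U. length (c e) = N" using dfb_length by blast
    then show ?thesis using dt_snd_slice[of U c N "tup k" "\<lambda>x. x" k 0 k] by auto
  qed (simp add: dt_empty)
  ultimately have "dt (U \<times> tup k) (\<lambda>p. c (fst p) @ snd p) k (\<lambda>p. snd p)"
    by (subst dt_cong[where \<sigma> = "\<lambda>p. take k (drop 0 (snd p))"]) auto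
  then have "dfb (U \<times> tup k) (\<lambda>p. c (fst p) @ snd p) (\<lambda>p. snd p \<in> I \<longrightarrow> P (fst p) (snd p))"
    by (intro dfb_imp dt_mem[OF assms(1)] assms(2))
  then have "dfb U c (\<lambda>e. \<forall>y\<in>tup k. y \<in> I \<longrightarrow> P e y)" by (rule dfb_all_tup)
  then show ?thesis by (rule dfb_transfer) (use S_length[OF assms(1)] in auto)
qed

lemma dfb_bex [dfi]:
  assumes "I \<in> S k" "dfb (U \<times> tup k) (\<lambda>p. c (fst p) @ snd p) (\<lambda>p. P (fst p) (snd p))"
  shows "dfb U c (\<lambda>e. \<exists>y\<in>I. P e y)"
  using dfb_not[OF dfb_ball[OF assms(1) dfb_not[OF assms(2)]]] by simp

lemma dtm_snd [dfi]:
  assumes "ctx U c"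
  shows "dtm (U \<times> tup k) (\<lambda>p. c (fst p) @ snd p) (\<lambda>p. snd p)"
proof -
  obtain N where "\<forall>e\<in>U. length (c e) = N" using assms unfolding ctx_def by blast
  then have "dt (U \<times> tup k) (\<lambda>p. c (fst p) @ snd p) k (\<lambda>p. take k (drop 0 (snd p)))"
    using dt_snd_slice[of U c N "tup k" "\<lambda>x. x" k 0 k] by auto
  then have "dt (U \<times> tup k) (\<lambda>p. c (fst p) @ snd p) k (\<lambda>p. snd p)"
    by (subst dt_cong[where \<sigma> = "\<lambda>p. take k (drop 0 (snd p))"]) auto
  then show ?thesis unfolding dtm_def by blast
qed

lemma dts_snd [dfi]:
  assumes "ctx U c"
  shows "dts (U \<times> UNIV) (\<lambda>p. c (fst p) @ [snd p]) (\<lambda>p. snd p)"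
proof -
  obtain N where "\<forall>e\<in>U. length (c e) = N" using assms unfolding ctx_def by blast
  then have "dt (U \<times> UNIV) (\<lambda>p. c (fst p) @ [snd p]) 1 (\<lambda>p. take 1 (drop 0 [snd p]))"
    using dt_snd_slice[of U c N UNIV "\<lambda>x. [x]" 1 0 1] by auto
  then show ?thesis unfolding dts_def by simp
qed

lemma dtm_fst [dfi]: "dtm U c \<tau> \<Longrightarrow> dtm (U \<times> tup j) (\<lambda>p. c (fst p) @ snd p) (\<lambda>p. \<tau> (fst p))"
  and dtm_fst' [dfi]: "dtm U c \<tau> \<Longrightarrow> dtm (U \<times> UNIV) (\<lambda>p. c (fst p) @ [snd p]) (\<lambda>p. \<tau> (fst p))"
  and dts_fst [dfi]: "dts U c \<sigma> \<Longrightarrow> dts (U \<times> tup j) (\<lambda>p. c (fst p) @ snd p) (\<lambda>p. \<sigma> (fst p))"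
  and dts_fst' [dfi]: "dts U c \<sigma> \<Longrightarrow> dts (U \<times> UNIV) (\<lambda>p. c (fst p) @ [snd p]) (\<lambda>p. \<sigma> (fst p))"
  unfolding dtm_def dts_def using dt_fst_tup dt_fst by blast+

lemma dtm_self [dfi]: "dtm (tup k) (\<lambda>x. x) (\<lambda>x. x)"
  unfolding dtm_def using dt_self by blast

lemma dts_self [dfi]: "dts UNIV (\<lambda>x. [x]) (\<lambda>x. x)"
  using dt_coords[of UNIV "\<lambda>x. [x]" 1 "[0]" 1] unfolding dts_def by simp

lemma dtm_eq [dfi]:
  assumes "dtm U c \<tau>" "dtm U c \<sigma>"
  shows "dfb U c (\<lambda>e. \<tau> e = \<sigma> e)"
proof -
  obtain k j where kj: "dt U c k \<tau>" "dt U c j \<sigma>" using assms unfolding dtm_def by blast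
  show ?thesis
  proof (cases "j = k")
    case True
    then have "dfb (U \<times> tup k) (\<lambda>p. c (fst p) @ snd p) (\<lambda>p. snd p = \<sigma> (fst p))"
      using kj(2) unfolding dt_def by simp
    then show ?thesis by (rule dt_subst[OF kj(1)])
  next
    case False
    have "\<tau> e \<noteq> \<sigma> e" if "e \<in> U" for e using dt_length kj that False by metis
    then show ?thesis by (intro dfb_transfer[OF dfb_triv[OF dt_ctx[OF kj(1)], of False]]) simp
  qed
qed

lemma dtmI_graph:
  assumes "dfb (U \<times> tup k) (\<lambda>p. c (fst p) @ snd p) (\<lambda>p. P (fst p) (snd p))"
    and "\<And>e. e \<in> U \<Longrightarrow> length (\<tau> e) = k"
    and "\<And>e y. e \<in> U \<Longrightarrow> length y = k \<Longrightarrow> P e y \<longleftrightarrow> y = \<tau> e"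
  shows "dtm U c \<tau>"
proof -
  have "dfb (U \<times> tup k) (\<lambda>p. c (fst p) @ snd p) (\<lambda>p. snd p = \<tau> (fst p))"
    using assms(1) by (rule dfb_transfer) (use assms(3) in auto)
  then show ?thesis unfolding dtm_def dt_def using assms(2) by (intro exI[of _ k]) simp
qed

lemma dts_eq [dfi]: "dts U c \<tau> \<Longrightarrow> dts U c \<sigma> \<Longrightarrow> dfb U c (\<lambda>e. \<tau> e = \<sigma> e)"
  using dtm_eq[of U c "\<lambda>e. [\<tau> e]" "\<lambda>e. [\<sigma> e]"] unfolding dts_def dtm_def by auto

lemma dtm_single [dfi]: "dts U c \<tau> \<Longrightarrow> dtm U c (\<lambda>e. [\<tau> e])"
  unfolding dts_def dtm_def by blast

lemma dts_single: "dtm U c (\<lambda>e. [\<tau> e]) \<Longrightarrow> dts U c \<tau>"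
  unfolding dts_def by (rule dtm_dt) auto

lemma dtm_slice:
  assumes "dtm U c \<tau>" "\<And>e. e \<in> U \<Longrightarrow> length (\<tau> e) = j" "i + k \<le> j"
  shows "dtm U c (\<lambda>e. take k (drop i (\<tau> e)))"
proof -
  have t: "dt U c j \<tau>" using dtm_dt assms by blast
  obtain N where N: "\<forall>e\<in>U. length (c e) = N" using dt_ctx[OF t] unfolding ctx_def by blast
  have "dtm ((U \<times> tup k) \<times> tup j) (\<lambda>p. (c (fst (fst p)) @ snd (fst p)) @ snd p)
      (\<lambda>p. take k (drop i (snd p)))"
    unfolding dtm_def
    using dt_snd_slice[of "U \<times> tup k" "\<lambda>p. c (fst p) @ snd p" "N + k" "tup j" "\<lambda>x. x" j i k]
      N assms(3) by auto
  then have "dfb (U \<times> tup k) (\<lambda>p. c (fst p) @ snd p)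
      (\<lambda>p. \<exists>z\<in>tup j. z = \<tau> (fst p) \<and> take k (drop i z) = snd p)"
    by (intro dfb_bex[OF S_tup] dfb_conj dtm_eq dtm_snd dtm_fst assms(1) ctx_ext_tup dt_ctx[OF t])
  then show ?thesis
    by (rule dtmI_graph) (use assms in auto)
qed

lemma dtm_append [dfi]:
  assumes "dtm U c \<tau>" "dtm U c \<sigma>"
  shows "dtm U c (\<lambda>e. \<tau> e @ \<sigma> e)"
proof -
  obtain k j where kj: "dt U c k \<tau>" "dt U c j \<sigma>" using assms unfolding dtm_def by blast
  have ctx: "ctx U c" using dtm_ctx assms by blast
  show ?thesis
  proof (rule dtmI_graph)
    show "dfb (U \<times> tup (k + j)) (\<lambda>p. c (fst p) @ snd p)
      (\<lambda>p. take k (drop 0 (snd p)) = \<tau> (fst p) \<and> take j (drop k (snd p)) = \<sigma> (fst p))"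
      by (intro dfb_conj dtm_eq dtm_slice[where j = "k + j"] dtm_snd dtm_fst ctx assms) auto
  qed (use dt_length[OF kj(1)] dt_length[OF kj(2)] append_take_drop_id in \<open>auto, metis\<close>)
qed

lemma dtm_nil [dfi]:
  assumes "ctx U c"
  shows "dtm U c (\<lambda>e. [])"
  by (rule dtmI_graph[where k = 0 and P = "\<lambda>_ _. True"]) (intro dfi assms, auto)

lemma dtm_cons [dfi]:
  assumes "dts U c \<tau>" "dtm U c \<sigma>"
  shows "dtm U c (\<lambda>e. \<tau> e # \<sigma> e)"
  using dtm_append[OF dtm_single[OF assms(1)] assms(2)] by simp

lemma dts_nth:
  assumes "dtm U c \<tau>" "\<And>e. e \<in> U \<Longrightarrow> length (\<tau> e) = j" "i < j"
  shows "dts U c (\<lambda>e. \<tau> e ! i)"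
proof (rule dts_single)
  have "dtm U c (\<lambda>e. take 1 (drop i (\<tau> e)))" by (rule dtm_slice) (use assms in auto)
  then have "dt U c 1 (\<lambda>e. take 1 (drop i (\<tau> e)))" by (rule dtm_dt) (use assms in auto)
  then have "dt U c 1 (\<lambda>e. [\<tau> e ! i])"
    by (rule dt_cong[THEN iffD1, rotated]) (use assms in \<open>auto simp: take_Suc hd_drop_conv_nth\<close>)
  then show "dtm U c (\<lambda>e. [\<tau> e ! i])" unfolding dtm_def by blast
qed

lemma dtm_app:
  assumes "dtm (tup k) (\<lambda>x. x) f" "dtm U c \<tau>" "\<And>e. e \<in> U \<Longrightarrow> length (\<tau> e) = k"
  shows "dtm U c (\<lambda>e. f (\<tau> e))"
proof -
  obtain n where f: "dt (tup k) (\<lambda>x. x) n f" using assms(1) unfolding dtm_def by blast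
  have ctx: "ctx U c" by (rule dtm_ctx[OF assms(2)])
  have "dfb (tup k \<times> tup n) (\<lambda>p. fst p @ snd p) (\<lambda>p. snd p = f (fst p))"
    using f unfolding dt_def by simp
  then obtain N A where A: "\<forall>p\<in>tup k \<times> tup n. length (fst p @ snd p :: 'a list) = N" "A \<in> S N"
      "\<forall>p\<in>tup k \<times> tup n. snd p = f (fst p) \<longleftrightarrow> fst p @ snd p \<in> A"
    by (rule dfbE)
  show ?thesis
  proof (rule dtmI_graph)
    show "dfb (U \<times> tup n) (\<lambda>p. c (fst p) @ snd p) (\<lambda>p. \<tau> (fst p) @ snd p \<in> A)"
      by (intro dfi dtm_mem[OF A(2)] assms(2) ctx)
  qed (use A(3) assms(3) dt_length[OF f] in auto)
qed

text \<open>The index \<open>i\<close> is no variable of the structure, so the conjunction is built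
  one conjunct at a time. It expresses conditions on all coordinates of a tuple.\<close>

lemma dfb_finite_all:
  assumes "ctx U c" "\<And>i. i < (n::nat) \<Longrightarrow> dfb U c (P i)"
  shows "dfb U c (\<lambda>e. \<forall>i<n. P i e)"
  using assms(2)
proof (induction n)
  case 0
  then show ?case using dfb_triv[OF assms(1), of True] by simp
next
  case (Suc n)
  then have "dfb U c (\<lambda>e. (\<forall>i<n. P i e) \<and> P n e)" by (intro dfb_conj) auto
  then show ?case by (rule dfb_transfer) (auto simp: less_Suc_eq)
qed

lemma dtm_if [dfi]:
  assumes "dfb U c P" "dtm U c \<tau>" "dtm U c \<sigma>" "\<And>e. e \<in> U \<Longrightarrow> length (\<tau> e) = length (\<sigma> e)"
  shows "dtm U c (\<lambda>e. if P e then \<tau> e else \<sigma> e)"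
proof -
  obtain k where k: "dt U c k \<tau>" using assms unfolding dtm_def by blast
  have ctx: "ctx U c" using dtm_ctx assms by blast
  have P: "dfb (U \<times> tup k) (\<lambda>p. c (fst p) @ snd p) (\<lambda>p. P (fst p))"
    by (rule dfb_weaken[where d = "\<lambda>x. x"]) (use assms in auto)
  have "dfb (U \<times> tup k) (\<lambda>p. c (fst p) @ snd p)
      (\<lambda>p. (P (fst p) \<longrightarrow> snd p = \<tau> (fst p)) \<and> (\<not> P (fst p) \<longrightarrow> snd p = \<sigma> (fst p)))"
    by (intro dfi P assms ctx)
  then show ?thesis
    by (rule dtmI_graph) (use dt_length[OF k] assms(4) in auto)
qed

lemma dts_if [dfi]:
  assumes "dfb U c P" "dts U c \<tau>" "dts U c \<sigma>"
  shows "dts U c (\<lambda>e. if P e then \<tau> e else \<sigma> e)"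
proof (rule dts_single)
  have "dtm U c (\<lambda>e. if P e then [\<tau> e] else [\<sigma> e])" by (intro dfi assms) simp
  then show "dtm U c (\<lambda>e. [if P e then \<tau> e else \<sigma> e])" by (simp only: if_distrib[of "\<lambda>x. [x]"])
qed

lemma dfb_pair:
  assumes "dfb (tup k \<times> tup j) (\<lambda>p. fst p @ snd p) (\<lambda>p. P (fst p) (snd p))"
    "dtm U c \<tau>" "dtm U c \<sigma>" "\<And>e. e \<in> U \<Longrightarrow> length (\<tau> e) = k" "\<And>e. e \<in> U \<Longrightarrow> length (\<sigma> e) = j"
  shows "dfb U c (\<lambda>e. P (\<tau> e) (\<sigma> e))"
proof -
  obtain N A where A: "\<forall>p\<in>tup k \<times> tup j. length (fst p @ snd p :: 'a list) = N" "A \<in> S N"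
      "\<forall>p\<in>tup k \<times> tup j. P (fst p) (snd p) \<longleftrightarrow> fst p @ snd p \<in> A"
    by (rule dfbE[OF assms(1)])
  have "dfb U c (\<lambda>e. \<tau> e @ \<sigma> e \<in> A)" by (intro dfi dtm_mem[OF A(2)] assms)
  then show ?thesis by (rule dfb_transfer) (use A(3) assms in auto)
qed

end

section \<open>Order, group and local o-minimality\<close>

context fo_structure
begin

lemma dtm_enc [dfi]: "ctx U c \<Longrightarrow> dtm U c c"
proof -
  assume "ctx U c"
  then obtain N where N: "\<forall>e\<in>U. length (c e) = N" unfolding ctx_def by blast
  have "dt U c N (\<lambda>e. map (nth (c e)) [0..<N])" by (rule dt_coords) (use N in auto)
  then have "dt U c N c" by (rule dt_cong[THEN iffD1, rotated]) (use N in \<open>auto simp: map_nth\<close>)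
  then show ?thesis unfolding dtm_def by blast
qed

text \<open>The environment \<open>g v\<close> need not select coordinates of \<open>v\<close>; it
  is enough that its encoding is a definable tuple over \<open>V\<close>. The variants below let a
  premise about one bound variable be reused beneath further quantifiers.\<close>

lemma dfb_lift0:
  assumes "dfb U c P" "dtm V d (\<lambda>v. c (g v))" "\<And>v. v \<in> V \<Longrightarrow> g v \<in> U"
  shows "dfb V d (\<lambda>v. P (g v))"
proof -
  obtain N A where A: "\<forall>e\<in>U. length (c e) = N" "A \<in> S N" "\<forall>e\<in>U. P e \<longleftrightarrow> c e \<in> A"
    by (rule dfbE[OF assms(1)])
  have "dfb V d (\<lambda>v. c (g v) \<in> A)" by (rule dtm_mem[OF A(2) assms(2)])
  then show ?thesis by (rule dfb_transfer) (use A(3) assms(3) in simp)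
qed

lemma dfb_lift:
  assumes "dfb (U \<times> UNIV) (\<lambda>p. c (fst p) @ [snd p]) (\<lambda>p. P (fst p) (snd p))"
    "dtm V d (\<lambda>v. c (g v))" "\<And>v. v \<in> V \<Longrightarrow> g v \<in> U" "dts V d \<sigma>"
  shows "dfb V d (\<lambda>v. P (g v) (\<sigma> v))"
  using dfb_lift0[OF assms(1), of V d "\<lambda>v. (g v, \<sigma> v)"] assms(2-4) by (simp add: dfi)

lemma dfb_lift_tup:
  assumes "dfb (U \<times> tup k) (\<lambda>p. c (fst p) @ snd p) (\<lambda>p. P (fst p) (snd p))"
    "dtm V d (\<lambda>v. c (g v))" "\<And>v. v \<in> V \<Longrightarrow> g v \<in> U" "dtm V d \<sigma>"
    "\<And>v. v \<in> V \<Longrightarrow> length (\<sigma> v) = k"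
  shows "dfb V d (\<lambda>v. P (g v) (\<sigma> v))"
  using dfb_lift0[OF assms(1), of V d "\<lambda>v. (g v, \<sigma> v)"] assms(2-5) by (simp add: dfi)

lemma dtsI_graph:
  assumes "dfb (U \<times> UNIV) (\<lambda>p. c (fst p) @ [snd p]) (\<lambda>p. P (fst p) (snd p))"
    and "\<And>e y. e \<in> U \<Longrightarrow> P e y \<longleftrightarrow> y = \<tau> e"
  shows "dts U c \<tau>"
proof (rule dts_single, rule dtmI_graph)
  show "dfb (U \<times> tup 1) (\<lambda>p. c (fst p) @ snd p) (\<lambda>p. P (fst p) (hd (snd p)))"
    using dfb_scalar_tup[OF assms(1)] by simp
  show "P e (hd y) \<longleftrightarrow> y = [\<tau> e]" if "e \<in> U" "length y = 1" for e y
    using that assms(2) by (cases y) auto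
qed simp

lemma definable1_iff: "definable1 S {x. P x} \<longleftrightarrow> dfb UNIV (\<lambda>x. [x]) P"
proof
  assume "definable1 S {x. P x}"
  then show "dfb UNIV (\<lambda>x. [x]) P"
    unfolding definable1_def by (intro dfbI[of _ _ 1 "(\<lambda>y. [y]) ` {x. P x}"]) auto
next
  assume P: "dfb UNIV (\<lambda>x. [x]) P"
  have "dfb (tup 1) (\<lambda>x. x) (\<lambda>x. P (hd x))"
  proof (rule dfb_lift0[OF P])
    have "dtm (tup 1) (\<lambda>x. x) (\<lambda>x. x)" by (rule dfi)
    then show "dtm (tup 1) (\<lambda>x. x) (\<lambda>v. [hd v])"
      unfolding dtm_def
      by (elim exE, intro exI) (erule dt_cong[THEN iffD1, rotated], auto simp: length_Suc_conv)
  qed simp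
  then have "{x. length x = 1 \<and> P (hd x)} \<in> S 1" by (simp add: dfb_tup_iff)
  moreover have "{x. length x = 1 \<and> P (hd x)} = (\<lambda>y. [y]) ` {x. P x}"
    by (auto simp: length_Suc_conv image_iff)
  ultimately show "definable1 S {x. P x}" unfolding definable1_def by simp
qed

end

section \<open>One-sided germs of predicates on the line\<close>

definition evr :: "'a::linorder \<Rightarrow> ('a \<Rightarrow> bool) \<Rightarrow> bool" where
  "evr x P \<longleftrightarrow> (\<exists>y>x. \<forall>z. x < z \<and> z < y \<longrightarrow> P z)"

definition evl :: "'a::linorder \<Rightarrow> ('a \<Rightarrow> bool) \<Rightarrow> bool" where
  "evl x P \<longleftrightarrow> (\<exists>y<x. \<forall>z. y < z \<and> z < x \<longrightarrow> P z)"

lemma evr_mono: "evr x P \<Longrightarrow> (\<And>z. x < z \<Longrightarrow> P z \<Longrightarrow> Q z) \<Longrightarrow> evr x Q"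
  unfolding evr_def by blast

lemma evl_mono: "evl x P \<Longrightarrow> (\<And>z. z < x \<Longrightarrow> P z \<Longrightarrow> Q z) \<Longrightarrow> evl x Q"
  unfolding evl_def by blast

lemma evr_conj: "evr x P \<Longrightarrow> evr x Q \<Longrightarrow> evr x (\<lambda>z. P z \<and> Q z)"
proof -
  assume "evr x P" "evr x Q"
  then obtain y y' where "y > x" "\<forall>z. x < z \<and> z < y \<longrightarrow> P z" "y' > x" "\<forall>z. x < z \<and> z < y' \<longrightarrow> Q z"
    unfolding evr_def by blast
  then show ?thesis unfolding evr_def by (intro exI[of _ "min y y'"]) auto
qed

lemma evl_conj: "evl x P \<Longrightarrow> evl x Q \<Longrightarrow> evl x (\<lambda>z. P z \<and> Q z)"
proof -
  assume "evl x P" "evl x Q"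
  then obtain y y' where "y < x" "\<forall>z. y < z \<and> z < x \<longrightarrow> P z" "y' < x" "\<forall>z. y' < z \<and> z < x \<longrightarrow> Q z"
    unfolding evl_def by blast
  then show ?thesis unfolding evl_def by (intro exI[of _ "max y y'"]) auto
qed

lemma evr_ex: "evr x P \<Longrightarrow> x < (b::'a::dense_linorder) \<Longrightarrow> \<exists>z. x < z \<and> z < b \<and> P z"
  unfolding evr_def by (metis dense min_less_iff_conj)

lemma evl_ex: "evl x P \<Longrightarrow> (b::'a::dense_linorder) < x \<Longrightarrow> \<exists>z. b < z \<and> z < x \<and> P z"
  unfolding evl_def by (metis dense max_less_iff_conj)

lemma evr_less: "x < b \<Longrightarrow> evr x (\<lambda>z. z < b)"
  unfolding evr_def by blast

text \<open>The group is written additively but may be noncommutative. Hence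
  \<open>add_mono_both\<close> translates on both sides, and differences appear as
  \<open>- p + c\<close> where the side matters.\<close>

locale dclom = fo_structure S
  for S :: "nat \<Rightarrow> ('a::{group_add, dense_linorder, no_top, no_bot}) list set set" +
  assumes grp: "expands_ordered_group S"
    and add_mono_both: "\<forall>x y z::'a. x < y \<longrightarrow> x + z < y + z \<and> z + x < z + y"
    and lom: "locally_o_minimal S"
    and dcomp: "definably_complete S"
begin

lemma add_less_r: "(x::'a) < y \<Longrightarrow> x + z < y + z"
  and add_less_l: "(x::'a) < y \<Longrightarrow> z + x < z + y"
  using add_mono_both by blast+

lemma add_le_r: "(x::'a) \<le> y \<Longrightarrow> x + z \<le> y + z"
  and add_le_l: "(x::'a) \<le> y \<Longrightarrow> z + x \<le> z + y"
  using add_less_r add_less_l by (auto simp: le_less)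

lemma neg_less [simp]: "- x < - y \<longleftrightarrow> y < (x::'a)"
proof -
  have *: "- x < - y" if "y < x" for x y :: 'a
    using add_less_r[OF add_less_l[OF that, of "- x"], of "- y"] by (simp add: add.assoc)
  show ?thesis using * *[of "- x" "- y"] by auto
qed

lemma neg_le [simp]: "- x \<le> - y \<longleftrightarrow> y \<le> (x::'a)"
  by (auto simp: le_less)

lemma neg_less_iff: "- x < y \<longleftrightarrow> - y < (x::'a)" "x < - y \<longleftrightarrow> y < - (x::'a)"
  using neg_less[of x "- y"] neg_less[of "- x" y] by auto

lemma neg_le_iff: "- x \<le> y \<longleftrightarrow> - y \<le> (x::'a)" "x \<le> - y \<longleftrightarrow> y \<le> - (x::'a)"
  using neg_le[of x "- y"] neg_le[of "- x" y] by auto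

lemma neg_pos [simp]: "0 < - x \<longleftrightarrow> (x::'a) < 0" "0 \<le> - x \<longleftrightarrow> (x::'a) \<le> 0"
  using neg_less_iff(2)[of 0 x] neg_le_iff(2)[of 0 x] by auto

lemma dts_const [dfi]:
  assumes "ctx U c"
  shows "dts U c (\<lambda>e. a)"
proof (rule dtsI_graph)
  have "{[a]} \<in> S 1" using grp unfolding expands_ordered_group_def by blast
  then show "dfb (U \<times> UNIV) (\<lambda>p. c (fst p) @ [snd p]) (\<lambda>p. [snd p] \<in> {[a]})"
    by (intro dtm_mem dfi assms)
qed simp

lemma dfb_less [dfi]:
  assumes "dts U c \<tau>" "dts U c \<sigma>"
  shows "dfb U c (\<lambda>e. \<tau> e < \<sigma> e)"
proof -
  have "{[x, y] | x y::'a. x < y} \<in> S 2" using grp unfolding expands_ordered_group_def by blast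
  then have "dfb U c (\<lambda>e. [\<tau> e, \<sigma> e] \<in> {[x, y] | x y. x < y})"
    by (rule dtm_mem) (intro dfi assms dts_ctx[OF assms(1)])
  then show ?thesis by (rule dfb_transfer) simp
qed

lemma dfb_le [dfi]:
  assumes "dts U c \<tau>" "dts U c \<sigma>"
  shows "dfb U c (\<lambda>e. \<tau> e \<le> \<sigma> e)"
  using dfb_not[OF dfb_less[OF assms(2,1)]] by (simp add: not_less)

lemma dts_plus [dfi]:
  assumes "dts U c \<tau>" "dts U c \<sigma>"
  shows "dts U c (\<lambda>e. \<tau> e + \<sigma> e)"
proof (rule dtsI_graph)
  have "{[x, y, x + y] | x y::'a. True} \<in> S 3" using grp unfolding expands_ordered_group_def by blast
  then show "dfb (U \<times> UNIV) (\<lambda>p. c (fst p) @ [snd p])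
      (\<lambda>p. [\<tau> (fst p), \<sigma> (fst p), snd p] \<in> {[x, y, x + y] | x y. True})"
    by (rule dtm_mem) (intro dfi assms dts_ctx[OF assms(1)])
qed auto

lemma dts_uminus [dfi]:
  assumes "dts U c \<tau>"
  shows "dts U c (\<lambda>e. - \<tau> e)"
proof (rule dtsI_graph)
  show "dfb (U \<times> UNIV) (\<lambda>p. c (fst p) @ [snd p]) (\<lambda>p. \<tau> (fst p) + snd p = 0)"
    by (intro dfi assms dts_ctx[OF assms(1)])
  show "\<tau> e + y = 0 \<longleftrightarrow> y = - \<tau> e" for e y
    using minus_unique[of "\<tau> e" y] by auto
qed

lemma dts_minus [dfi]: "dts U c \<tau> \<Longrightarrow> dts U c \<sigma> \<Longrightarrow> dts U c (\<lambda>e. \<tau> e - \<sigma> e)"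
  using dts_plus[OF _ dts_uminus, of U c \<tau> \<sigma>] by simp

abbreviation D1 :: "('a \<Rightarrow> bool) \<Rightarrow> bool" where
  "D1 P \<equiv> dfb UNIV (\<lambda>x. [x]) P"

abbreviation D2 :: "('a \<Rightarrow> 'a \<Rightarrow> bool) \<Rightarrow> bool" where
  "D2 P \<equiv> dfb (UNIV \<times> UNIV) (\<lambda>p. [fst p] @ [snd p]) (\<lambda>p. P (fst p) (snd p))"

lemma dfb_D1: "D1 P \<Longrightarrow> dts U c \<tau> \<Longrightarrow> dfb U c (\<lambda>e. P (\<tau> e))"
  by (rule dfb_lift0) (auto intro: dfi)

lemma dfb_D2: "D2 P \<Longrightarrow> dts U c \<tau> \<Longrightarrow> dts U c \<sigma> \<Longrightarrow> dfb U c (\<lambda>e. P (\<tau> e) (\<sigma> e))"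
  by (rule dfb_lift[where c = "\<lambda>x. [x]" and U = UNIV]) (auto intro: dfi)

lemma dfb_evr [dfi]:
  assumes "dts U c \<tau>" "dfb (U \<times> UNIV) (\<lambda>p. c (fst p) @ [snd p]) (\<lambda>p. P (fst p) (snd p))"
  shows "dfb U c (\<lambda>e. evr (\<tau> e) (P e))"
  unfolding evr_def by (intro dfi assms(1) dts_ctx[OF assms(1)] dfb_lift[OF assms(2)]) auto

lemma dfb_evl [dfi]:
  assumes "dts U c \<tau>" "dfb (U \<times> UNIV) (\<lambda>p. c (fst p) @ [snd p]) (\<lambda>p. P (fst p) (snd p))"
  shows "dfb U c (\<lambda>e. evl (\<tau> e) (P e))"
  unfolding evl_def by (intro dfi assms(1) dts_ctx[OF assms(1)] dfb_lift[OF assms(2)]) auto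

lemma loc:
  assumes "D1 P"
  obtains l u A B where "l < a" "a < u" "finite A" "finite B"
    "\<forall>x. l < x \<and> x < u \<longrightarrow> (P x \<longleftrightarrow> x \<in> A \<or> (\<exists>r\<in>B. fst r < x \<and> x < snd r))"
proof -
  have "definable1 S {x. P x}" using assms by (simp add: definable1_iff)
  then have "\<exists>l u. l < a \<and> a < u \<and> (\<exists>A B. finite A \<and> finite B \<and>
      {x. P x} \<inter> {l<..<u} = A \<union> (\<Union>(p, q)\<in>B. {p<..<q}))"
    using lom unfolding locally_o_minimal_def by simp
  then obtain l u A B where *: "l < a" "a < u" "finite A" "finite B"
    "{x. P x} \<inter> {l<..<u} = A \<union> (\<Union>(p, q)\<in>B. {p<..<q})"
    by (elim exE conjE)
  have "P x \<longleftrightarrow> x \<in> A \<or> (\<exists>r\<in>B. fst r < x \<and> x < snd r)" if "l < x" "x < u" for x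
  proof -
    have "P x \<longleftrightarrow> x \<in> {x. P x} \<inter> {l<..<u}" using that by simp
    also have "\<dots> \<longleftrightarrow> x \<in> A \<or> (\<exists>r\<in>B. fst r < x \<and> x < snd r)" unfolding * by (simp add: case_prod_beta)
    finally show ?thesis .
  qed
  then show thesis by (intro that[OF *(1-4)]) simp
qed

lemma finite_gap_right:
  assumes "finite F" "a < (u::'a)"
  shows "\<exists>y. a < y \<and> y \<le> u \<and> (\<forall>x\<in>F. a < x \<longrightarrow> y \<le> x)"
  using assms
proof (induction F rule: finite_induct)
  case (insert x F)
  then obtain y where "a < y" "y \<le> u" "\<forall>x\<in>F. a < x \<longrightarrow> y \<le> x" by blast
  then show ?case by (intro exI[of _ "if a < x then min x y else y"]) (auto simp: min_def)
qed auto

lemma finite_gap_left: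
  assumes "finite F" "(u::'a) < a"
  shows "\<exists>y. y < a \<and> u \<le> y \<and> (\<forall>x\<in>F. x < a \<longrightarrow> x \<le> y)"
  using assms
proof (induction F rule: finite_induct)
  case (insert x F)
  then obtain y where "y < a" "u \<le> y" "\<forall>x\<in>F. x < a \<longrightarrow> x \<le> y" by blast
  then show ?case by (intro exI[of _ "if x < a then max x y else y"]) (auto simp: max_def)
qed auto

text \<open>Up to the first endpoint of the local description beyond \<open>a\<close>, membership
  depends only on whether some interval of the description covers the whole gap. Local o-minimality
  enters the proof through this lemma and \<open>evl_cases\<close>.\<close>

lemma evr_cases:
  assumes "D1 P"
  shows "evr a P \<or> evr a (\<lambda>x. \<not> P x)"
proof -
  obtain l u A B where *: "l < a" "a < u" "finite A" "finite B"
    "\<forall>x. l < x \<and> x < u \<longrightarrow> (P x \<longleftrightarrow> x \<in> A \<or> (\<exists>r\<in>B. fst r < x \<and> x < snd r))"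
    by (rule loc[OF assms, where a = a])
  have fin: "finite (A \<union> fst ` B \<union> snd ` B)" using *(3,4) by simp
  obtain y where y: "a < y" "y \<le> u" "\<forall>x\<in>A \<union> fst ` B \<union> snd ` B. a < x \<longrightarrow> y \<le> x"
    using finite_gap_right[OF fin *(2)] by (elim exE conjE)
  have "P x \<longleftrightarrow> (\<exists>r\<in>B. fst r \<le> a \<and> y \<le> snd r)" if x: "a < x" "x < y" for x
  proof -
    have "x \<notin> A" using y(3)[THEN bspec, of x] x by auto
    moreover have "fst r < x \<and> x < snd r \<longleftrightarrow> fst r \<le> a \<and> y \<le> snd r" if "r \<in> B" for r
    proof -
      have "a < fst r \<longrightarrow> y \<le> fst r" "a < snd r \<longrightarrow> y \<le> snd r" using y(3) that by simp_all
      then show ?thesis using x by auto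
    qed
    moreover have "l < x" "x < u" using x *(1) y(2) by auto
    ultimately show ?thesis using *(5) by simp
  qed
  then show ?thesis unfolding evr_def using y(1) by (cases "\<exists>r\<in>B. fst r \<le> a \<and> y \<le> snd r") auto
qed

lemma evl_cases:
  assumes "D1 P"
  shows "evl a P \<or> evl a (\<lambda>x. \<not> P x)"
proof -
  obtain l u A B where *: "l < a" "a < u" "finite A" "finite B"
    "\<forall>x. l < x \<and> x < u \<longrightarrow> (P x \<longleftrightarrow> x \<in> A \<or> (\<exists>r\<in>B. fst r < x \<and> x < snd r))"
    by (rule loc[OF assms, where a = a])
  have fin: "finite (A \<union> fst ` B \<union> snd ` B)" using *(3,4) by simp
  obtain y where y: "y < a" "l \<le> y" "\<forall>x\<in>A \<union> fst ` B \<union> snd ` B. x < a \<longrightarrow> x \<le> y"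
    using finite_gap_left[OF fin *(1)] by (elim exE conjE)
  have "P x \<longleftrightarrow> (\<exists>r\<in>B. fst r \<le> y \<and> a \<le> snd r)" if x: "y < x" "x < a" for x
  proof -
    have "x \<notin> A" using y(3)[THEN bspec, of x] x by auto
    moreover have "fst r < x \<and> x < snd r \<longleftrightarrow> fst r \<le> y \<and> a \<le> snd r" if "r \<in> B" for r
    proof -
      have "fst r < a \<longrightarrow> fst r \<le> y" "snd r < a \<longrightarrow> snd r \<le> y" using y(3) that by simp_all
      then show ?thesis using x by auto
    qed
    moreover have "l < x" "x < u" using x *(2) y(2) by auto
    ultimately show ?thesis using *(5) by simp
  qed
  then show ?thesis unfolding evl_def using y(1) by (cases "\<exists>r\<in>B. fst r \<le> y \<and> a \<le> snd r") auto
qed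

definition is_lub :: "('a \<Rightarrow> bool) \<Rightarrow> 'a \<Rightarrow> bool" where
  "is_lub P s \<longleftrightarrow> (\<forall>y. P y \<longrightarrow> y \<le> s) \<and> (\<forall>b. (\<forall>y. P y \<longrightarrow> y \<le> b) \<longrightarrow> s \<le> b)"

definition is_glb :: "('a \<Rightarrow> bool) \<Rightarrow> 'a \<Rightarrow> bool" where
  "is_glb P s \<longleftrightarrow> (\<forall>y. P y \<longrightarrow> s \<le> y) \<and> (\<forall>b. (\<forall>y. P y \<longrightarrow> b \<le> y) \<longrightarrow> b \<le> s)"

lemma lub_ex: "D1 P \<Longrightarrow> P x \<Longrightarrow> (\<And>y. P y \<Longrightarrow> y \<le> b) \<Longrightarrow> \<exists>s. is_lub P s"
  using dcomp[unfolded definably_complete_def, THEN conjunct1, rule_format, of "{x. P x}"]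
  unfolding definable1_iff is_lub_def by auto

lemma glb_ex: "D1 P \<Longrightarrow> P x \<Longrightarrow> (\<And>y. P y \<Longrightarrow> b \<le> y) \<Longrightarrow> \<exists>s. is_glb P s"
  using dcomp[unfolded definably_complete_def, THEN conjunct2, rule_format, of "{x. P x}"]
  unfolding definable1_iff is_glb_def by auto

lemma lub_less: "is_lub P s \<Longrightarrow> b < s \<Longrightarrow> \<exists>y. P y \<and> b < y \<and> y \<le> s"
  unfolding is_lub_def by (meson not_le)

lemma glb_less: "is_glb P s \<Longrightarrow> s < b \<Longrightarrow> \<exists>y. P y \<and> y < b \<and> s \<le> y"
  unfolding is_glb_def by (meson not_le)

lemma lub_unique: "is_lub P s \<Longrightarrow> is_lub P s' \<Longrightarrow> s = s'"
  unfolding is_lub_def by (meson order_antisym)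

lemma glb_unique: "is_glb P s \<Longrightarrow> is_glb P s' \<Longrightarrow> s = s'"
  unfolding is_glb_def by (meson order_antisym)

text \<open>Elements of \<open>P\<close> accumulate from the left at an unattained supremum, so the
  left germ there cannot belong to the complement.\<close>

lemma lub_evl:
  assumes "D1 P" "is_lub P s" "\<not> P s"
  shows "evl s P"
proof (rule ccontr)
  assume "\<not> evl s P"
  then have "evl s (\<lambda>x. \<not> P x)" using evl_cases[OF assms(1)] by auto
  then obtain y where y: "y < s" "\<forall>z. y < z \<and> z < s \<longrightarrow> \<not> P z" unfolding evl_def by auto
  obtain z where "P z" "y < z" "z \<le> s" using lub_less[OF assms(2) y(1)] by auto
  then show False using y(2) assms(3) by (auto simp: le_less)
qed

lemma glb_evr:
  assumes "D1 P" "is_glb P s" "\<not> P s"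
  shows "evr s P"
proof (rule ccontr)
  assume "\<not> evr s P"
  then have "evr s (\<lambda>x. \<not> P x)" using evr_cases[OF assms(1)] by auto
  then obtain y where y: "s < y" "\<forall>z. s < z \<and> z < y \<longrightarrow> \<not> P z" unfolding evr_def by auto
  obtain z where "P z" "z < y" "s \<le> z" using glb_less[OF assms(2) y(1)] by auto
  then show False using y(2) assms(3) by (auto simp: le_less)
qed

end

section \<open>Strict local minima and definable choice\<close>

context dclom
begin

text \<open>
  The next two lemmas carry over the argument by which the o-minimal monotonicity theorem rules out
  functions having a strict local minimum everywhere.  The values of the function enter only through
  comparisons, so a definable total preorder on an interval suffices; finiteness of definable sets
  is replaced by their tameness at the two endpoints.
\<close>

lemma strict_local_min_right_end:
  assumes le: "D2 le" and pq: "p < q"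
    and tot: "\<And>x y. p < x \<Longrightarrow> x < q \<Longrightarrow> p < y \<Longrightarrow> y < q \<Longrightarrow> le x y \<or> le y x"
    and tr: "\<And>x y z. p < x \<Longrightarrow> x < q \<Longrightarrow> p < y \<Longrightarrow> y < q \<Longrightarrow> p < z \<Longrightarrow> z < q \<Longrightarrow>
      le x y \<Longrightarrow> le y z \<Longrightarrow> le x z"
    and R: "\<And>x. p < x \<Longrightarrow> x < q \<Longrightarrow> evr x (\<lambda>y. \<not> le y x)"
    and L: "\<And>x. p < x \<Longrightarrow> x < q \<Longrightarrow> evl x (\<lambda>y. \<not> le y x)"
  shows "\<exists>p'. p \<le> p' \<and> p' < q \<and> (\<forall>x. p' < x \<and> x < q \<longrightarrow>
    (\<exists>v. p < v \<and> v < q \<and> evl x (\<lambda>y. \<not> le y v) \<and> evr x (\<lambda>y. le y v)))"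
proof -
  \<comment> \<open>\<open>B x\<close>: every later point lies strictly above \<open>x\<close>. This
    cannot hold throughout an interval ending at \<open>q\<close>, since a strict minimum at
    \<open>x\<close> has points above it on its left, and \<open>x\<close> is later than these
    without lying above them.\<close>
  define B where "B x \<longleftrightarrow> p < x \<and> x < q \<and> (\<forall>y. x < y \<and> y < q \<longrightarrow> \<not> le y x)" for x
  have DB: "D1 B" unfolding B_def by (intro dfi dfb_D2[OF le])
  have Dc: "D1 (\<lambda>y. le y c)" for c by (intro dfi dfb_D2[OF le])
  have "\<not> evl q B"
  proof
    assume "evl q B"
    then obtain q1 where q1: "q1 < q" "\<forall>z. q1 < z \<and> z < q \<longrightarrow> B z" unfolding evl_def by auto
    obtain x where x: "max p q1 < x" "x < q" using dense[of "max p q1" q] q1 pq by auto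
    have "evl x (\<lambda>y. \<not> le y x)" using L x by auto
    from evl_ex[OF this x(1)] obtain y where y: "max p q1 < y" "y < x" "\<not> le y x" by auto
    have "B y" using q1 y x by auto
    then have "\<not> le x y" using y x unfolding B_def by auto
    moreover have "y < q" using x y by (auto intro: order.strict_trans)
    ultimately show False using tot[of x y] x y by auto
  qed
  then have "evl q (\<lambda>x. \<not> B x)" using evl_cases[OF DB] by auto
  then obtain q1 where q1: "q1 < q" "\<forall>z. q1 < z \<and> z < q \<longrightarrow> \<not> B z" unfolding evl_def by auto
  define p1 where "p1 = max p q1"
  have p1: "p \<le> p1" "p1 < q" using pq q1 unfolding p1_def by auto
  have nB: "\<exists>y. x < y \<and> y < q \<and> le y x" if "p1 < x" "x < q" for x
  proof -
    have "\<not> B x" "p < x" using q1(2) that unfolding p1_def by auto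
    then show ?thesis using that unfolding B_def by auto
  qed
  \<comment> \<open>Otherwise there is a last point \<open>d\<close> of \<open>[c, q)\<close> that
    is not above \<open>c\<close>; as \<open>B d\<close> fails, some later point is not above
    \<open>d\<close>, hence not above \<open>c\<close>.\<close>
  have ev: "evl q (\<lambda>y. le y c)" if c: "p1 < c" "c < q" for c
  proof (rule ccontr)
    assume "\<not> evl q (\<lambda>y. le y c)"
    then have "evl q (\<lambda>y. \<not> le y c)" using evl_cases[OF Dc] by auto
    then obtain d0 where d0: "d0 < q" "\<forall>z. d0 < z \<and> z < q \<longrightarrow> \<not> le z c" unfolding evl_def by auto
    define E where "E y \<longleftrightarrow> c \<le> y \<and> y < q \<and> le y c" for y
    have DE: "D1 E" unfolding E_def by (intro dfi dfb_D2[OF le])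
    have Ec: "E c" using tot[of c c] c p1 unfolding E_def by auto
    have bE: "y \<le> max d0 c" if "E y" for y
      by (rule ccontr) (use that d0(2) in \<open>auto simp: E_def not_le\<close>)
    obtain d where d: "is_lub E d" using lub_ex[OF DE Ec bE] by auto
    have dc: "c \<le> d" "d \<le> max d0 c" using d Ec bE unfolding is_lub_def by auto
    have dq: "d < q" "p < d"
      using le_less_trans[OF dc(2), of q] le_less_trans[OF p1(1), of d] dc(1) d0(1) c by auto
    have Ed: "E d"
    proof (rule ccontr)
      assume nE: "\<not> E d"
      have "evl d (\<lambda>y. E y \<and> \<not> le y d)" using evl_conj[OF lub_evl[OF DE d nE] L] dq by auto
      from evl_ex[OF this dq(2)] obtain y where y: "E y" "\<not> le y d" by auto
      have pc: "p < c" "p < y" using le_less_trans[OF p1(1) c(1)] less_le_trans[of p c y] y(1)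
        unfolding E_def by auto
      have "le d y" using tot[of d y] y dq pc unfolding E_def by blast
      then have "le d c" using tr[of d y c] y dq c pc unfolding E_def by blast
      then show False using nE dc dq unfolding E_def by auto
    qed
    obtain y where y: "d < y" "y < q" "le y d" using nB[OF less_le_trans[OF c(1) dc(1)] dq(1)] by auto
    have pc: "p < c" "p < y" using le_less_trans[OF p1(1) c(1)] order.strict_trans[OF dq(2) y(1)] .
    then have "le y c" using tr[of y d c] Ed y dq c unfolding E_def by blast
    then have "E y" using y order_trans[OF dc(1), of y] unfolding E_def by auto
    then have "y \<le> d" using d unfolding is_lub_def by auto
    then show False using y by auto
  qed
  \<comment> \<open>A downward crossing at \<open>x\<close>: the left germ lies above some level
    \<open>v\<close> and the right germ does not.\<close>
  define Psi where
    "Psi x \<longleftrightarrow> (\<exists>v. p < v \<and> v < q \<and> evl x (\<lambda>y. \<not> le y v) \<and> evr x (\<lambda>y. le y v))" for x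
  have DP: "D1 Psi" unfolding Psi_def by (intro dfi dfb_D2[OF le])
  \<comment> \<open>The crossing of level \<open>c\<close> sits at the supremum \<open>d\<close> of
    the later points above that level. Such points exist by strictness on the right of
    \<open>c\<close>, and \<open>ev\<close> bounds them away from \<open>q\<close>.\<close>
  have ex: "\<exists>d. c < d \<and> d < q \<and> Psi d" if c: "p1 < c" "c < q" for c
  proof -
    obtain b where b: "b < q" "\<forall>z. b < z \<and> z < q \<longrightarrow> le z c" using ev[OF c] unfolding evl_def by auto
    define E where "E y \<longleftrightarrow> c < y \<and> y < q \<and> \<not> le y c" for y
    have DE: "D1 E" unfolding E_def by (intro dfi dfb_D2[OF le])
    have "evr c (\<lambda>y. \<not> le y c)" using R c p1 by auto
    from evr_ex[OF this c(2)] obtain y0 where y0: "c < y0" "y0 < q" "\<not> le y0 c" by auto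
    have E0: "E y0" using y0 unfolding E_def by auto
    have bE: "y \<le> b" if "E y" for y
      by (rule ccontr) (use that b(2) in \<open>auto simp: E_def not_le\<close>)
    obtain d where d: "is_lub E d" using lub_ex[OF DE E0 bE] by auto
    have "y0 \<le> d" "d \<le> b" using d E0 bE unfolding is_lub_def by auto
    then have dq: "c < d" "d < q" "p < d" using y0 b c p1 by auto
    have right: "le y c" if "d < y" "y < q" for y
    proof (rule ccontr)
      assume "\<not> le y c"
      then have "E y" using that dq unfolding E_def by auto
      then have "y \<le> d" using d unfolding is_lub_def by auto
      then show False using that by auto
    qed
    have left: "evl d (\<lambda>y. \<not> le y c)"
    proof (rule ccontr)
      assume "\<not> evl d (\<lambda>y. \<not> le y c)"
      then have l: "evl d (\<lambda>y. le y c)" using evl_cases[OF Dc] by auto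
      have Ed: "E d"
      proof (rule ccontr)
        assume "\<not> E d"
        then have "evl d E" by (rule lub_evl[OF DE d])
        from evl_ex[OF evl_conj[OF this l] dq(3)] show False unfolding E_def by auto
      qed
      have "evr d (\<lambda>y. \<not> le y d)" using R[of d] dq by auto
      from evr_ex[OF this dq(2)] obtain y where y: "d < y" "y < q" "\<not> le y d" by auto
      have pc: "p < c" "p < y" using le_less_trans[OF p1(1) c(1)] order.strict_trans[OF dq(3) y(1)] .
      have "le d y" using tot[of d y] y dq pc by blast
      then have "le d c" using tr[of d y c] right y dq c pc by blast
      then show False using Ed unfolding E_def by auto
    qed
    have "evr d (\<lambda>y. le y c)" unfolding evr_def using right dq by auto
    then have "Psi d" using left c p1 unfolding Psi_def by (intro exI[of _ c]) auto
    then show ?thesis using dq by auto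
  qed
  have "evl q Psi"
  proof (rule ccontr)
    assume "\<not> evl q Psi"
    then have "evl q (\<lambda>x. \<not> Psi x)" using evl_cases[OF DP] by auto
    then obtain r where r: "r < q" "\<forall>z. r < z \<and> z < q \<longrightarrow> \<not> Psi z" unfolding evl_def by auto
    obtain c where c: "max p1 r < c" "c < q" using dense[of "max p1 r" q] r p1 by auto
    obtain d where "c < d" "d < q" "Psi d" using ex[of c] c by auto
    then show False using r(2) c by auto
  qed
  then obtain r where r: "r < q" "\<forall>z. r < z \<and> z < q \<longrightarrow> Psi z" unfolding evl_def by auto
  show ?thesis
    by (intro exI[of _ "max p r"]) (use r pq in \<open>auto simp: Psi_def\<close>)
qed

lemma evl_neg: "evl (- x) P \<longleftrightarrow> evr x (\<lambda>y. P (- (y::'a)))"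
proof
  assume "evl (- x) P"
  then obtain y where y: "y < - x" "\<forall>z. y < z \<and> z < - x \<longrightarrow> P z" unfolding evl_def by auto
  have "P (- z)" if "x < z" "z < - y" for z using y(2) that neg_less_iff(2)[of z y] by auto
  then show "evr x (\<lambda>y. P (- y))" unfolding evr_def using y(1) neg_less_iff(2)[of y x] by auto
next
  assume "evr x (\<lambda>y. P (- y))"
  then obtain y where y: "x < y" "\<forall>z. x < z \<and> z < y \<longrightarrow> P (- z)" unfolding evr_def by auto
  have "P z" if "- y < z" "z < - x" for z
    using y(2)[rule_format, of "- z"] that neg_less_iff[of y z] neg_less_iff(2)[of z x] by auto
  then show "evl (- x) P" unfolding evl_def using y(1) by (intro exI[of _ "- y"]) auto
qed

lemma evr_neg: "evr (- x) P \<longleftrightarrow> evl x (\<lambda>y. P (- (y::'a)))"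
  using evl_neg[of "- x" "\<lambda>y. P (- y)"] by simp

lemma no_strict_local_min_preorder:
  assumes le: "D2 le" and pq: "p < q"
    and tot: "\<And>x y. p < x \<Longrightarrow> x < q \<Longrightarrow> p < y \<Longrightarrow> y < q \<Longrightarrow> le x y \<or> le y x"
    and tr: "\<And>x y z. p < x \<Longrightarrow> x < q \<Longrightarrow> p < y \<Longrightarrow> y < q \<Longrightarrow> p < z \<Longrightarrow> z < q \<Longrightarrow>
      le x y \<Longrightarrow> le y z \<Longrightarrow> le x z"
    and R: "\<And>x. p < x \<Longrightarrow> x < q \<Longrightarrow> evr x (\<lambda>y. \<not> le y x)"
    and L: "\<And>x. p < x \<Longrightarrow> x < q \<Longrightarrow> evl x (\<lambda>y. \<not> le y x)"
  shows False
proof -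
  have "\<exists>p'. p \<le> p' \<and> p' < q \<and> (\<forall>x. p' < x \<and> x < q \<longrightarrow>
    (\<exists>v. p < v \<and> v < q \<and> evl x (\<lambda>y. \<not> le y v) \<and> evr x (\<lambda>y. le y v)))"
    by (rule strict_local_min_right_end[OF le pq])
      (use tot in blast, use tr in blast, use R in blast, use L in blast)
  then obtain p' where p': "p \<le> p'" "p' < q" "\<forall>x. p' < x \<and> x < q \<longrightarrow>
    (\<exists>v. p < v \<and> v < q \<and> evl x (\<lambda>y. \<not> le y v) \<and> evr x (\<lambda>y. le y v))"
    by (elim exE conjE)
  \<comment> \<open>Reflecting the line turns downward crossings into upward ones. Working inside
    \<open>(p', q)\<close>, this yields a point \<open>z\<close> with crossings of both
    kinds.\<close>
  define le' where "le' x y \<longleftrightarrow> le (- x) (- y)" for x y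
  have le': "D2 le'" unfolding le'_def by (intro dfi dfb_D2[OF le])
  have flip: "p < - x" "- x < q" if "- q < x" "x < - p'" for x
    using that p'(1) neg_less_iff(1)[of q x] neg_less_iff(2)[of x p'] by auto
  have "\<exists>p''. - q \<le> p'' \<and> p'' < - p' \<and> (\<forall>x. p'' < x \<and> x < - p' \<longrightarrow>
    (\<exists>v. - q < v \<and> v < - p' \<and> evl x (\<lambda>y. \<not> le' y v) \<and> evr x (\<lambda>y. le' y v)))"
  proof (rule strict_local_min_right_end[OF le'])
    show "- q < - p'" using p' by simp
    show "le' x y \<or> le' y x" if "- q < x" "x < - p'" "- q < y" "y < - p'" for x y
      unfolding le'_def using tot flip that by auto
    show "le' x z" if "- q < x" "x < - p'" "- q < y" "y < - p'" "- q < z" "z < - p'" "le' x y" "le' y z"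
      for x y z
      using tr[OF flip[OF that(1,2)] flip[OF that(3,4)] flip[OF that(5,6)]] that(7,8)
      unfolding le'_def by simp
    show "evr x (\<lambda>y. \<not> le' y x)" if "- q < x" "x < - p'" for x
      using L[OF flip[OF that]] evr_neg[of "- x"] unfolding le'_def by simp
    show "evl x (\<lambda>y. \<not> le' y x)" if "- q < x" "x < - p'" for x
      using R[OF flip[OF that]] evl_neg[of "- x"] unfolding le'_def by simp
  qed
  then obtain p'' where p'': "- q \<le> p''" "p'' < - p'" "\<forall>x. p'' < x \<and> x < - p' \<longrightarrow>
    (\<exists>v. - q < v \<and> v < - p' \<and> evl x (\<lambda>y. \<not> le' y v) \<and> evr x (\<lambda>y. le' y v))"
    by (elim exE conjE)
  obtain x where x: "p'' < x" "x < - p'" using dense p''(2) by auto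
  then obtain v' where v': "- q < v'" "v' < - p'" "evl x (\<lambda>y. \<not> le' y v')" "evr x (\<lambda>y. le' y v')"
    using p''(3) by auto
  define z where "z = - x"
  have z: "p' < z" "z < q" "p < z"
    using x p''(1) p'(1) neg_less_iff(1)[of q x] neg_less_iff(2)[of x p'] unfolding z_def by auto
  obtain v where v: "p < v" "v < q" "evl z (\<lambda>y. \<not> le y v)" "evr z (\<lambda>y. le y v)"
    using p'(3) z by auto
  have r: "evr z (\<lambda>y. \<not> le y (- v'))" using v'(3) evl_neg[of z] unfolding le'_def z_def by simp
  have l: "evl z (\<lambda>y. le y (- v'))" using v'(4) evr_neg[of z] unfolding le'_def z_def by simp
  have V: "p < - v'" "- v' < q" using flip v' by auto
  \<comment> \<open>The point \<open>y1\<close> left of \<open>z\<close> is above \<open>v\<close>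
    but not above \<open>- v'\<close>, and \<open>y2\<close> on the right is above
    \<open>- v'\<close> but not above \<open>v\<close>. Each of the two levels would lie strictly
    below the other.\<close>
  obtain y1 where y1: "p < y1" "y1 < z" "\<not> le y1 v" "le y1 (- v')"
    using evl_ex[OF evl_conj[OF v(3) l] z(3)] by auto
  obtain y2 where y2: "z < y2" "y2 < q" "le y2 v" "\<not> le y2 (- v')"
    using evr_ex[OF evr_conj[OF v(4) r] z(2)] by auto
  have y: "y1 < q" "p < y2" using order.strict_trans[OF y1(2) z(2)] order.strict_trans[OF z(3) y2(1)] .
  have "\<not> le (- v') v" using tr[of y1 "- v'" v] y y1 v V by blast
  then have "le v (- v')" using tot[of v "- v'"] v V by blast
  then show False using tr[of y2 v "- v'"] y y2 v V by blast
qed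

text \<open>A Baire property for definable chains. Compare points by how early they enter the chain.
  If no member contains an interval, both germs at \<open>x\<close> lie outside a member that
  contains \<open>x\<close>, so nearby points enter strictly later than \<open>x\<close>. Then every
  point is a strict local minimum, which is impossible.\<close>

lemma monotone_cover:
  assumes Q: "D2 Q" and chain: "\<And>u v. (\<forall>x. Q u x \<longrightarrow> Q v x) \<or> (\<forall>x. Q v x \<longrightarrow> Q u x)"
    and pq: "p < q" and cov: "\<And>x. p < x \<Longrightarrow> x < q \<Longrightarrow> \<exists>u. Q u x"
  shows "\<exists>u p' q'. p \<le> p' \<and> p' < q' \<and> q' \<le> q \<and> (\<forall>x. p' < x \<and> x < q' \<longrightarrow> Q u x)"
proof (rule ccontr)
  assume no: "\<not> ?thesis"
  define le where "le x y \<longleftrightarrow> (\<forall>u. Q u y \<longrightarrow> Q u x)" for x y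
  have le: "D2 le" unfolding le_def by (intro dfi dfb_D2[OF Q])
  have DQ: "D1 (Q u)" for u by (intro dfi dfb_D2[OF Q])
  show False
  proof (rule no_strict_local_min_preorder[OF le pq])
    show "le x y \<or> le y x" for x y
    proof (rule ccontr)
      assume "\<not> (le x y \<or> le y x)"
      then obtain u v where "Q u y" "\<not> Q u x" "Q v x" "\<not> Q v y" unfolding le_def by auto
      then show False using chain[of u v] by auto
    qed
    show "le x z" if "le x y" "le y z" for x y z using that unfolding le_def by simp
  next
    fix x assume x: "p < x" "x < q"
    obtain u where u: "Q u x" using cov x by auto
    have "\<not> evr x (Q u)"
    proof
      assume "evr x (Q u)"
      then obtain y where "x < y" "\<forall>z. x < z \<and> z < y \<longrightarrow> Q u z" unfolding evr_def by auto
      then have "p \<le> x \<and> x < min y q \<and> min y q \<le> q \<and> (\<forall>z. x < z \<and> z < min y q \<longrightarrow> Q u z)"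
        using x by auto
      then show False using no by (elim notE) (intro exI)
    qed
    then have "evr x (\<lambda>y. \<not> Q u y)" using evr_cases[OF DQ] by auto
    then show "evr x (\<lambda>y. \<not> le y x)" by (rule evr_mono) (use u in \<open>auto simp: le_def\<close>)
    have "\<not> evl x (Q u)"
    proof
      assume "evl x (Q u)"
      then obtain y where "y < x" "\<forall>z. y < z \<and> z < x \<longrightarrow> Q u z" unfolding evl_def by auto
      then have "p \<le> max y p \<and> max y p < x \<and> x \<le> q \<and> (\<forall>z. max y p < z \<and> z < x \<longrightarrow> Q u z)"
        using x by auto
      then show False using no by (elim notE) (intro exI)
    qed
    then have "evl x (\<lambda>y. \<not> Q u y)" using evl_cases[OF DQ] by auto
    then show "evl x (\<lambda>y. \<not> le y x)" by (rule evl_mono) (use u in \<open>auto simp: le_def\<close>)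
  qed
qed

section \<open>Definable choice\<close>

definition lubp :: "('a \<Rightarrow> bool) \<Rightarrow> 'a" where
  "lubp P = (if \<exists>s. is_lub P s then THE s. is_lub P s else 0)"

text \<open>The default 0 matters for empty fibres: it puts their lower end into every set
  \<open>inK w\<close> with \<open>0 \<le> w\<close>.\<close>

definition glbp :: "('a \<Rightarrow> bool) \<Rightarrow> 'a" where
  "glbp P = (if \<exists>s. is_glb P s then THE s. is_glb P s else 0)"

lemma lubp_eq: "is_lub P s \<Longrightarrow> lubp P = s"
  unfolding lubp_def using lub_unique by auto

lemma glbp_eq: "is_glb P s \<Longrightarrow> glbp P = s"
  unfolding glbp_def using glb_unique by auto

lemma dts_lubp [dfi]:
  assumes P: "dfb (U \<times> UNIV) (\<lambda>p. c (fst p) @ [snd p]) (\<lambda>p. P (fst p) (snd p))" and c: "ctx U c"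
  shows "dts U c (\<lambda>e. lubp (P e))"
proof (rule dtsI_graph)
  show "dfb (U \<times> UNIV) (\<lambda>p. c (fst p) @ [snd p]) (\<lambda>p. is_lub (P (fst p)) (snd p) \<or>
      (\<not> (\<exists>s. is_lub (P (fst p)) s) \<and> snd p = 0))"
    unfolding is_lub_def by (intro dfi dfb_lift[OF P] c) auto
  show "is_lub (P e) y \<or> (\<not> (\<exists>s. is_lub (P e) s) \<and> y = 0) \<longleftrightarrow> y = lubp (P e)" for e y
    using lubp_eq lubp_def by metis
qed

lemma dts_glbp [dfi]:
  assumes P: "dfb (U \<times> UNIV) (\<lambda>p. c (fst p) @ [snd p]) (\<lambda>p. P (fst p) (snd p))" and c: "ctx U c"
  shows "dts U c (\<lambda>e. glbp (P e))"
proof (rule dtsI_graph)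
  show "dfb (U \<times> UNIV) (\<lambda>p. c (fst p) @ [snd p]) (\<lambda>p. is_glb (P (fst p)) (snd p) \<or>
      (\<not> (\<exists>s. is_glb (P (fst p)) s) \<and> snd p = 0))"
    unfolding is_glb_def by (intro dfi dfb_lift[OF P] c) auto
  show "is_glb (P e) y \<or> (\<not> (\<exists>s. is_glb (P e) s) \<and> y = 0) \<longleftrightarrow> y = glbp (P e)" for e y
    using glbp_eq glbp_def by metis
qed

definition unit_pos :: 'a where
  "unit_pos = (SOME e. 0 < e)"

lemma unit_pos: "0 < unit_pos"
  unfolding unit_pos_def by (rule someI_ex) (rule gt_ex)

text \<open>
  Selects an element of \<open>P\<close> depending definably on parameters: the infimum if it is attained, and
  otherwise a point half way into an initial interval of \<open>P\<close>, whose length is capped by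
  \<open>unit_pos\<close>.  The group need not be divisible, so the half is taken as a supremum.
\<close>

definition choose_pos :: "('a \<Rightarrow> bool) \<Rightarrow> 'a" where
  "choose_pos P = (if P (glbp P) then glbp P else glbp P +
     lubp (\<lambda>d. 0 < d \<and> d \<le> unit_pos \<and> (\<forall>y. glbp P < y \<and> y \<le> glbp P + d + d \<longrightarrow> P y)))"

text \<open>\<open>choose_pos\<close> works from an infimum, so \<open>P\<close> is cut down to its
  nonnegative elements or, if there are none, reflected.\<close>

definition choose_elem :: "('a \<Rightarrow> bool) \<Rightarrow> 'a" where
  "choose_elem P = (if \<exists>y. 0 \<le> y \<and> P y then choose_pos (\<lambda>y. 0 \<le> y \<and> P y) else - choose_pos (\<lambda>y. P (- y)))"

text \<open>The smaller of the two parts \<open>e\<close> and \<open>- e + t\<close> of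
  \<open>t\<close> fits twice into \<open>t\<close>; shrinking it makes the inequality
  strict.\<close>

lemma half_ex:
  assumes "0 < (t::'a)"
  shows "\<exists>d. 0 < d \<and> d + d < t"
proof -
  obtain e where e: "0 < e" "e < t" using dense assms by auto
  define d where "d = min e (- e + t)"
  have d: "0 < d" using e add_less_l[OF e(2), of "- e"] unfolding d_def by auto
  obtain d' where d': "0 < d'" "d' < d" using dense d by auto
  have "d' + d' < d + d'" using d' by (intro add_less_r)
  also have "\<dots> < d + d" using d' by (intro add_less_l)
  also have "\<dots> \<le> e + d" unfolding d_def by (intro add_le_r) simp
  also have "\<dots> \<le> e + (- e + t)" unfolding d_def by (intro add_le_l) simp
  also have "\<dots> = t" by (simp add: add.assoc[symmetric])
  finally show ?thesis using d' by auto
qed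

lemma choose_pos:
  assumes P: "D1 P" and x: "P x" and pos: "\<And>y. P y \<Longrightarrow> 0 \<le> y"
  shows "P (choose_pos P)"
proof -
  obtain i where i: "is_glb P i" using glb_ex[OF P x pos] by auto
  have gi: "glbp P = i" using glbp_eq[OF i] .
  show ?thesis
  proof (cases "P i")
    case True
    then show ?thesis unfolding choose_pos_def gi by simp
  next
    case False
    obtain y0 where y0: "i < y0" "\<forall>z. i < z \<and> z < y0 \<longrightarrow> P z"
      using glb_evr[OF P i False] unfolding evr_def by auto
    define H where "H d \<longleftrightarrow> 0 < d \<and> d \<le> unit_pos \<and> (\<forall>y. i < y \<and> y \<le> i + d + d \<longrightarrow> P y)" for d
    have DH: "D1 H" unfolding H_def by (intro dfi dfb_D1[OF P])
    have "0 < - i + y0" using add_less_l[OF y0(1), of "- i"] by simp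
    then obtain d1 where d1: "0 < d1" "d1 + d1 < - i + y0" using half_ex by auto
    define d where "d = min d1 unit_pos"
    have "d + d \<le> d1 + d" unfolding d_def by (intro add_le_r) simp
    also have "\<dots> \<le> d1 + d1" unfolding d_def by (intro add_le_l) simp
    finally have "d + d < - i + y0" using d1 by simp
    from add_less_l[OF this, of i] have "i + d + d < y0" by (simp add: add.assoc[symmetric])
    then have H0: "H d" using y0(2) d1 unit_pos unfolding H_def d_def by auto
    have bH: "d \<le> unit_pos" if "H d" for d using that unfolding H_def by simp
    obtain \<delta> where \<delta>: "is_lub H \<delta>" using lub_ex[OF DH H0 bH] by auto
    have d\<delta>: "d \<le> \<delta>" "0 < d" using \<delta> H0 unfolding is_lub_def H_def by auto
    \<comment> \<open>The supremum \<open>\<delta>\<close> may itself fail \<open>H\<close>, but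
      some \<open>m\<close> satisfying \<open>H\<close> has \<open>\<delta> < m + m\<close>, which
      puts \<open>i + \<delta>\<close> into the part of \<open>P\<close> guaranteed by
      \<open>m\<close>.\<close>
    have "\<delta> + - d < \<delta> + 0" using d\<delta> by (intro add_less_l) (simp add: neg_less_iff)
    then have "\<delta> - d < \<delta>" by simp
    then obtain d2 where d2: "H d2" "\<delta> - d < d2" using lub_less[OF \<delta>] by auto
    have "\<delta> < d2 + d" using add_less_r[OF d2(2), of d] by simp
    moreover define m where "m = max d d2"
    have "d2 + d \<le> m + d" unfolding m_def by (intro add_le_r) simp
    moreover have "m + d \<le> m + m" unfolding m_def by (intro add_le_l) simp
    ultimately have "\<delta> < m + m" by simp
    then have "i + \<delta> \<le> i + m + m" using add_less_l[of \<delta> "m + m" i] by (simp add: add.assoc)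
    moreover have "i + 0 < i + \<delta>" using d\<delta> by (intro add_less_l) simp
    moreover have "H m" using H0 d2 unfolding m_def by (simp add: max_def)
    ultimately have "P (i + \<delta>)" unfolding H_def by simp
    then show ?thesis using False lubp_eq[OF \<delta>] unfolding choose_pos_def gi H_def by simp
  qed
qed

lemma choose_elem:
  assumes P: "D1 P" and x: "P x"
  shows "P (choose_elem P)"
proof (cases "\<exists>y. 0 \<le> y \<and> P y")
  case True
  then obtain y where y: "0 \<le> y \<and> P y" by auto
  have "D1 (\<lambda>y. 0 \<le> y \<and> P y)" by (intro dfi dfb_D1[OF P])
  from choose_pos[OF this y] show ?thesis using True unfolding choose_elem_def by simp
next
  case False
  have D: "D1 (\<lambda>y. P (- y))" by (intro dfi dfb_D1[OF P])
  have "0 \<le> y" if "P (- y)" for y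
  proof (rule ccontr)
    assume "\<not> 0 \<le> y"
    then have "0 \<le> - y" by simp
    then show False using False that by auto
  qed
  from choose_pos[OF D, of "- x", OF _ this] x
  show ?thesis unfolding choose_elem_def if_not_P[OF False] by simp
qed

lemma dts_choose_pos:
  assumes P: "dfb (U \<times> UNIV) (\<lambda>p. c (fst p) @ [snd p]) (\<lambda>p. P (fst p) (snd p))" and c: "ctx U c"
  shows "dts U c (\<lambda>e. choose_pos (P e))"
proof -
  have g: "dts U c (\<lambda>e. glbp (P e))" by (intro dfi P c)
  have Pg: "dfb U c (\<lambda>e. P e (glbp (P e)))"
    by (rule dfb_lift[OF P]) (intro dfi c g, auto intro: dfi g)
  show ?thesis unfolding choose_pos_def by (intro dfi Pg g c dfb_lift[OF P]) auto
qed

lemma dts_choose_elem: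
  assumes P: "dfb (U \<times> UNIV) (\<lambda>p. c (fst p) @ [snd p]) (\<lambda>p. P (fst p) (snd p))" and c: "ctx U c"
  shows "dts U c (\<lambda>e. choose_elem (P e))"
  unfolding choose_elem_def by (intro dfi dts_choose_pos dfb_lift[OF P] c) auto

text \<open>The result depends on \<open>P\<close> only as a set, so equivalent parameters receive
  the same tuple. Class representatives are picked in this way later.\<close>

fun choose_tup :: "nat \<Rightarrow> ('a list \<Rightarrow> bool) \<Rightarrow> 'a list" where
  "choose_tup 0 P = []"
| "choose_tup (Suc n) P = (let y = choose_elem (\<lambda>y. \<exists>z\<in>tup n. P (y # z)) in
     y # choose_tup n (\<lambda>z. P (y # z)))"

lemma length_choose_tup [simp]: "length (choose_tup n P) = n"
  by (induction n arbitrary: P) (auto simp: Let_def)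

lemma choose_tup:
  assumes "dfb (tup n) (\<lambda>x. x) P" "length x = n" "P x"
  shows "P (choose_tup n P)"
  using assms
proof (induction n arbitrary: P x)
  case (Suc n)
  define y where "y = choose_elem (\<lambda>y. \<exists>z\<in>tup n. P (y # z))"
  have D: "D1 (\<lambda>y. \<exists>z\<in>tup n. P (y # z))"
    by (rule dfb_bex[OF S_tup], rule dfb_pred[OF Suc.prems(1)]) (intro dfi, auto)
  have "\<exists>z\<in>tup n. P (hd x # z)" using Suc.prems by (cases x) auto
  from choose_elem[OF D this] obtain z where z: "length z = n" "P (y # z)" unfolding y_def by auto
  have "dfb (tup n) (\<lambda>x. x) (\<lambda>z. P (y # z))"
    by (rule dfb_pred[OF Suc.prems(1)]) (intro dfi, auto)
  from Suc.IH[OF this z] show ?case by (simp add: Let_def y_def[symmetric])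
qed simp

lemma dtm_choose_tup:
  assumes "dfb (U \<times> tup n) (\<lambda>p. c (fst p) @ snd p) (\<lambda>p. P (fst p) (snd p))" and c: "ctx U c"
  shows "dtm U c (\<lambda>e. choose_tup n (P e))"
  using assms(1)
proof (induction n arbitrary: P)
  case 0
  then show ?case by (simp add: dtm_nil[OF c])
next
  case (Suc n)
  have P1: "dts U c (\<lambda>e. choose_elem (\<lambda>y. \<exists>z\<in>tup n. P e (y # z)))"
    by (intro dts_choose_elem c dfb_bex[OF S_tup] dfb_lift_tup[OF Suc.prems] dfi) auto
  have "dtm U c (\<lambda>e. choose_tup n (\<lambda>z. P e (choose_elem (\<lambda>y. \<exists>z\<in>tup n. P e (y # z)) # z)))"
    by (intro Suc.IH dfb_lift_tup[OF Suc.prems] dfi c dtm_cons dts_fst[OF P1]) auto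
  with P1 show ?case by (auto simp: Let_def intro: dtm_cons)
qed

end

section \<open>Definable types and preorders\<close>

context fo_structure
begin

lemma dtm_lift:
  assumes "dtm U c f" "dtm V d (\<lambda>v. c (g v))" "\<And>v. v \<in> V \<Longrightarrow> g v \<in> U"
  shows "dtm V d (\<lambda>v. f (g v))"
proof -
  obtain k where k: "dt U c k f" using assms(1) unfolding dtm_def by auto
  then have G: "dfb (U \<times> tup k) (\<lambda>p. c (fst p) @ snd p) (\<lambda>p. snd p = f (fst p))"
    unfolding dt_def by simp
  have "dfb (V \<times> tup k) (\<lambda>p. d (fst p) @ snd p) (\<lambda>p. snd p = f (g (fst p)))"
    by (rule dfb_lift_tup[OF G, where g = "\<lambda>p. g (fst p)"])
      (intro dfi assms(2) dtm_ctx[OF assms(2)], use assms(3) in auto, intro dfi dtm_ctx[OF assms(2)])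
  then show ?thesis by (rule dtmI_graph) (use dt_length[OF k] assms(3) in auto)
qed

lemma dts_lift:
  assumes "dts U c f" "dtm V d (\<lambda>v. c (g v))" "\<And>v. v \<in> V \<Longrightarrow> g v \<in> U"
  shows "dts V d (\<lambda>v. f (g v))"
  by (rule dts_single, rule dtm_lift[OF dtm_single[OF assms(1)] assms(2,3)])

lemma dtm_app1: "dtm UNIV (\<lambda>x. [x]) f \<Longrightarrow> dts U c \<tau> \<Longrightarrow> dtm U c (\<lambda>e. f (\<tau> e))"
  by (rule dtm_lift) (auto intro: dfi)

lemma dts_app:
  "dts (tup k) (\<lambda>x. x) f \<Longrightarrow> dtm U c \<tau> \<Longrightarrow> (\<And>e. e \<in> U \<Longrightarrow> length (\<tau> e) = k) \<Longrightarrow> dts U c (\<lambda>e. f (\<tau> e))"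
  by (rule dts_lift) auto

text \<open>A definable type as a filter: it is complete on definable predicates, but need not be an
  ultrafilter. The last clause, definability of the type, turns \<open>eventually\<close> into a
  quantifier that preserves definability (\<open>dfb_ev\<close>).\<close>

definition deftype :: "nat \<Rightarrow> 'a list filter \<Rightarrow> bool" where
  "deftype m F \<longleftrightarrow> F \<noteq> bot \<and> (\<forall>\<^sub>F a in F. length a = m) \<and>
     (\<forall>P. dfb (tup m) (\<lambda>x. x) P \<longrightarrow> (\<forall>\<^sub>F a in F. P a) \<or> (\<forall>\<^sub>F a in F. \<not> P a)) \<and>
     (\<forall>k. \<forall>A\<in>S (k + m). {t. length t = k \<and> (\<forall>\<^sub>F a in F. t @ a \<in> A)} \<in> S k)"

lemma deftype_bot: "deftype m F \<Longrightarrow> F \<noteq> bot"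
  and deftype_length: "deftype m F \<Longrightarrow> \<forall>\<^sub>F a in F. length a = m"
  and deftype_cases:
    "deftype m F \<Longrightarrow> dfb (tup m) (\<lambda>x. x) P \<Longrightarrow> (\<forall>\<^sub>F a in F. P a) \<or> (\<forall>\<^sub>F a in F. \<not> P a)"
  and deftype_S: "deftype m F \<Longrightarrow> A \<in> S (k + m) \<Longrightarrow> {t. length t = k \<and> (\<forall>\<^sub>F a in F. t @ a \<in> A)} \<in> S k"
  unfolding deftype_def by simp_all

lemma dfb_ev:
  assumes F: "deftype m F" and P: "dfb (U \<times> tup m) (\<lambda>p. c (fst p) @ snd p) (\<lambda>p. P (fst p) (snd p))"
  shows "dfb U c (\<lambda>e. \<forall>\<^sub>F a in F. P e a)"
proof (cases "U = {}")
  case False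
  obtain N' A where A: "\<forall>p\<in>U \<times> tup m. length (c (fst p) @ snd p) = N'" "A \<in> S N'"
      "\<forall>p\<in>U \<times> tup m. P (fst p) (snd p) \<longleftrightarrow> c (fst p) @ snd p \<in> A"
    by (rule dfbE[OF P])
  have N: "length (c e) + m = N'" if "e \<in> U" for e
    using A(1)[THEN bspec, of "(e, replicate m undefined)"] that by simp
  define N where "N = N' - m"
  have len: "length (c e) = N" if "e \<in> U" for e using N[OF that] N_def by simp
  obtain e where "e \<in> U" using False by auto
  then have "A \<in> S (N + m)" using N[of e] len[of e] A(2) by simp
  then have "{t. length t = N \<and> (\<forall>\<^sub>F a in F. t @ a \<in> A)} \<in> S N" by (rule deftype_S[OF F])
  moreover have "(\<forall>\<^sub>F a in F. P e a) \<longleftrightarrow> (\<forall>\<^sub>F a in F. c e @ a \<in> A)" if e: "e \<in> U" for e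
  proof (rule eventually_cong[OF deftype_length[OF F]])
    fix a :: "'a list" assume "length a = m"
    then show "P e a \<longleftrightarrow> c e @ a \<in> A" using A(3)[THEN bspec, of "(e, a)"] e by simp
  qed
  ultimately show ?thesis using len
    by (intro dfbI[of U c N "{t. length t = N \<and> (\<forall>\<^sub>F a in F. t @ a \<in> A)}"]) simp_all
qed (simp add: dfb_empty)

definition D3 :: "nat \<Rightarrow> nat \<Rightarrow> nat \<Rightarrow> ('a list \<Rightarrow> 'a list \<Rightarrow> 'a list \<Rightarrow> bool) \<Rightarrow> bool" where
  "D3 j k l R \<longleftrightarrow> dfb ((tup j \<times> tup k) \<times> tup l) (\<lambda>p. (fst (fst p) @ snd (fst p)) @ snd p)
     (\<lambda>p. R (fst (fst p)) (snd (fst p)) (snd p))"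

lemma dfb_D3:
  assumes "D3 j k l R" "dtm U c \<rho>" "dtm U c \<sigma>" "dtm U c \<tau>" "\<And>e. e \<in> U \<Longrightarrow> length (\<rho> e) = j"
    "\<And>e. e \<in> U \<Longrightarrow> length (\<sigma> e) = k" "\<And>e. e \<in> U \<Longrightarrow> length (\<tau> e) = l"
  shows "dfb U c (\<lambda>e. R (\<rho> e) (\<sigma> e) (\<tau> e))"
  using dfb_lift0[OF assms(1)[unfolded D3_def], of U c "\<lambda>e. ((\<rho> e, \<sigma> e), \<tau> e)"] assms(2-7)
  by (simp add: dtm_append)

text \<open>
  Definable nonempty sets having a greatest and a least class is the definable counterpart of the
  finiteness of a total preorder; \<open>PW m F\<close> says that it survives passing to the limit along
  \<open>F\<close>.
\<close>

definition pw :: "nat \<Rightarrow> 'a list set \<Rightarrow> ('a list \<Rightarrow> 'a list \<Rightarrow> bool) \<Rightarrow> bool" where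
  "pw l I le \<longleftrightarrow> (\<forall>s\<in>I. \<forall>t\<in>I. le s t \<or> le t s) \<and>
     (\<forall>s\<in>I. \<forall>t\<in>I. \<forall>r\<in>I. le s t \<longrightarrow> le t r \<longrightarrow> le s r) \<and>
     (\<forall>J\<in>S l. J \<subseteq> I \<longrightarrow> J \<noteq> {} \<longrightarrow> (\<exists>s\<in>J. \<forall>t\<in>J. le t s) \<and> (\<exists>s\<in>J. \<forall>t\<in>J. le s t))"

lemma pwI:
  assumes "\<And>s t. s \<in> I \<Longrightarrow> t \<in> I \<Longrightarrow> le s t \<or> le t s"
    and "\<And>s t r. s \<in> I \<Longrightarrow> t \<in> I \<Longrightarrow> r \<in> I \<Longrightarrow> le s t \<Longrightarrow> le t r \<Longrightarrow> le s r"
    and "\<And>J. J \<in> S l \<Longrightarrow> J \<subseteq> I \<Longrightarrow> J \<noteq> {} \<Longrightarrow> \<exists>s\<in>J. \<forall>t\<in>J. le t s"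
    and "\<And>J. J \<in> S l \<Longrightarrow> J \<subseteq> I \<Longrightarrow> J \<noteq> {} \<Longrightarrow> \<exists>s\<in>J. \<forall>t\<in>J. le s t"
  shows "pw l I le"
  unfolding pw_def by (intro conjI ballI impI; rule assms; assumption)

lemma pw_total: "pw l I le \<Longrightarrow> s \<in> I \<Longrightarrow> t \<in> I \<Longrightarrow> le s t \<or> le t s"
  unfolding pw_def by (drule conjunct1) simp

lemma pw_trans:
  assumes "pw l I le" "s \<in> I" "t \<in> I" "r \<in> I" "le s t" "le t r"
  shows "le s r"
  by (rule assms(1)[unfolded pw_def, THEN conjunct2, THEN conjunct1, rule_format, OF assms(2-6)])

lemma pw_max: "pw l I le \<Longrightarrow> J \<in> S l \<Longrightarrow> J \<subseteq> I \<Longrightarrow> J \<noteq> {} \<Longrightarrow> \<exists>s\<in>J. \<forall>t\<in>J. le t s"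
  and pw_min: "pw l I le \<Longrightarrow> J \<in> S l \<Longrightarrow> J \<subseteq> I \<Longrightarrow> J \<noteq> {} \<Longrightarrow> \<exists>s\<in>J. \<forall>t\<in>J. le s t"
  unfolding pw_def by (drule conjunct2, drule conjunct2, simp)+

lemma pw_swap:
  assumes "pw l I le"
  shows "pw l I (\<lambda>s t. le t s)"
  by (rule pwI) (use pw_total[OF assms] in blast, rule pw_trans[OF assms], assumption+,
      rule pw_min[OF assms], assumption+, rule pw_max[OF assms], assumption+)

definition PW :: "nat \<Rightarrow> 'a list filter \<Rightarrow> bool" where
  "PW m F \<longleftrightarrow> (\<forall>l. \<forall>I\<in>S l. \<forall>R. D3 m l l R \<longrightarrow> (\<forall>\<^sub>F a in F. pw l I (R a)) \<longrightarrow>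
     pw l I (\<lambda>s t. \<forall>\<^sub>F a in F. R a s t))"

lemma PWD: "PW m F \<Longrightarrow> I \<in> S l \<Longrightarrow> D3 m l l R \<Longrightarrow> \<forall>\<^sub>F a in F. pw l I (R a) \<Longrightarrow>
    pw l I (\<lambda>s t. \<forall>\<^sub>F a in F. R a s t)"
  unfolding PW_def by simp

end

context dclom
begin

lemma dtm_const [dfi]: "ctx U c \<Longrightarrow> dtm U c (\<lambda>e. xs)"
  by (induction xs) (auto intro: dfi)

section \<open>Limits of preorders along an end of the line\<close>

lemma ev_total:
  assumes "deftype m F" "I \<in> S l" "D3 m l l R" "\<forall>\<^sub>F a in F. pw l I (R a)" "s \<in> I" "t \<in> I"
  shows "(\<forall>\<^sub>F a in F. R a s t) \<or> (\<forall>\<^sub>F a in F. R a t s)"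
proof -
  have "length s = l" "length t = l" using assms S_length by auto
  then have "dfb (tup m) (\<lambda>x. x) (\<lambda>a. R a s t)"
    by (intro dfb_D3[OF assms(3)] dfi) auto
  then have "(\<forall>\<^sub>F a in F. R a s t) \<or> (\<forall>\<^sub>F a in F. \<not> R a s t)" by (rule deftype_cases[OF assms(1)])
  then show ?thesis
  proof
    assume "\<forall>\<^sub>F a in F. \<not> R a s t"
    then have "\<forall>\<^sub>F a in F. R a t s" using assms(4)
      by eventually_elim (use pw_total assms(5,6) in blast)
    then show ?thesis ..
  qed simp
qed

lemma ev_trans:
  assumes "\<forall>\<^sub>F a in F. pw l I (R a)" "s \<in> I" "t \<in> I" "r \<in> I"
    "\<forall>\<^sub>F a in F. R a s t" "\<forall>\<^sub>F a in F. R a t r"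
  shows "\<forall>\<^sub>F a in F. R a s r"
  using assms(1,5,6) by eventually_elim (use pw_trans assms(2-4) in blast)

text \<open>Basic neighbourhoods of the right side of 0 (\<open>True\<close>) and of infinity
  (\<open>False\<close>); the Boolean lets one proof serve both ends. \<open>wb\<close> discards the
  parameters for which \<open>(0, u)\<close> is empty.\<close>

definition nb :: "bool \<Rightarrow> 'a \<Rightarrow> 'a \<Rightarrow> bool" where
  "nb b u t \<longleftrightarrow> (if b then 0 < t \<and> t < u else u < t)"

definition wb :: "bool \<Rightarrow> 'a \<Rightarrow> bool" where
  "wb b u \<longleftrightarrow> (b \<longrightarrow> 0 < u)"

lemma dfb_nb [dfi]: "dts U c \<tau> \<Longrightarrow> dts U c \<sigma> \<Longrightarrow> dfb U c (\<lambda>e. nb b (\<tau> e) (\<sigma> e))"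
  unfolding nb_def by (cases b) (auto intro!: dfi dest: dts_ctx)

lemma dfb_wb [dfi]: "dts U c \<tau> \<Longrightarrow> dfb U c (\<lambda>e. wb b (\<tau> e))"
  unfolding wb_def by (intro dfi dts_ctx) 

lemma nb_common: "wb b u \<Longrightarrow> wb b v \<Longrightarrow> \<exists>w. wb b w \<and> (\<forall>t. nb b w t \<longrightarrow> nb b u t \<and> nb b v t)"
  by (intro exI[of _ "if b then min u v else max u v"]) (auto simp: nb_def wb_def)

lemma nb_ex: "wb b u \<Longrightarrow> \<exists>t. nb b u t"
  using dense[of 0 u] gt_ex[of u] by (cases b) (auto simp: nb_def wb_def)

definition endf :: "bool \<Rightarrow> 'a list filter" where
  "endf b = Abs_filter (\<lambda>P. \<exists>u. wb b u \<and> (\<forall>t. nb b u t \<longrightarrow> P [t]))"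

lemma eventually_endf: "eventually P (endf b) \<longleftrightarrow> (\<exists>u. wb b u \<and> (\<forall>t. nb b u t \<longrightarrow> P [t]))"
  unfolding endf_def
proof (rule eventually_Abs_filter, rule is_filter.intro)
  show "\<exists>u. wb b u \<and> (\<forall>t. nb b u t \<longrightarrow> True)" using unit_pos by (auto simp: wb_def)
next
  fix P Q :: "'a list \<Rightarrow> bool"
  assume "\<exists>u. wb b u \<and> (\<forall>t. nb b u t \<longrightarrow> P [t])" "\<exists>u. wb b u \<and> (\<forall>t. nb b u t \<longrightarrow> Q [t])"
  then obtain u v where "wb b u" "\<forall>t. nb b u t \<longrightarrow> P [t]" "wb b v" "\<forall>t. nb b v t \<longrightarrow> Q [t]" by auto
  then show "\<exists>u. wb b u \<and> (\<forall>t. nb b u t \<longrightarrow> P [t] \<and> Q [t])" using nb_common[of b u v] by metis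
qed auto

text \<open>
  The definable types used here are iterated limits along \<open>t \<rightarrow> 0\<close> from the right
  (\<open>endf True\<close>) and, when definable sets are tame at infinity, along \<open>t \<rightarrow> \<infinity>\<close> (\<open>endf False\<close>).
\<close>

definition tame_inf :: bool where
  "tame_inf \<longleftrightarrow> (\<forall>P. D1 P \<longrightarrow> (\<exists>u. (\<forall>t>u. P t) \<or> (\<forall>t>u. \<not> P t)))"

lemma endf_cases:
  assumes "b \<or> tame_inf" "D1 P"
  shows "(\<exists>u. wb b u \<and> (\<forall>t. nb b u t \<longrightarrow> P t)) \<or> (\<exists>u. wb b u \<and> (\<forall>t. nb b u t \<longrightarrow> \<not> P t))"
proof (cases b)
  case True
  then show ?thesis using evr_cases[OF assms(2), of 0] unfolding evr_def wb_def nb_def by auto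
next
  case False
  then show ?thesis using assms unfolding tame_inf_def wb_def nb_def by metis
qed

lemma deftype_endf:
  assumes "b \<or> tame_inf"
  shows "deftype 1 (endf b)"
  unfolding deftype_def
proof (intro conjI allI impI ballI)
  show "endf b \<noteq> bot"
    unfolding trivial_limit_def eventually_endf using nb_ex by auto
  show "\<forall>\<^sub>F a in endf b. length a = 1" unfolding eventually_endf using unit_pos by (auto simp: wb_def)
next
  fix P :: "'a list \<Rightarrow> bool" assume P: "dfb (tup 1) (\<lambda>x. x) P"
  have "D1 (\<lambda>t. P [t])" by (rule dfb_pred[OF P]) (intro dfi, auto)
  from endf_cases[OF assms this] show "(\<forall>\<^sub>F a in endf b. P a) \<or> (\<forall>\<^sub>F a in endf b. \<not> P a)"
    unfolding eventually_endf .
next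
  fix k A assume A: "A \<in> S (k + 1)"
  have "dfb (tup k) (\<lambda>x. x) (\<lambda>t. \<exists>u. wb b u \<and> (\<forall>x. nb b u x \<longrightarrow> t @ [x] \<in> A))"
    by (intro dfi dtm_mem[OF A])
  then show "{t. length t = k \<and> (\<forall>\<^sub>F a in endf b. t @ a \<in> A)} \<in> S k"
    unfolding dfb_tup_iff eventually_endf .
qed

text \<open>Definable connectedness of intervals: the initial segments of \<open>[y1, y2]\<close>
  equivalent to \<open>y1\<close> have a supremum, and local constancy at it carries them further
  unless it is \<open>y2\<close>.\<close>

lemma locally_constant_imp_constant:
  assumes E: "D2 E" and sym: "\<And>x y. c < x \<Longrightarrow> x < d \<Longrightarrow> c < y \<Longrightarrow> y < d \<Longrightarrow> E x y \<Longrightarrow> E y x"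
    and tr: "\<And>x y z. c < x \<Longrightarrow> x < d \<Longrightarrow> c < y \<Longrightarrow> y < d \<Longrightarrow> c < z \<Longrightarrow> z < d \<Longrightarrow> E x y \<Longrightarrow> E y z \<Longrightarrow> E x z"
    and loc: "\<And>y. c < y \<Longrightarrow> y < d \<Longrightarrow> \<exists>p q. p < y \<and> y < q \<and> (\<forall>z. p < z \<and> z < q \<longrightarrow> E z y)"
    and y: "c < y1" "y1 < y2" "y2 < d"
  shows "E y2 y1"
proof -
  define H where "H x \<longleftrightarrow> y1 \<le> x \<and> x \<le> y2 \<and> (\<forall>z. y1 \<le> z \<and> z \<le> x \<longrightarrow> E z y1)" for x
  have DH: "D1 H" unfolding H_def by (intro dfi dfb_D2[OF E])
  have y1d: "y1 < d" using y by (auto intro: order.strict_trans)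
  have "E y1 y1" using loc[OF y(1) y1d] by auto
  then have H1: "H y1" using y unfolding H_def by auto
  obtain s where s: "is_lub H s" using lub_ex[OF DH H1, of y2] unfolding H_def by auto
  have "y1 \<le> s" "s \<le> y2" using s H1 unfolding is_lub_def H_def by auto
  then have cs: "c < s" "s < d" using y by (auto intro: less_le_trans le_less_trans)
  obtain p q where pq: "p < s" "s < q" "\<forall>z. p < z \<and> z < q \<longrightarrow> E z s" using loc[OF cs] by auto
  obtain x where x: "H x" "p < x" "x \<le> s" using lub_less[OF s pq(1)] by auto
  have xd: "c < x" "x < d" using x cs y unfolding H_def by (auto intro: less_le_trans le_less_trans)
  have "E x s" using pq x by (auto intro: le_less_trans)
  then have sx: "E s x" using sym xd cs by blast
  have "E x y1" using x unfolding H_def by auto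
  then have sy: "E s y1" using tr[OF cs xd y(1) y1d sx] by blast
  have ext: "H x'" if x': "s \<le> x'" "x' < q" "x' \<le> y2" for x'
    unfolding H_def
  proof (intro conjI allI impI)
    show "y1 \<le> x'" using \<open>y1 \<le> s\<close> x' by auto
    show "x' \<le> y2" by fact
    fix z assume z: "y1 \<le> z \<and> z \<le> x'"
    show "E z y1"
    proof (cases "z \<le> x")
      case True
      then show ?thesis using x z unfolding H_def by auto
    next
      case False
      then have "p < z" "z < q" using order.strict_trans[OF x(2)] z x'(2) le_less_trans[of z x' q] by auto
      then have "E z s" using pq(3) by blast
      moreover have "c < z" "z < d" using z x' y by (auto intro: less_le_trans le_less_trans)
      ultimately show ?thesis using tr[OF _ _ cs y(1) y1d _ sy] by blast
    qed
  qed
  have "s = y2"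
  proof (rule ccontr)
    assume "s \<noteq> y2"
    then have "s < min q y2" using \<open>s \<le> y2\<close> pq by auto
    then obtain x' where "s < x'" "x' < min q y2" using dense by blast
    then have "H x'" "s < x'" using ext by auto
    then show False using s unfolding is_lub_def by auto
  qed
  then show ?thesis using sy by simp
qed

text \<open>Let \<open>v\<close> be a greatest element that is eventually below the curve. If the
  curve stayed strictly above \<open>v\<close>, a least element \<open>k\<close> of \<open>I\<close>
  above \<open>v\<close> would be eventually below the curve too, against the choice of
  \<open>v\<close>. So the curve stays in the class of \<open>v\<close> near
  \<open>x0\<close>.\<close>

lemma pw_curve:
  assumes pw: "pw l I le" and I: "I \<in> S l" and x0: "x0 < x2"
    and le: "dfb (tup l \<times> tup l) (\<lambda>p. fst p @ snd p) (\<lambda>p. le (fst p) (snd p))"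
    and w: "dtm UNIV (\<lambda>x. [x]) w" and lw: "\<And>y. length (w y) = l"
    and wI: "\<And>y. x0 < y \<Longrightarrow> y < x2 \<Longrightarrow> w y \<in> I"
  shows "\<exists>x1. x0 < x1 \<and> x1 \<le> x2 \<and> (\<forall>z z'. x0 < z \<and> z < x1 \<and> x0 < z' \<and> z' < x1 \<longrightarrow> le (w z) (w z'))"
proof -
  define V where "V = {v. length v = l \<and> v \<in> I \<and> evr x0 (\<lambda>y. le v (w y))}"
  have "dfb (tup l) (\<lambda>x. x) (\<lambda>v. v \<in> I \<and> evr x0 (\<lambda>y. le v (w y)))"
    by (intro dfi dtm_mem[OF I] dfb_pair[OF le] dtm_app1[OF w]) (auto simp: lw)
  then have V: "V \<in> S l" unfolding V_def dfb_tup_iff .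
  obtain y0 where "x0 < y0" "y0 < x2" using dense x0 by auto
  then have "I \<noteq> {}" using wI by auto
  then obtain v0 where v0: "v0 \<in> I" "\<forall>t\<in>I. le v0 t" using pw_min[OF pw I] by auto
  have "v0 \<in> V" unfolding V_def evr_def using v0 wI x0 S_length[OF I] by auto
  then have "V \<noteq> {}" "V \<subseteq> I" unfolding V_def by auto
  then obtain v where v: "v \<in> V" "\<forall>t\<in>V. le t v" using pw_max[OF pw V] by auto
  have vI: "v \<in> I" "length v = l" "evr x0 (\<lambda>y. le v (w y))" using v unfolding V_def by auto
  have "D1 (\<lambda>y. le (w y) v)"
    by (intro dfi dfb_pair[OF le] dtm_app1[OF w]) (auto simp: lw vI)
  then have "evr x0 (\<lambda>y. le (w y) v) \<or> evr x0 (\<lambda>y. \<not> le (w y) v)" by (rule evr_cases)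
  then have up: "evr x0 (\<lambda>y. le (w y) v)"
  proof
    assume above: "evr x0 (\<lambda>y. \<not> le (w y) v)"
    define K where "K = {t. length t = l \<and> t \<in> I \<and> \<not> le t v}"
    have "dfb (tup l) (\<lambda>x. x) (\<lambda>t. t \<in> I \<and> \<not> le t v)"
      by (intro dfi dtm_mem[OF I] dfb_pair[OF le]) (auto simp: vI)
    then have K: "K \<in> S l" unfolding K_def dfb_tup_iff .
    obtain y1 where y1: "x0 < y1" "y1 < x2" "\<not> le (w y1) v" using evr_ex[OF above x0] by auto
    have "K \<noteq> {}" "K \<subseteq> I" using y1 wI lw unfolding K_def by auto
    then obtain k where k: "k \<in> K" "\<forall>t\<in>K. le k t" using pw_min[OF pw K] by auto
    have "evr x0 (\<lambda>y. le k (w y))"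
      by (rule evr_mono[OF evr_conj[OF above evr_less[OF x0]]]) (use k wI lw in \<open>auto simp: K_def\<close>)
    then have "k \<in> V" using k unfolding V_def K_def by auto
    then have "le k v" using v by auto
    then show ?thesis using k unfolding K_def by auto
  qed
  obtain x1 where x1: "x0 < x1" "\<forall>z. x0 < z \<and> z < x1 \<longrightarrow> le v (w z) \<and> le (w z) v"
    using evr_conj[OF vI(3) up] unfolding evr_def by auto
  show ?thesis
  proof (intro exI[of _ "min x1 x2"] conjI allI impI)
    fix z z' assume z: "x0 < z \<and> z < min x1 x2 \<and> x0 < z' \<and> z' < min x1 x2"
    then have "le (w z) v" "le v (w z')" "w z \<in> I" "w z' \<in> I" using x1 wI by auto
    then show "le (w z) (w z')" using pw_trans[OF pw _ vI(1)] by blast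
  qed (use x1 x0 in auto)
qed

end

context dclom
begin

text \<open>Such an \<open>f\<close> has a definable section \<open>w\<close> over
  \<open>(p, q)\<close> whose values are pairwise inequivalent in the limit. For fixed
  \<open>x\<close>, however, \<open>pw_curve\<close> makes \<open>w\<close> constant up to
  equivalence on an initial part of every subinterval, and \<open>monotone_cover\<close> makes this
  uniform in \<open>x\<close>, so two values of \<open>w\<close> are equivalent in the limit after
  all.\<close>

lemma endf_no_injective_interval:
  assumes b: "b \<or> tame_inf" and I: "I \<in> S l" and R: "D3 1 l l R"
    and pwR: "\<forall>\<^sub>F a in endf b. pw l I (R a)" and Q: "Q \<in> S l" "Q \<subseteq> I"
    and sep: "\<And>s t. s \<in> Q \<Longrightarrow> t \<in> Q \<Longrightarrow> \<forall>\<^sub>F a in endf b. R a s t \<Longrightarrow> \<forall>\<^sub>F a in endf b. R a t s \<Longrightarrow> s = t"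
    and f: "dts (tup l) (\<lambda>x. x) f" and pq: "p < q"
    and im: "\<And>y. p < y \<Longrightarrow> y < q \<Longrightarrow> \<exists>s\<in>Q. f s = y"
  shows False
proof -
  obtain u0 where u0: "wb b u0" "\<forall>x. nb b u0 x \<longrightarrow> pw l I (R [x])"
    using pwR unfolding eventually_endf by (elim exE conjE)
  define w where "w y = choose_tup l (\<lambda>s. s \<in> Q \<and> f s = y)" for y
  have lw: "length (w y) = l" for y unfolding w_def by simp
  have wD: "dtm UNIV (\<lambda>x. [x]) w"
    unfolding w_def by (rule dtm_choose_tup) (intro dfi dtm_mem[OF Q(1)] dts_app[OF f], auto intro: dfi)
  have w: "w y \<in> Q" "f (w y) = y" if y: "p < y" "y < q" for y
  proof -
    obtain s where s: "s \<in> Q" "f s = y" using im y by auto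
    have "dfb (tup l) (\<lambda>x. x) (\<lambda>s. s \<in> Q \<and> f s = y)"
      by (intro dfi dtm_mem[OF Q(1)] dts_app[OF f]) auto
    from choose_tup[OF this S_length[OF Q(1) s(1)]] s show "w y \<in> Q" "f (w y) = y"
      unfolding w_def by auto
  qed
  define E where "E x z y \<longleftrightarrow> R [x] (w z) (w y) \<and> R [x] (w y) (w z)" for x z y
  have E2: "D2 (E x)" for x
    unfolding E_def by (intro dfi dfb_D3[OF R] dtm_app1[OF wD]) (auto simp: lw)
  \<comment> \<open>Jumps of the class of \<open>w\<close> at stage \<open>x\<close>. By
    \<open>curve\<close>, no subinterval consists of jumps only when \<open>x\<close> is close to
    the end.\<close>
  define Jmp where "Jmp x y \<longleftrightarrow> \<not> (\<exists>c d. p \<le> c \<and> c < y \<and> y < d \<and> d \<le> q \<and> (\<forall>z. c < z \<and> z < d \<longrightarrow> E x z y))"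
    for x y
  have Jmp: "D2 (\<lambda>x y. Jmp x y)"
    unfolding Jmp_def E_def by (intro dfi dfb_D3[OF R] dtm_app1[OF wD]) (auto simp: lw)
  have curve: "\<exists>x1. x0 < x1 \<and> x1 \<le> x2 \<and> (\<forall>z z'. x0 < z \<and> z < x1 \<and> x0 < z' \<and> z' < x1 \<longrightarrow> E x z z')"
    if x: "nb b u0 x" and x0: "p \<le> x0" "x0 < x2" "x2 \<le> q" for x x0 x2
  proof -
    have D: "dfb (tup l \<times> tup l) (\<lambda>p. fst p @ snd p) (\<lambda>p. R [x] (fst p) (snd p))"
      by (intro dfb_D3[OF R] dfi) auto
    have "w y \<in> I" if "x0 < y" "y < x2" for y using w(1)[of y] Q(2) that x0 by (auto intro: le_less_trans less_le_trans)
    from pw_curve[OF u0(2)[rule_format, OF x] I x0(2) D wD lw this]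
    show ?thesis unfolding E_def by metis
  qed
  have free: "\<exists>y. c < y \<and> y < d \<and> \<not> Jmp x y" if x: "nb b u0 x" and cd: "p \<le> c" "c < d" "d \<le> q" for x c d
  proof -
    obtain x1 where x1: "c < x1" "x1 \<le> d"
      "\<forall>z z'. c < z \<and> z < x1 \<and> c < z' \<and> z' < x1 \<longrightarrow> E x z z'" using curve[OF x cd] by auto
    obtain y where y: "c < y" "y < x1" using dense[OF x1(1)] by auto
    have "\<not> Jmp x y" unfolding Jmp_def not_not
      by (intro exI[of _ c] exI[of _ x1]) (use x1 y cd in auto)
    then show ?thesis using y x1 by (auto intro: less_le_trans)
  qed
  \<comment> \<open>The neighbourhood of the end on which \<open>P\<close> holds depends on
    \<open>y\<close>. These neighbourhoods form a chain, so \<open>monotone_cover\<close> finds a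
    subinterval of points \<open>y\<close> that share one.\<close>
  have uniform: "\<exists>u c' d'. wb b u \<and> c \<le> c' \<and> c' < d' \<and> d' \<le> d \<and>
      (\<forall>y. c' < y \<and> y < d' \<longrightarrow> (\<forall>x. nb b u x \<longrightarrow> P x y))"
    if P: "D2 P" and cd: "c < d" and ev: "\<And>y. c < y \<Longrightarrow> y < d \<Longrightarrow> \<forall>\<^sub>F a in endf b. P (hd a) y" for P c d
  proof -
    define G where "G u y \<longleftrightarrow> wb b u \<and> (\<forall>x. nb b u x \<longrightarrow> P x y)" for u y
    have G: "D2 G" unfolding G_def by (intro dfi dfb_D2[OF P])
    have "\<exists>u c' d'. c \<le> c' \<and> c' < d' \<and> d' \<le> d \<and> (\<forall>y. c' < y \<and> y < d' \<longrightarrow> G u y)"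
    proof (rule monotone_cover[OF G _ cd])
      show "(\<forall>y. G u y \<longrightarrow> G v y) \<or> (\<forall>y. G v y \<longrightarrow> G u y)" for u v
      proof -
        have "(wb b u \<longrightarrow> wb b v \<and> (\<forall>x. nb b v x \<longrightarrow> nb b u x)) \<or> (wb b v \<longrightarrow> wb b u \<and> (\<forall>x. nb b u x \<longrightarrow> nb b v x))"
          by (cases "u \<le> v"; cases b) (auto simp: wb_def nb_def)
        then show ?thesis unfolding G_def by metis
      qed
      show "\<exists>u. G u y" if "c < y" "y < d" for y
        using ev[OF that] unfolding eventually_endf G_def by simp
    qed
    then obtain u c' d' where *: "c \<le> c'" "c' < d'" "d' \<le> d" "\<forall>y. c' < y \<and> y < d' \<longrightarrow> G u y" by auto
    obtain y where "c' < y" "y < d'" using dense[OF *(2)] by auto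
    then have "wb b u" using * unfolding G_def by auto
    then show ?thesis using * unfolding G_def by metis
  qed
  define C where "C y \<longleftrightarrow> (\<forall>\<^sub>F a in endf b. Jmp (hd a) y)" for y
  have C_alt: "C y \<longleftrightarrow> (\<exists>u. wb b u \<and> (\<forall>x. nb b u x \<longrightarrow> Jmp x y))" for y
    unfolding C_def eventually_endf by simp
  have DC: "D1 C" unfolding C_alt by (intro dfi dfb_D2[OF Jmp])
  have notC: "\<forall>\<^sub>F a in endf b. \<not> Jmp (hd a) y" if "\<not> C y" for y
  proof -
    have "D1 (\<lambda>x. Jmp x y)" by (intro dfi dfb_D2[OF Jmp])
    from endf_cases[OF b this] show ?thesis using that unfolding C_alt eventually_endf by auto
  qed
  \<comment> \<open>If the points of an interval were all eventually jumps, then by uniformity a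
    whole subinterval would jump at a single stage, contradicting \<open>free\<close>.\<close>
  have "\<not> evr p C"
  proof
    assume "evr p C"
    then obtain d where d: "p < d" "\<forall>y. p < y \<and> y < d \<longrightarrow> C y" unfolding evr_def by auto
    have pm: "p < min d q" using d(1) pq by simp
    have "\<exists>u c' d'. wb b u \<and> p \<le> c' \<and> c' < d' \<and> d' \<le> min d q \<and>
        (\<forall>y. c' < y \<and> y < d' \<longrightarrow> (\<forall>x. nb b u x \<longrightarrow> Jmp x y))"
      by (rule uniform[OF Jmp pm]) (use d(2) in \<open>auto simp: C_def\<close>)
    then obtain u c' d' where *: "wb b u" "p \<le> c'" "c' < d'" "d' \<le> min d q"
      "\<forall>y. c' < y \<and> y < d' \<longrightarrow> (\<forall>x. nb b u x \<longrightarrow> Jmp x y)" by (elim exE conjE)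
    obtain v where v: "wb b v" "\<forall>x. nb b v x \<longrightarrow> nb b u x \<and> nb b u0 x"
      using nb_common[OF *(1) u0(1)] by auto
    obtain x where "nb b v x" using nb_ex[OF v(1)] by auto
    then have x: "nb b u x" "nb b u0 x" using v by auto
    obtain y where "c' < y" "y < d'" "\<not> Jmp x y" using free[OF x(2) *(2,3)] *(4) by auto
    then show False using *(5) x by auto
  qed
  then have "evr p (\<lambda>y. \<not> C y)" using evr_cases[OF DC] by auto
  then obtain d where d: "p < d" "\<forall>y. p < y \<and> y < d \<longrightarrow> \<not> C y" unfolding evr_def by auto
  have pm: "p < min d q" using d(1) pq by simp
  have nJ: "D2 (\<lambda>x y. \<not> Jmp x y)" by (intro dfi Jmp)
  have "\<exists>u c' d'. wb b u \<and> p \<le> c' \<and> c' < d' \<and> d' \<le> min d q \<and>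
      (\<forall>y. c' < y \<and> y < d' \<longrightarrow> (\<forall>x. nb b u x \<longrightarrow> \<not> Jmp x y))"
    by (rule uniform[OF nJ pm], rule notC) (use d(2) in auto)
  then obtain u c' d' where *: "wb b u" "p \<le> c'" "c' < d'" "d' \<le> min d q"
      "\<forall>y. c' < y \<and> y < d' \<longrightarrow> (\<forall>x. nb b u x \<longrightarrow> \<not> Jmp x y)" by (elim exE conjE)
  obtain y1 where y1: "c' < y1" "y1 < d'" using dense[OF *(3)] by auto
  obtain y2 where y2: "y1 < y2" "y2 < d'" using dense[OF y1(2)] by auto
  obtain v where v: "wb b v" "\<forall>x. nb b v x \<longrightarrow> nb b u x \<and> nb b u0 x"
    using nb_common[OF *(1) u0(1)] by auto
  have inq: "p < y" "y < q" if "c' < y" "y < d'" for y using that * by (auto intro: le_less_trans less_le_trans)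
  have E12: "E x y2 y1" if x: "nb b v x" for x
  proof (rule locally_constant_imp_constant[OF E2, of c' d'])
    have pwx: "pw l I (R [x])" using u0 v x by auto
    show "E x z y" if "E x y z" for y z using that unfolding E_def by auto
    show "E x y r" if "c' < y" "y < d'" "c' < z" "z < d'" "c' < r" "r < d'" "E x y z" "E x z r" for y z r
    proof -
      have "w y \<in> I" "w z \<in> I" "w r \<in> I" using w(1) inq that Q(2) by blast+
      then show ?thesis using pw_trans[OF pwx] that(7,8) unfolding E_def by blast
    qed
    show "\<exists>p q. p < y \<and> y < q \<and> (\<forall>z. p < z \<and> z < q \<longrightarrow> E x z y)" if "c' < y" "y < d'" for y
    proof -
      have "\<not> Jmp x y" using *(5) that v x by auto
      then show ?thesis unfolding Jmp_def by auto
    qed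
  qed (use y1 y2 in auto)
  have "\<forall>\<^sub>F a in endf b. R a (w y2) (w y1)" "\<forall>\<^sub>F a in endf b. R a (w y1) (w y2)"
    unfolding eventually_endf using v(1) E12 unfolding E_def by auto
  moreover have i1: "p < y1" "y1 < q" and i2: "p < y2" "y2 < q"
    using inq[OF y1] inq[OF order.strict_trans[OF y1(1) y2(1)] y2(2)] by simp_all
  ultimately have "w y1 = w y2" using sep[of "w y2" "w y1"] w(1)[OF i1] w(1)[OF i2] by simp
  then have "y1 = y2" using w(2)[OF i1] w(2)[OF i2] by (metis (no_types))
  then show False using y2 by simp
qed

text \<open>Were there no greatest class, each representative \<open>s\<close> would cease to be
  maximal from some stage \<open>f s\<close> on, while every single stage has a maximal element. The
  values of \<open>f\<close> are tame at the end. Either they contain an interval, which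
  \<open>endf_no_injective_interval\<close> excludes, or they keep away from the end, and then a
  stage close to the end has no maximal element.\<close>

lemma endf_max:
  assumes b: "b \<or> tame_inf" and I: "I \<in> S l" and R: "D3 1 l l R"
    and pwR: "\<forall>\<^sub>F a in endf b. pw l I (R a)" and J: "J \<in> S l" "J \<subseteq> I" "J \<noteq> {}"
  shows "\<exists>s\<in>J. \<forall>t\<in>J. \<forall>\<^sub>F a in endf b. R a t s"
proof (rule ccontr)
  assume no: "\<not> ?thesis"
  note F = deftype_endf[OF b]
  define L where "L s t \<longleftrightarrow> (\<forall>\<^sub>F a in endf b. R a s t)" for s t
  obtain u0 where u0: "wb b u0" "\<forall>x. nb b u0 x \<longrightarrow> pw l I (R [x])"
    using pwR unfolding eventually_endf by (elim exE conjE)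
  have LD: "dfb (tup l \<times> tup l) (\<lambda>p. fst p @ snd p) (\<lambda>p. L (fst p) (snd p))"
    unfolding L_def by (rule dfb_ev[OF F]) (intro dfb_D3[OF R] dfi, auto)
  have tot: "L s t \<or> L t s" if "s \<in> I" "t \<in> I" for s t
    unfolding L_def by (rule ev_total[OF F I R pwR that])
  have tr: "L s r" if "s \<in> I" "t \<in> I" "r \<in> I" "L s t" "L t r" for s t r
    using ev_trans[OF pwR that(1-3)] that(4,5) unfolding L_def by simp
  \<comment> \<open>Representatives of the limit classes, so that distinct elements of
    \<open>Q\<close> are inequivalent in the limit.\<close>
  define \<kappa> where "\<kappa> s = choose_tup l (\<lambda>t. t \<in> J \<and> L s t \<and> L t s)" for s
  have \<kappa>D: "dtm (tup l) (\<lambda>x. x) \<kappa>"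
    unfolding \<kappa>_def
    by (rule dtm_choose_tup) (intro dfi dtm_mem[OF J(1)] dfb_pair[OF LD], auto intro: dfi)
  have \<kappa>: "\<kappa> s \<in> J" "L s (\<kappa> s)" "L (\<kappa> s) s" if s: "s \<in> J" for s
  proof -
    have ls: "length s = l" using S_length[OF J(1) s] .
    have "dfb (tup l) (\<lambda>x. x) (\<lambda>t. t \<in> J \<and> L s t \<and> L t s)"
      by (intro dfi dtm_mem[OF J(1)] dfb_pair[OF LD]) (auto simp: ls)
    from choose_tup[OF this ls] tot[of s s] s J(2) show "\<kappa> s \<in> J" "L s (\<kappa> s)" "L (\<kappa> s) s"
      unfolding \<kappa>_def by auto
  qed
  have \<kappa>_eq: "\<kappa> s = \<kappa> t" if "s \<in> J" "t \<in> J" "L s t" "L t s" for s t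
  proof -
    have "(r \<in> J \<and> L s r \<and> L r s) \<longleftrightarrow> (r \<in> J \<and> L t r \<and> L r t)" for r
      using tr[of s t r] tr[of t s r] tr[of r s t] tr[of r t s] that J(2) by blast
    then show ?thesis unfolding \<kappa>_def by simp
  qed
  define Q where "Q = {s. length s = l \<and> (s \<in> J \<and> \<kappa> s = s)}"
  have "dfb (tup l) (\<lambda>x. x) (\<lambda>s. s \<in> J \<and> \<kappa> s = s)"
    by (intro dfi dtm_mem[OF J(1)] \<kappa>D)
  then have Q: "Q \<in> S l" unfolding Q_def dfb_tup_iff .
  have QJ: "Q \<subseteq> J" "Q \<subseteq> I" using J(2) unfolding Q_def by auto
  have \<kappa>Q: "\<kappa> s \<in> Q" if "s \<in> J" for s
  proof -
    have "\<kappa> (\<kappa> s) = \<kappa> s" using \<kappa>_eq[of "\<kappa> s" s] \<kappa>[OF that] that by auto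
    then show ?thesis using \<kappa>[OF that] S_length[OF J(1)] unfolding Q_def by auto
  qed
  have sep: "s = t" if "s \<in> Q" "t \<in> Q" "L s t" "L t s" for s t
    using \<kappa>_eq[of s t] that unfolding Q_def by auto
  have Qne: "Q \<noteq> {}" using \<kappa>Q J(3) by auto
  have nomax: "\<exists>t\<in>Q. \<not> L t s" if s: "s \<in> Q" for s
  proof -
    obtain t where t: "t \<in> J" "\<not> L t s" using no s QJ(1) unfolding L_def by auto
    then have "\<not> L (\<kappa> t) s" using tr[of t "\<kappa> t" s] \<kappa>[OF t(1)] s QJ J(2) by blast
    then show ?thesis using \<kappa>Q[OF t(1)] by auto
  qed
  define Mx where "Mx x s \<longleftrightarrow> s \<in> Q \<and> (\<forall>t\<in>Q. R [x] t s)" for x s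
  have Mx_ex: "\<exists>s. Mx x s" if "nb b u0 x" for x
    using pw_max[OF u0(2)[rule_format, OF that] Q QJ(2) Qne] unfolding Mx_def by auto
  define f where "f s = choose_elem (\<lambda>u. wb b u \<and> (\<forall>x. nb b u x \<longrightarrow> \<not> Mx x s))" for s
  have fD: "dts (tup l) (\<lambda>x. x) f"
    unfolding f_def Mx_def
    by (rule dts_choose_elem) (intro dfi dtm_mem[OF Q] dfb_ball[OF Q] dfb_D3[OF R], auto intro: dfi)
  have f: "wb b (f s)" "\<forall>x. nb b (f s) x \<longrightarrow> \<not> Mx x s" if s: "s \<in> Q" for s
  proof -
    have ls: "length s = l" using S_length[OF Q s] .
    obtain t where t: "t \<in> Q" "\<not> L t s" using nomax[OF s] by auto
    have lt: "length t = l" using S_length[OF Q t(1)] .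
    have "D1 (\<lambda>x. R [x] t s)" by (intro dfb_D3[OF R] dfi) (auto simp: ls lt)
    from endf_cases[OF b this] t(2) obtain u where u: "wb b u" "\<forall>x. nb b u x \<longrightarrow> \<not> R [x] t s"
      unfolding L_def eventually_endf by auto
    have D: "D1 (\<lambda>u. wb b u \<and> (\<forall>x. nb b u x \<longrightarrow> \<not> Mx x s))"
      unfolding Mx_def by (intro dfi dtm_mem[OF Q] dfb_ball[OF Q] dfb_D3[OF R]) (auto simp: ls)
    have "wb b u \<and> (\<forall>x. nb b u x \<longrightarrow> \<not> Mx x s)" using u t(1) unfolding Mx_def by auto
    from choose_elem[OF D this] show "wb b (f s)" "\<forall>x. nb b (f s) x \<longrightarrow> \<not> Mx x s" unfolding f_def by simp_all
  qed
  have "D1 (\<lambda>y. \<exists>s\<in>Q. f s = y)" by (intro dfi dfb_bex[OF Q] dts_app[OF fD]) auto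
  from endf_cases[OF b this] show False
  proof
    assume "\<exists>u. wb b u \<and> (\<forall>t. nb b u t \<longrightarrow> (\<exists>s\<in>Q. f s = t))"
    then obtain u where u: "wb b u" "\<forall>t. nb b u t \<longrightarrow> (\<exists>s\<in>Q. f s = t)" by auto
    obtain p q where pq: "p < q" "\<And>y. p < y \<Longrightarrow> y < q \<Longrightarrow> nb b u y"
    proof (cases b)
      case True
      then show thesis using that[of 0 u] u(1) by (auto simp: nb_def wb_def)
    next
      case False
      obtain q where "u < q" using gt_ex by auto
      then show thesis using that[of u q] False by (auto simp: nb_def)
    qed
    show False
      by (rule endf_no_injective_interval[OF b I R pwR Q QJ(2) _ fD pq(1)])
        (use sep u(2) pq(2) in \<open>auto simp: L_def\<close>)
  next
    assume "\<exists>u. wb b u \<and> (\<forall>t. nb b u t \<longrightarrow> \<not> (\<exists>s\<in>Q. f s = t))"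
    then obtain u1 where u1: "wb b u1" "\<forall>t. nb b u1 t \<longrightarrow> \<not> (\<exists>s\<in>Q. f s = t)" by auto
    obtain v where v: "wb b v" "\<forall>x. nb b v x \<longrightarrow> nb b u1 x \<and> nb b u0 x"
      using nb_common[OF u1(1) u0(1)] by auto
    obtain x where "nb b v x" using nb_ex[OF v(1)] by auto
    then have x: "nb b u1 x" "nb b u0 x" using v by auto
    obtain s where s: "Mx x s" using Mx_ex[OF x(2)] by auto
    then have sQ: "s \<in> Q" unfolding Mx_def by simp
    \<comment> \<open>As \<open>f s\<close> is not close to the end, the stage \<open>x\<close> lies
      beyond it, where \<open>s\<close> has stopped being maximal.\<close>
    have "\<not> nb b u1 (f s)" using u1(2) sQ by auto
    then have "nb b (f s) x" using x(1) f(1)[OF sQ] unfolding nb_def wb_def by (auto split: if_splits)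
    then show False using f(2)[OF sQ] s by auto
  qed
qed

lemma D3_swap:
  assumes "D3 m l l R"
  shows "D3 m l l (\<lambda>a s t. R a t s)"
  unfolding D3_def by (intro dfb_D3[OF assms] dfi) auto

lemma PW_endf:
  assumes b: "b \<or> tame_inf"
  shows "PW 1 (endf b)"
  unfolding PW_def
proof (intro allI ballI impI)
  fix l I R assume I: "I \<in> S l" and R: "D3 1 l l R" and pwR: "\<forall>\<^sub>F a in endf b. pw l I (R a)"
  have swap: "\<forall>\<^sub>F a in endf b. pw l I (\<lambda>s t. R a t s)"
    using pwR by eventually_elim (rule pw_swap)
  show "pw l I (\<lambda>s t. \<forall>\<^sub>F a in endf b. R a s t)"
  proof (rule pwI)
    show "(\<forall>\<^sub>F a in endf b. R a s t) \<or> (\<forall>\<^sub>F a in endf b. R a t s)" if "s \<in> I" "t \<in> I" for s t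
      by (rule ev_total[OF deftype_endf[OF b] I R pwR that])
    show "\<forall>\<^sub>F a in endf b. R a s r" if "s \<in> I" "t \<in> I" "r \<in> I"
      "\<forall>\<^sub>F a in endf b. R a s t" "\<forall>\<^sub>F a in endf b. R a t r" for s t r
      by (rule ev_trans[OF pwR that])
    show "\<exists>s\<in>J. \<forall>t\<in>J. \<forall>\<^sub>F a in endf b. R a t s" if "J \<in> S l" "J \<subseteq> I" "J \<noteq> {}" for J
      by (rule endf_max[OF b I R pwR that])
    show "\<exists>s\<in>J. \<forall>t\<in>J. \<forall>\<^sub>F a in endf b. R a s t" if "J \<in> S l" "J \<subseteq> I" "J \<noteq> {}" for J
      by (rule endf_max[OF b I D3_swap[OF R] swap that])
  qed
qed

section \<open>Iterated limits and images of types\<close>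

definition prodf :: "'a list filter \<Rightarrow> 'a list filter \<Rightarrow> 'a list filter" where
  "prodf F G = Abs_filter (\<lambda>P. \<forall>\<^sub>F a in F. \<forall>\<^sub>F b in G. P (a @ b))"

lemma eventually_prodf: "eventually P (prodf F G) \<longleftrightarrow> (\<forall>\<^sub>F a in F. \<forall>\<^sub>F b in G. P (a @ b))"
  unfolding prodf_def
proof (rule eventually_Abs_filter, rule is_filter.intro)
  fix P Q :: "'a list \<Rightarrow> bool"
  assume "\<forall>\<^sub>F a in F. \<forall>\<^sub>F b in G. P (a @ b)" "\<forall>\<^sub>F a in F. \<forall>\<^sub>F b in G. Q (a @ b)"
  then show "\<forall>\<^sub>F a in F. \<forall>\<^sub>F b in G. P (a @ b) \<and> Q (a @ b)"
    by eventually_elim (rule eventually_conj)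
next
  fix P Q :: "'a list \<Rightarrow> bool"
  assume PQ: "\<forall>x. P x \<longrightarrow> Q x" and "\<forall>\<^sub>F a in F. \<forall>\<^sub>F b in G. P (a @ b)"
  from this(2) show "\<forall>\<^sub>F a in F. \<forall>\<^sub>F b in G. Q (a @ b)"
    by (rule eventually_mono) (erule eventually_mono, use PQ in simp)
qed simp

text \<open>In \<open>prodf F G\<close> the second block is generic over the first. The inner limit
  is a definable predicate of the first block because \<open>G\<close> is definable, so
  \<open>F\<close> decides it.\<close>

lemma deftype_prodf:
  assumes F: "deftype m F" and G: "deftype j G"
  shows "deftype (m + j) (prodf F G)"
  unfolding deftype_def
proof (intro conjI allI impI ballI)
  show "prodf F G \<noteq> bot"
    using deftype_bot[OF F] deftype_bot[OF G]
    unfolding trivial_limit_def eventually_prodf by simp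
  show "\<forall>\<^sub>F a in prodf F G. length a = m + j"
    unfolding eventually_prodf using deftype_length[OF F]
  proof eventually_elim
    case (elim a)
    show ?case using deftype_length[OF G] by eventually_elim (use elim in simp)
  qed
next
  fix P :: "'a list \<Rightarrow> bool" assume P: "dfb (tup (m + j)) (\<lambda>x. x) P"
  have P2: "dfb (tup m \<times> tup j) (\<lambda>p. fst p @ snd p) (\<lambda>p. P (fst p @ snd p))"
    by (rule dfb_pred[OF P]) (intro dfi, auto)
  have "dfb (tup m) (\<lambda>x. x) (\<lambda>a. \<forall>\<^sub>F b in G. P (a @ b))" by (rule dfb_ev[OF G P2])
  then have "(\<forall>\<^sub>F a in F. \<forall>\<^sub>F b in G. P (a @ b)) \<or> (\<forall>\<^sub>F a in F. \<not> (\<forall>\<^sub>F b in G. P (a @ b)))"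
    by (rule deftype_cases[OF F])
  then show "(\<forall>\<^sub>F a in prodf F G. P a) \<or> (\<forall>\<^sub>F a in prodf F G. \<not> P a)"
  proof
    assume "\<forall>\<^sub>F a in F. \<not> (\<forall>\<^sub>F b in G. P (a @ b))"
    then have "\<forall>\<^sub>F a in F. \<forall>\<^sub>F b in G. \<not> P (a @ b)" using deftype_length[OF F]
    proof eventually_elim
      case (elim a)
      have "dfb (tup j) (\<lambda>x. x) (\<lambda>b. P (a @ b))"
        by (rule dfb_pred[OF P]) (intro dfi, use elim in auto)
      then show ?case using deftype_cases[OF G] elim by auto
    qed
    then show ?thesis unfolding eventually_prodf by simp
  qed (simp add: eventually_prodf)
next
  fix k A assume A: "A \<in> S (k + (m + j))"
  have "dfb ((tup k \<times> tup m) \<times> tup j) (\<lambda>p. (fst (fst p) @ snd (fst p)) @ snd p)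
      (\<lambda>p. fst (fst p) @ (snd (fst p) @ snd p) \<in> A)"
    by (intro dfi dtm_mem[OF A])
  from dfb_ev[OF F dfb_ev[OF G this]]
  show "{t. length t = k \<and> (\<forall>\<^sub>F a in prodf F G. t @ a \<in> A)} \<in> S k"
    unfolding eventually_prodf dfb_tup_iff .
qed

text \<open>The inner limits form a definable family of relations, which satisfy \<open>pw\<close>
  for almost all \<open>a\<close> by \<open>PW\<close> of \<open>G\<close>; the limit of this family
  is handled by \<open>PW\<close> of \<open>F\<close>.\<close>

lemma PW_prodf:
  assumes F: "deftype m F" "PW m F" and G: "deftype j G" "PW j G"
  shows "PW (m + j) (prodf F G)"
  unfolding PW_def
proof (intro allI ballI impI)
  fix l I R assume I: "I \<in> S l" and R: "D3 (m + j) l l R" and pwR: "\<forall>\<^sub>F a in prodf F G. pw l I (R a)"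
  have "D3 m l l (\<lambda>a s t. \<forall>\<^sub>F b in G. R (a @ b) s t)"
    unfolding D3_def by (rule dfb_ev[OF G(1)]) (intro dfb_D3[OF R] dfi, auto)
  moreover have "\<forall>\<^sub>F a in F. pw l I (\<lambda>s t. \<forall>\<^sub>F b in G. R (a @ b) s t)"
    using pwR[unfolded eventually_prodf] deftype_length[OF F(1)]
  proof eventually_elim
    case (elim a)
    have "D3 j l l (\<lambda>b. R (a @ b))"
      unfolding D3_def by (intro dfb_D3[OF R] dfi) (use elim in auto)
    from PWD[OF G(2) I this elim(1)] show ?case .
  qed
  ultimately show "pw l I (\<lambda>s t. \<forall>\<^sub>F a in prodf F G. R a s t)"
    unfolding eventually_prodf by (rule PWD[OF F(2) I])
qed

lemma deftype_filtermap:
  assumes F: "deftype m F" and g: "dtm (tup m) (\<lambda>x. x) g" "\<And>a. length a = m \<Longrightarrow> length (g a) = j"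
  shows "deftype j (filtermap g F)"
  unfolding deftype_def eventually_filtermap
proof (intro conjI allI impI ballI)
  show "filtermap g F \<noteq> bot" using deftype_bot[OF F] by (simp add: filtermap_bot_iff)
  show "\<forall>\<^sub>F a in F. length (g a) = j" using deftype_length[OF F] by eventually_elim (rule g)
next
  fix P :: "'a list \<Rightarrow> bool" assume P: "dfb (tup j) (\<lambda>x. x) P"
  show "(\<forall>\<^sub>F a in F. P (g a)) \<or> (\<forall>\<^sub>F a in F. \<not> P (g a))"
    by (rule deftype_cases[OF F], rule dfb_pred[OF P g(1)]) (use g in auto)
next
  fix k A assume A: "A \<in> S (k + j)"
  have "dfb (tup k) (\<lambda>x. x) (\<lambda>t. \<forall>\<^sub>F a in F. t @ g a \<in> A)"
    by (rule dfb_ev[OF F]) (intro dfi dtm_mem[OF A] dtm_app[OF g(1)], auto)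
  then show "{t. length t = k \<and> (\<forall>\<^sub>F a in F. t @ g a \<in> A)} \<in> S k" unfolding dfb_tup_iff .
qed

lemma PW_filtermap:
  assumes F: "deftype m F" "PW m F" and g: "dtm (tup m) (\<lambda>x. x) g" "\<And>a. length a = m \<Longrightarrow> length (g a) = j"
  shows "PW j (filtermap g F)"
  unfolding PW_def eventually_filtermap
proof (intro allI ballI impI)
  fix l I R assume I: "I \<in> S l" and R: "D3 j l l R" and pwR: "\<forall>\<^sub>F a in F. pw l I (R (g a))"
  have "D3 m l l (\<lambda>a. R (g a))"
    unfolding D3_def by (intro dfb_D3[OF R] dfi dtm_app[OF g(1)]) (use g in auto)
  then show "pw l I (\<lambda>s t. \<forall>\<^sub>F a in F. R (g a) s t)" by (rule PWD[OF F(2) I _ pwR])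
qed

lemma deftype_nil: "deftype 0 (principal {[]})"
  unfolding deftype_def
proof (intro conjI allI impI ballI)
  fix k A assume "A \<in> S (k + 0)"
  moreover from this have "{t. length t = k \<and> (\<forall>\<^sub>F a in principal {[]}. t @ a \<in> A)} = A"
    using S_length[of A k] by (auto simp: eventually_principal)
  ultimately show "{t. length t = k \<and> (\<forall>\<^sub>F a in principal {[]}. t @ a \<in> A)} \<in> S k" by simp
qed (auto simp: eventually_principal principal_eq_bot_iff)

lemma PW_nil: "PW 0 (principal {[]})"
  unfolding PW_def eventually_principal by simp

end

section \<open>Definable topological spaces\<close>

context fo_structure
begin

lemma dts_pair:
  assumes "dts (tup k \<times> tup j) (\<lambda>p. fst p @ snd p) (\<lambda>p. f (fst p) (snd p))"
    "dtm U c \<sigma>" "dtm U c \<tau>" "\<And>e. e \<in> U \<Longrightarrow> length (\<sigma> e) = k" "\<And>e. e \<in> U \<Longrightarrow> length (\<tau> e) = j"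
  shows "dts U c (\<lambda>e. f (\<sigma> e) (\<tau> e))"
  using dts_lift[OF assms(1), of U c "\<lambda>e. (\<sigma> e, \<tau> e)"] assms(2-5) by (simp add: dtm_append)

end

locale def_space = fo_structure S
  for S :: "nat \<Rightarrow> 'a list set set" +
  fixes n :: nat and X :: "'a list set" and T :: "'a list topology"
  assumes top: "definable_top_space S n X T"
begin

lemma X_S: "X \<in> S n" and topspace_X: "topspace T = X"
  using top unfolding definable_top_space_def by simp_all

text \<open>A single definable set \<open>G\<close> has the basic open sets as fibres, so that
  statements about all basic neighbourhoods become bounded quantifiers over
  \<open>I\<close>.\<close>

lemma base_ex:
  obtains m I G where "I \<in> S m" "G \<in> S (m + n)" "\<forall>t\<in>I. openin T {x. t @ x \<in> G}"
    "\<forall>U x. openin T U \<longrightarrow> x \<in> U \<longrightarrow> (\<exists>t\<in>I. t @ x \<in> G \<and> {x. t @ x \<in> G} \<subseteq> U)"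
proof -
  obtain m I B where *: "definable_family S m n I B" "\<forall>t\<in>I. openin T (B t)"
    "\<forall>U. openin T U \<longrightarrow> (\<exists>J\<subseteq>I. U = \<Union>(B ` J))"
    using top unfolding definable_top_space_def by (elim conjE exE)
  define G where "G = {t @ x | t x. t \<in> I \<and> x \<in> B t}"
  have I: "I \<in> S m" and G: "G \<in> S (m + n)" and Bn: "\<And>t x. t \<in> I \<Longrightarrow> x \<in> B t \<Longrightarrow> length x = n"
    using *(1) unfolding definable_family_def G_def by auto
  have B: "{x. t @ x \<in> G} = B t" if t: "t \<in> I" for t
  proof (intro set_eqI iffI)
    fix x assume "x \<in> {x. t @ x \<in> G}"
    then obtain t' x' where "t @ x = t' @ x'" "t' \<in> I" "x' \<in> B t'" unfolding G_def by auto
    moreover have "length t = m" "length t' = m" using S_length[OF I] t calculation by auto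
    ultimately show "x \<in> B t" by auto
  qed (use t in \<open>auto simp: G_def\<close>)
  have "\<exists>t\<in>I. t @ x \<in> G \<and> {x. t @ x \<in> G} \<subseteq> U" if U: "openin T U" "x \<in> U" for U x
  proof -
    obtain J where J: "J \<subseteq> I" "U = \<Union>(B ` J)" using *(3) U(1) by auto
    then obtain t where "t \<in> J" "x \<in> B t" using U(2) by auto
    then show ?thesis using J B by (intro bexI[of _ t]) auto
  qed
  then show thesis using that[OF I G] *(2) B by simp
qed

definition nbhd :: "'a list set \<Rightarrow> 'a list \<Rightarrow> bool" where
  "nbhd A x \<longleftrightarrow> definable_nbhd S n T A x"

end

locale dclom_space = dclom S + def_space S n X T
  for S :: "nat \<Rightarrow> ('a::{group_add, dense_linorder, no_top, no_bot}) list set set" and n X T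
begin

lemma S_slice: "G \<in> S (m + k) \<Longrightarrow> length t = m \<Longrightarrow> {x. t @ x \<in> G} \<in> S k"
proof -
  assume G: "G \<in> S (m + k)" and t: "length t = m"
  have "dfb (tup k) (\<lambda>x. x) (\<lambda>x. t @ x \<in> G)" by (intro dfi dtm_mem[OF G])
  moreover have "{x. length x = k \<and> t @ x \<in> G} = {x. t @ x \<in> G}" using S_length[OF G] t by force
  ultimately show ?thesis unfolding dfb_tup_iff by simp
qed

lemma nbhd_base:
  assumes "I \<in> S m" "G \<in> S (m + n)" "\<forall>t\<in>I. openin T {x. t @ x \<in> G}" "t \<in> I" "t @ x \<in> G"
  shows "nbhd {x. t @ x \<in> G} x"
proof -
  have o: "openin T {x. t @ x \<in> G}" using assms by simp
  have "{x. t @ x \<in> G} \<in> S n" by (rule S_slice[OF assms(2) S_length[OF assms(1,4)]])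
  then show ?thesis unfolding nbhd_def definable_nbhd_def
    using o assms(5) openin_subset[OF o] by auto
qed

lemma nbhd_S: "nbhd A x \<Longrightarrow> A \<in> S n"
  unfolding nbhd_def definable_nbhd_def by simp

text \<open>The maps are total on tuples and take values in \<open>X\<close> only almost everywhere,
  because definable choice returns some tuple even where there is nothing to choose.\<close>

definition Good :: "nat \<Rightarrow> 'a list filter \<Rightarrow> bool" where
  "Good m F \<longleftrightarrow> (\<forall>\<gamma>. dtm (tup m) (\<lambda>x. x) \<gamma> \<longrightarrow> (\<forall>a. length a = m \<longrightarrow> length (\<gamma> a) = n) \<longrightarrow>
     (\<forall>\<^sub>F a in F. \<gamma> a \<in> X) \<longrightarrow> (\<exists>x\<in>X. \<forall>A. nbhd A x \<longrightarrow> (\<forall>\<^sub>F a in F. \<gamma> a \<in> A)))"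

lemma GoodD:
  "Good m F \<Longrightarrow> dtm (tup m) (\<lambda>x. x) \<gamma> \<Longrightarrow> (\<And>a. length a = m \<Longrightarrow> length (\<gamma> a) = n) \<Longrightarrow>
    \<forall>\<^sub>F a in F. \<gamma> a \<in> X \<Longrightarrow> \<exists>x\<in>X. \<forall>A. nbhd A x \<longrightarrow> (\<forall>\<^sub>F a in F. \<gamma> a \<in> A)"
  unfolding Good_def by simp

definition nice :: "nat \<Rightarrow> 'a list filter \<Rightarrow> bool" where
  "nice m F \<longleftrightarrow> deftype m F \<and> PW m F \<and> Good m F"

lemma nice_nil: "nice 0 (principal {[]})"
proof -
  have "Good 0 (principal {[]})"
    unfolding Good_def eventually_principal
  proof (intro allI impI)
    fix \<gamma> assume "\<forall>x\<in>{[]}. \<gamma> x \<in> X"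
    then show "\<exists>x\<in>X. \<forall>A. nbhd A x \<longrightarrow> (\<forall>a\<in>{[]}. \<gamma> a \<in> A)"
      by (intro bexI[of _ "\<gamma> []"]) (auto simp: nbhd_def definable_nbhd_def)
  qed
  then show ?thesis unfolding nice_def using deftype_nil PW_nil by simp
qed

lemma nice_filtermap:
  assumes F: "nice m F" and g: "dtm (tup m) (\<lambda>x. x) g" "\<And>a. length a = m \<Longrightarrow> length (g a) = j"
  shows "nice j (filtermap g F)"
proof -
  have "Good j (filtermap g F)"
    unfolding Good_def eventually_filtermap
  proof (intro allI impI)
    fix \<gamma> assume \<gamma>: "dtm (tup j) (\<lambda>x. x) \<gamma>" "\<forall>a. length a = j \<longrightarrow> length (\<gamma> a) = n"
      "\<forall>\<^sub>F a in F. \<gamma> (g a) \<in> X"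
    have "dtm (tup m) (\<lambda>x. x) (\<lambda>a. \<gamma> (g a))" by (rule dtm_app[OF \<gamma>(1) g(1)]) (use g in simp)
    then show "\<exists>x\<in>X. \<forall>A. nbhd A x \<longrightarrow> (\<forall>\<^sub>F a in F. \<gamma> (g a) \<in> A)"
      using F g(2) \<gamma>(2,3) unfolding nice_def by (intro GoodD[of m F "\<lambda>a. \<gamma> (g a)"]) simp_all
  qed
  then show ?thesis
    using F deftype_filtermap[OF _ g] PW_filtermap[OF _ _ g] unfolding nice_def by simp
qed

text \<open>Limits are taken one block at a time: the inner limit \<open>\<xi> a\<close> is chosen
  definably, and \<open>x\<close> is a limit of \<open>\<xi>\<close>. A basic open set around
  \<open>x\<close> is a neighbourhood of \<open>\<xi> a\<close> for almost all \<open>a\<close>, so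
  it contains \<open>\<gamma> (a @ b)\<close> for almost all \<open>b\<close>.\<close>

lemma nice_prodf:
  assumes F: "nice m F" and G: "nice j G"
  shows "nice (m + j) (prodf F G)"
proof -
  have dF: "deftype m F" and dG: "deftype j G" and gF: "Good m F" and gG: "Good j G"
    using F G unfolding nice_def by simp_all
  obtain k I B where base: "I \<in> S k" "B \<in> S (k + n)" "\<forall>t\<in>I. openin T {x. t @ x \<in> B}"
    "\<forall>U x. openin T U \<longrightarrow> x \<in> U \<longrightarrow> (\<exists>t\<in>I. t @ x \<in> B \<and> {x. t @ x \<in> B} \<subseteq> U)"
    by (rule base_ex)
  have "Good (m + j) (prodf F G)"
    unfolding Good_def eventually_prodf
  proof (intro allI impI)
    fix \<gamma> assume \<gamma>: "dtm (tup (m + j)) (\<lambda>x. x) \<gamma>" "\<forall>a. length a = m + j \<longrightarrow> length (\<gamma> a) = n"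
      and ev: "\<forall>\<^sub>F a in F. \<forall>\<^sub>F b in G. \<gamma> (a @ b) \<in> X"
    \<comment> \<open>Only basic neighbourhoods are mentioned, which keeps \<open>lim\<close>
      definable; one cannot quantify over all definable neighbourhoods within the structure.\<close>
    define lim where "lim a x \<longleftrightarrow> x \<in> X \<and> (\<forall>t\<in>I. t @ x \<in> B \<longrightarrow> (\<forall>\<^sub>F b in G. t @ \<gamma> (a @ b) \<in> B))" for a x
    have D: "dfb (tup m \<times> tup n) (\<lambda>p. fst p @ snd p) (\<lambda>p. lim (fst p) (snd p))"
      unfolding lim_def
      by (intro dfi dtm_mem[OF X_S] dfb_ball[OF base(1)] dtm_mem[OF base(2)] dfb_ev[OF dG] dtm_app[OF \<gamma>(1)])
        auto
    define \<xi> where "\<xi> a = choose_tup n (lim a)" for a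
    have \<xi>D: "dtm (tup m) (\<lambda>x. x) \<xi>" unfolding \<xi>_def by (rule dtm_choose_tup[OF D]) (intro dfi)
    have \<xi>: "lim a (\<xi> a)" if a: "length a = m" "\<forall>\<^sub>F b in G. \<gamma> (a @ b) \<in> X" for a
    proof -
      have "dtm (tup j) (\<lambda>x. x) (\<lambda>b. \<gamma> (a @ b))"
        by (intro dtm_app[OF \<gamma>(1)] dfi) (use a in auto)
      then obtain x where x: "x \<in> X" "\<forall>A. nbhd A x \<longrightarrow> (\<forall>\<^sub>F b in G. \<gamma> (a @ b) \<in> A)"
        using GoodD[OF gG, of "\<lambda>b. \<gamma> (a @ b)"] a \<gamma>(2) by auto
      have "lim a x" unfolding lim_def
      proof (intro conjI ballI impI)
        fix t assume "t \<in> I" "t @ x \<in> B"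
        from x(2)[rule_format, OF nbhd_base[OF base(1-3) this]]
        show "\<forall>\<^sub>F b in G. t @ \<gamma> (a @ b) \<in> B" by simp
      qed fact
      then show ?thesis unfolding \<xi>_def
        by (rule choose_tup[OF _ S_length[OF X_S x(1)], rotated])
          (intro dfb_pair[OF D] dfi, use a in auto)
    qed
    have ev\<xi>: "\<forall>\<^sub>F a in F. lim a (\<xi> a)" using ev deftype_length[OF dF] by eventually_elim (rule \<xi>)
    then have "\<forall>\<^sub>F a in F. \<xi> a \<in> X" by eventually_elim (simp add: lim_def)
    then obtain x where x: "x \<in> X" "\<forall>A. nbhd A x \<longrightarrow> (\<forall>\<^sub>F a in F. \<xi> a \<in> A)"
      using GoodD[OF gF \<xi>D] by (auto simp: \<xi>_def)
    show "\<exists>x\<in>X. \<forall>A. nbhd A x \<longrightarrow> (\<forall>\<^sub>F a in F. \<forall>\<^sub>F b in G. \<gamma> (a @ b) \<in> A)"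
    proof (intro bexI[OF _ x(1)] allI impI)
      fix A assume "nbhd A x"
      then obtain U where U: "openin T U" "x \<in> U" "U \<subseteq> A" unfolding nbhd_def definable_nbhd_def by auto
      obtain t where t: "t \<in> I" "t @ x \<in> B" "{x. t @ x \<in> B} \<subseteq> U" using base(4)[rule_format, OF U(1,2)] by auto
      have "\<forall>\<^sub>F a in F. \<xi> a \<in> {x. t @ x \<in> B}" using x(2)[rule_format, OF nbhd_base[OF base(1-3) t(1,2)]] .
      with ev\<xi> show "\<forall>\<^sub>F a in F. \<forall>\<^sub>F b in G. \<gamma> (a @ b) \<in> A"
      proof eventually_elim
        case (elim a)
        then have "\<forall>\<^sub>F b in G. t @ \<gamma> (a @ b) \<in> B" using t(1) unfolding lim_def by simp
        then show ?case by eventually_elim (use t(3) U(3) in auto)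
      qed
    qed
  qed
  then show ?thesis
    using F G deftype_prodf[OF dF dG] PW_prodf[OF dF _ dG] unfolding nice_def by simp
qed

definition curve_complete :: bool where
  "curve_complete \<longleftrightarrow> (\<forall>a b \<gamma>. definable_curve S n X a b \<gamma> \<longrightarrow>
     conv_right S n T a b \<gamma> \<noteq> {} \<and> conv_left S n T a b \<gamma> \<noteq> {})"

text \<open>The neighbourhoods of an end are open intervals, so the point comes from
  \<open>conv_left\<close> at 0 and from \<open>conv_right\<close> at infinity. It is a cluster
  point rather than a limit, and in this form the lemma also serves at infinity in the untame
  case.\<close>

lemma curve_endf:
  assumes cc: curve_complete and u: "wb b u" and \<gamma>: "dtm UNIV (\<lambda>x. [x]) \<gamma>" "\<And>t. length (\<gamma> t) = n"
    and \<gamma>X: "\<And>t. nb b u t \<Longrightarrow> \<gamma> t \<in> X"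
  shows "\<exists>x\<in>X. \<forall>A. nbhd A x \<longrightarrow> (\<forall>v. wb b v \<longrightarrow> (\<exists>t. nb b v t \<and> \<gamma> t \<in> A))"
proof -
  define p where "p = (if b then Some 0 else Some u)"
  define q where "q = (if b then Some u else None)"
  have oint: "oint p q = {t. nb b u t}" unfolding oint_def p_def q_def nb_def by (cases b) auto
  have "dfb (tup (1 + n)) (\<lambda>x. x) (\<lambda>z. \<exists>t. nb b u t \<and> z = [t] @ \<gamma> t)"
    by (intro dfi dtm_app1[OF \<gamma>(1)])
  then have "{z. length z = 1 + n \<and> (\<exists>t. nb b u t \<and> z = [t] @ \<gamma> t)} \<in> S (1 + n)"
    unfolding dfb_tup_iff .
  moreover have "{z. length z = 1 + n \<and> (\<exists>t. nb b u t \<and> z = [t] @ \<gamma> t)} = {[t] @ \<gamma> t | t. t \<in> oint p q}"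
    using \<gamma>(2) unfolding oint by auto
  ultimately have "definable_curve S n X p q \<gamma>"
    unfolding definable_curve_def using nb_ex[OF u] \<gamma>X oint by auto
  then have "conv_right S n T p q \<gamma> \<noteq> {}" "conv_left S n T p q \<gamma> \<noteq> {}"
    using cc unfolding curve_complete_def by auto
  then obtain x where x: "if b then x \<in> conv_left S n T p q \<gamma> else x \<in> conv_right S n T p q \<gamma>"
    by (cases b) auto
  have "\<exists>t. nb b v t \<and> \<gamma> t \<in> A" if A: "nbhd A x" and v: "wb b v" for A v
  proof -
    obtain w where w: "wb b w" "\<forall>t. nb b w t \<longrightarrow> nb b u t \<and> nb b v t" using nb_common[OF u v] by auto
    obtain t where t: "nb b w t" using nb_ex[OF w(1)] by auto
    then have "t \<in> oint p q" using w oint by simp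
    show ?thesis
    proof (cases b)
      case True
      then have "\<gamma> ` oint p (Some t) \<inter> A \<noteq> {}"
        using x A \<open>t \<in> oint p q\<close> unfolding conv_left_def nbhd_def by auto
      then obtain t' where "0 < t'" "t' < t" "\<gamma> t' \<in> A" using True unfolding oint_def p_def by auto
      moreover have "nb b w t'" using t True calculation unfolding nb_def by auto
      ultimately show ?thesis using w by auto
    next
      case False
      then have "\<gamma> ` oint (Some t) q \<inter> A \<noteq> {}"
        using x A \<open>t \<in> oint p q\<close> unfolding conv_right_def nbhd_def by auto
      then obtain t' where "t < t'" "\<gamma> t' \<in> A" using False unfolding oint_def q_def by auto
      moreover have "nb b w t'" using t False calculation unfolding nb_def by auto
      ultimately show ?thesis using w by auto
    qed
  qed
  moreover have "x \<in> X" using x topspace_X unfolding conv_left_def conv_right_def by (auto split: if_splits)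
  ultimately show ?thesis by auto
qed

text \<open>Tameness upgrades a cluster point to a limit: the curve is eventually inside or
  eventually outside a definable neighbourhood, and clustering excludes the latter.\<close>

lemma nice_endf:
  assumes cc: curve_complete and b: "b \<or> tame_inf"
  shows "nice 1 (endf b)"
proof -
  have "Good 1 (endf b)"
    unfolding Good_def eventually_endf
  proof (intro allI impI)
    fix \<gamma> assume \<gamma>: "dtm (tup 1) (\<lambda>x. x) \<gamma>" "\<forall>a. length a = 1 \<longrightarrow> length (\<gamma> a) = n"
      "\<exists>u. wb b u \<and> (\<forall>t. nb b u t \<longrightarrow> \<gamma> [t] \<in> X)"
    then obtain u where u: "wb b u" "\<forall>t. nb b u t \<longrightarrow> \<gamma> [t] \<in> X" by auto
    have D: "dtm UNIV (\<lambda>x. [x]) (\<lambda>t. \<gamma> [t])" by (rule dtm_app[OF \<gamma>(1)]) (intro dfi, auto)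
    obtain x where x: "x \<in> X" "\<forall>A. nbhd A x \<longrightarrow> (\<forall>v. wb b v \<longrightarrow> (\<exists>t. nb b v t \<and> \<gamma> [t] \<in> A))"
      using curve_endf[OF cc u(1) D] \<gamma>(2) u(2) by auto
    have "\<exists>u. wb b u \<and> (\<forall>t. nb b u t \<longrightarrow> \<gamma> [t] \<in> A)" if A: "nbhd A x" for A
    proof -
      have "D1 (\<lambda>t. \<gamma> [t] \<in> A)" by (rule dtm_mem[OF nbhd_S[OF A] D])
      from endf_cases[OF b this] show ?thesis using x(2) A by auto
    qed
    then show "\<exists>x\<in>X. \<forall>A. nbhd A x \<longrightarrow> (\<exists>u. wb b u \<and> (\<forall>t. nb b u t \<longrightarrow> \<gamma> [t] \<in> A))"
      using x(1) by auto
  qed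
  then show ?thesis unfolding nice_def using deftype_endf[OF b] PW_endf[OF b] by simp
qed

end

section \<open>Extending filtered families to types\<close>

context dclom
begin

text \<open>
  All coordinates are confined to \<open>[0, w]\<close> or, if definable sets are tame at infinity,
  to \<open>[0, \<infinity>)\<close>: there every definable set has an infimum and a tame upper end.
\<close>

definition inK :: "'a \<Rightarrow> 'a \<Rightarrow> bool" where
  "inK w x \<longleftrightarrow> 0 \<le> x \<and> (tame_inf \<or> x \<le> w)"

text \<open>The upper end of \<open>Y\<close> is approached by \<open>c + - t\<close> with
  \<open>t\<close> tending to 0 if \<open>Y\<close> has a supremum \<open>c\<close>, and by
  \<open>t\<close> tending to infinity otherwise, which forces \<open>tame_inf\<close>. A definable
  predicate with points between arbitrarily late elements of \<open>Y\<close> cannot be eventually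
  false along this curve, so it is eventually true.\<close>

lemma upper_end:
  assumes Y: "D1 Y" and K: "\<And>y. Y y \<Longrightarrow> inK w y" and y0: "Y y0"
    and nomax: "\<And>y. Y y \<Longrightarrow> \<exists>y'. Y y' \<and> y < y'"
  shows "\<exists>b g. (b \<or> tame_inf) \<and> dts UNIV (\<lambda>x. [x]) g \<and>
    (\<forall>P. D1 P \<longrightarrow> (\<forall>y. Y y \<longrightarrow> (\<exists>\<rho> y'. y \<le> \<rho> \<and> P \<rho> \<and> Y y' \<and> \<rho> < y')) \<longrightarrow>
      (\<forall>\<^sub>F a in endf b. P (g (hd a))))"
proof (cases "\<exists>c. \<forall>y. Y y \<longrightarrow> y \<le> c")
  case True
  then obtain c where c: "is_lub Y c" using lub_ex[OF Y y0] by auto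
  have less: "y < c" if "Y y" for y
  proof -
    obtain y' where "Y y'" "y < y'" using nomax \<open>Y y\<close> by auto
    then show ?thesis using c unfolding is_lub_def by (auto intro: less_le_trans)
  qed
  have "\<forall>\<^sub>F a in endf True. P (c + - hd a)"
    if P: "D1 P" and cof: "\<forall>y. Y y \<longrightarrow> (\<exists>\<rho> y'. y \<le> \<rho> \<and> P \<rho> \<and> Y y' \<and> \<rho> < y')" for P
  proof -
    have "\<not> evl c (\<lambda>z. \<not> P z)"
    proof
      assume "evl c (\<lambda>z. \<not> P z)"
      then obtain p where p: "p < c" "\<forall>z. p < z \<and> z < c \<longrightarrow> \<not> P z" unfolding evl_def by auto
      obtain y where y: "Y y" "p < y" using lub_less[OF c p(1)] by auto
      obtain \<rho> y' where r: "y \<le> \<rho>" "P \<rho>" "Y y'" "\<rho> < y'" using cof y(1) by auto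
      have "p < \<rho>" "\<rho> < c" using less_le_trans[OF y(2) r(1)] order.strict_trans[OF r(4) less[OF r(3)]] .
      then show False using p(2) r(2) by auto
    qed
    then have "evl c P" using evl_cases[OF P] by auto
    then obtain p where p: "p < c" "\<forall>z. p < z \<and> z < c \<longrightarrow> P z" unfolding evl_def by auto
    have "0 < - p + c" using add_less_l[OF p(1), of "- p"] by simp
    moreover have "P (c + - t)" if t: "0 < t" "t < - p + c" for t
    proof -
      have "p + t < c" using add_less_l[OF t(2), of p] by (simp add: add.assoc[symmetric])
      then have "p < c + - t" using add_less_r[of "p + t" c "- t"] by (simp add: add.assoc)
      moreover have "c + - t < c + 0" using t(1) by (intro add_less_l) (simp add: neg_less_iff)
      ultimately show ?thesis using p(2) by simp
    qed
    ultimately show ?thesis unfolding eventually_endf wb_def nb_def by (intro exI[of _ "- p + c"]) simp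
  qed
  moreover have "dts UNIV (\<lambda>x. [x]) (\<lambda>t. c + - t)" by (intro dfi)
  ultimately show ?thesis by (intro exI[of _ True] exI[of _ "\<lambda>t. c + - t"]) simp
next
  case False
  have tame: tame_inf
  proof (rule ccontr)
    assume "\<not> tame_inf"
    then have "\<forall>y. Y y \<longrightarrow> y \<le> w" using K unfolding inK_def by auto
    then show False using False by auto
  qed
  have "\<forall>\<^sub>F a in endf False. P (hd a)"
    if P: "D1 P" and cof: "\<forall>y. Y y \<longrightarrow> (\<exists>\<rho> y'. y \<le> \<rho> \<and> P \<rho> \<and> Y y' \<and> \<rho> < y')" for P
  proof -
    have "\<not> (\<forall>t>u. \<not> P t)" for u
    proof
      assume u: "\<forall>t>u. \<not> P t"
      obtain y where "Y y" "u < y" using False by (auto simp: not_le)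
      then obtain \<rho> where "u < \<rho>" "P \<rho>" using cof less_le_trans[of u y] by blast
      then show False using u by auto
    qed
    then show ?thesis
      using endf_cases[of False P] tame P unfolding eventually_endf nb_def wb_def by simp blast
  qed
  moreover have "dts UNIV (\<lambda>x. [x]) (\<lambda>t. t)" by (intro dfi)
  ultimately show ?thesis using tame by (intro exI[of _ False] exI[of _ "\<lambda>t. t"]) simp
qed

text \<open>\<open>E\<close> is decided just below the supremum of \<open>Y\<close>, or at infinity;
  unless \<open>Y\<close> has a maximum, \<open>y1\<close> is taken inside that region. This
  supplies a greatest class for \<open>cmp\<close>.\<close>

lemma upper_end_homogeneous:
  assumes Y: "D1 Y" and K: "\<And>y. Y y \<Longrightarrow> inK w y" and y0: "Y y0" and E: "D1 E"
  shows "\<exists>y1. Y y1 \<and> ((\<forall>y. Y y \<longrightarrow> y \<le> y1) \<or> (\<forall>x y. y1 \<le> x \<and> x \<le> y \<and> Y y \<longrightarrow> E x) \<or>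
    (\<forall>x y. y1 \<le> x \<and> x \<le> y \<and> Y y \<longrightarrow> \<not> E x))"
proof (cases "\<exists>y1. Y y1 \<and> (\<forall>y. Y y \<longrightarrow> y \<le> y1)")
  case nomax: False
  show ?thesis
  proof (cases "\<exists>c. \<forall>y. Y y \<longrightarrow> y \<le> c")
    case True
    then obtain c where c: "is_lub Y c" using lub_ex[OF Y y0] by auto
    have "\<not> Y c" using nomax c unfolding is_lub_def by auto
    then have less: "y < c" if "Y y" for y using that c unfolding is_lub_def by (metis le_less)
    have *: ?thesis if P: "evl c P" and "P = E \<or> P = (\<lambda>x. \<not> E x)" for P
    proof -
      obtain p where p: "p < c" "\<forall>z. p < z \<and> z < c \<longrightarrow> P z" using P unfolding evl_def by auto
      obtain y1 where y1: "Y y1" "p < y1" using lub_less[OF c p(1)] by auto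
      have "P x" if "y1 \<le> x" "x \<le> y" "Y y" for x y
        using p(2) less_le_trans[OF y1(2) that(1)] le_less_trans[OF that(2) less[OF that(3)]] by simp
      then show ?thesis using y1(1) that(2) by (intro exI[of _ y1]) auto
    qed
    show ?thesis using evl_cases[OF E, of c] *[of E] *[of "\<lambda>x. \<not> E x"] by auto
  next
    case False
    have tame_inf
    proof (rule ccontr)
      assume "\<not> tame_inf"
      then have "\<forall>y. Y y \<longrightarrow> y \<le> w" using K unfolding inK_def by auto
      then show False using False by auto
    qed
    then obtain u where u: "(\<forall>t>u. E t) \<or> (\<forall>t>u. \<not> E t)" using E unfolding tame_inf_def by auto
    obtain y1 where y1: "Y y1" "u < y1" using False by (auto simp: not_le)
    have "u < x" if "y1 \<le> x" for x using less_le_trans[OF y1(2) that] .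
    then show ?thesis using u y1(1) by (intro exI[of _ y1]) auto
  qed
qed auto

lemma lower_end_homogeneous:
  assumes Y: "D1 Y" and K: "\<And>y. Y y \<Longrightarrow> 0 \<le> y" and y0: "Y y0" and E: "D1 E"
  shows "\<exists>y1. Y y1 \<and> ((\<forall>y. Y y \<longrightarrow> y1 \<le> y) \<or> (\<forall>x y. x \<le> y1 \<and> y \<le> x \<and> Y y \<longrightarrow> E x) \<or>
    (\<forall>x y. x \<le> y1 \<and> y \<le> x \<and> Y y \<longrightarrow> \<not> E x))"
proof (cases "\<exists>y1. Y y1 \<and> (\<forall>y. Y y \<longrightarrow> y1 \<le> y)")
  case nomin: False
  obtain c where c: "is_glb Y c" using glb_ex[OF Y y0 K] by auto
  have "\<not> Y c" using nomin c unfolding is_glb_def by auto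
  then have less: "c < y" if "Y y" for y using that c unfolding is_glb_def by (metis le_less)
  have *: ?thesis if P: "evr c P" and "P = E \<or> P = (\<lambda>x. \<not> E x)" for P
  proof -
    obtain p where p: "c < p" "\<forall>z. c < z \<and> z < p \<longrightarrow> P z" using P unfolding evr_def by auto
    obtain y1 where y1: "Y y1" "y1 < p" using glb_less[OF c p(1)] by auto
    have "P x" if "x \<le> y1" "y \<le> x" "Y y" for x y
      using p(2) le_less_trans[OF that(1) y1(2)] less_le_trans[OF less[OF that(3)] that(2)] by simp
    then show ?thesis using y1(1) that(2) by (intro exI[of _ y1]) auto
  qed
  show ?thesis using evr_cases[OF E, of c] *[of E] *[of "\<lambda>x. \<not> E x"] by auto
qed auto

text \<open>The order of the line after collapsing every interval on which \<open>E\<close> does not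
  change: two points become equivalent exactly if \<open>E\<close> is constant between them.\<close>

definition cmp :: "('a \<Rightarrow> bool) \<Rightarrow> 'a \<Rightarrow> 'a \<Rightarrow> bool" where
  "cmp E y y' \<longleftrightarrow> y \<le> y' \<or> (\<forall>x. y' \<le> x \<and> x \<le> y \<longrightarrow> E x) \<or> (\<forall>x. y' \<le> x \<and> x \<le> y \<longrightarrow> \<not> E x)"

text \<open>The case with content is \<open>z < y < x\<close>: the two stretches on which
  \<open>E\<close> is constant share \<open>y\<close>, hence carry the same truth value.\<close>

lemma cmp_trans:
  assumes "cmp E x y" "cmp E y z"
  shows "cmp E x z"
proof -
  have sub: "cmp E a b" if "cmp E a' b'" "b' \<le> b" "a \<le> a'" for a b a' b'
  proof (cases "a \<le> b")
    case False
    then have "\<not> a' \<le> b'" using that by auto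
    moreover have "b' \<le> u" "u \<le> a'" if "b \<le> u" "u \<le> a" for u using that \<open>b' \<le> b\<close> \<open>a \<le> a'\<close> by auto
    ultimately show ?thesis using that(1) unfolding cmp_def by auto
  qed (simp add: cmp_def)
  show ?thesis
  proof (cases "x \<le> y \<or> y \<le> z")
    case True
    then show ?thesis using sub[of y z z x] sub[of x y z x] assms by auto
  next
    case False
    then have yx: "y \<le> x" and zy: "z \<le> y" and n: "\<not> x \<le> y" "\<not> y \<le> z" by auto
    have split: "(y \<le> u \<and> u \<le> x) \<or> (z \<le> u \<and> u \<le> y)" if "z \<le> u" "u \<le> x" for u using that by auto
    have "(\<forall>u. y \<le> u \<and> u \<le> x \<longrightarrow> E u) \<or> (\<forall>u. y \<le> u \<and> u \<le> x \<longrightarrow> \<not> E u)"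
      "(\<forall>u. z \<le> u \<and> u \<le> y \<longrightarrow> E u) \<or> (\<forall>u. z \<le> u \<and> u \<le> y \<longrightarrow> \<not> E u)"
      using assms n unfolding cmp_def by auto
    moreover have "y \<le> y \<and> y \<le> x" "z \<le> y \<and> y \<le> y" using yx zy by auto
    ultimately consider "\<forall>u. y \<le> u \<and> u \<le> x \<longrightarrow> E u" "\<forall>u. z \<le> u \<and> u \<le> y \<longrightarrow> E u" |
      "\<forall>u. y \<le> u \<and> u \<le> x \<longrightarrow> \<not> E u" "\<forall>u. z \<le> u \<and> u \<le> y \<longrightarrow> \<not> E u" by meson
    then show ?thesis using split unfolding cmp_def by cases meson+
  qed
qed

text \<open>A set of values without a maximum still has a greatest class, because \<open>E\<close>
  is constant along its final part; likewise at the lower end.\<close>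

lemma cmp_pw:
  assumes I: "I \<in> S l" and f: "dts (tup l) (\<lambda>x. x) f" and K: "\<And>s. s \<in> I \<Longrightarrow> inK w (f s)" and E: "D1 E"
  shows "pw l I (\<lambda>s t. cmp E (f s) (f t))"
proof (rule pwI)
  show "cmp E (f s) (f t) \<or> cmp E (f t) (f s)" for s t unfolding cmp_def by auto
  show "cmp E (f s) (f r)" if "cmp E (f s) (f t)" "cmp E (f t) (f r)" for s t r
    using cmp_trans that by blast
next
  fix J assume J: "J \<in> S l" "J \<subseteq> I" "J \<noteq> {}"
  define Y where "Y y \<longleftrightarrow> (\<exists>s\<in>J. f s = y)" for y
  have DY: "D1 Y" unfolding Y_def by (intro dfi dfb_bex[OF J(1)] dts_app[OF f]) auto
  have KY: "inK w y" if "Y y" for y using that K J(2) unfolding Y_def by auto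
  obtain s0 where "s0 \<in> J" using J(3) by auto
  then have Y0: "Y (f s0)" unfolding Y_def by auto
  have "\<exists>y1. Y y1 \<and> ((\<forall>y. Y y \<longrightarrow> y \<le> y1) \<or> (\<forall>x y. y1 \<le> x \<and> x \<le> y \<and> Y y \<longrightarrow> E x) \<or>
    (\<forall>x y. y1 \<le> x \<and> x \<le> y \<and> Y y \<longrightarrow> \<not> E x))"
    by (rule upper_end_homogeneous[OF DY KY Y0 E])
  then obtain y1 where y1: "Y y1" "(\<forall>y. Y y \<longrightarrow> y \<le> y1) \<or> (\<forall>x y. y1 \<le> x \<and> x \<le> y \<and> Y y \<longrightarrow> E x) \<or>
    (\<forall>x y. y1 \<le> x \<and> x \<le> y \<and> Y y \<longrightarrow> \<not> E x)"
    by (elim exE conjE)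
  have "cmp E y y1" if "Y y" for y using y1(2) that unfolding cmp_def by meson
  then show "\<exists>s\<in>J. \<forall>t\<in>J. cmp E (f t) (f s)" using y1(1) unfolding Y_def by auto
  have "\<exists>y2. Y y2 \<and> ((\<forall>y. Y y \<longrightarrow> y2 \<le> y) \<or> (\<forall>x y. x \<le> y2 \<and> y \<le> x \<and> Y y \<longrightarrow> E x) \<or>
    (\<forall>x y. x \<le> y2 \<and> y \<le> x \<and> Y y \<longrightarrow> \<not> E x))"
    by (rule lower_end_homogeneous[OF DY _ Y0 E]) (use KY in \<open>simp add: inK_def\<close>)
  then obtain y2 where y2: "Y y2" "(\<forall>y. Y y \<longrightarrow> y2 \<le> y) \<or> (\<forall>x y. x \<le> y2 \<and> y \<le> x \<and> Y y \<longrightarrow> E x) \<or>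
    (\<forall>x y. x \<le> y2 \<and> y \<le> x \<and> Y y \<longrightarrow> \<not> E x)"
    by (elim exE conjE)
  have "cmp E y2 y" if "Y y" for y using y2(2) that unfolding cmp_def by meson
  then show "\<exists>s\<in>J. \<forall>t\<in>J. cmp E (f s) (f t)" using y2(1) unfolding Y_def by auto
qed

text \<open>Induction on the number of coordinates. Either the elements with one fixed first
  coordinate are cofinal, and the curve moves in the remaining coordinates; or each such slice is
  bounded by an element \<open>h \<rho>\<close>, and it suffices to move \<open>\<rho>\<close> along
  a curve that eventually enters every set \<open>Y s\<close>.\<close>

lemma cofinal_curve:
  assumes "I \<in> S l" "I \<noteq> {}" "\<And>s x. s \<in> I \<Longrightarrow> x \<in> set s \<Longrightarrow> inK w x"
    and "dfb (tup l \<times> tup l) (\<lambda>p. fst p @ snd p) (\<lambda>p. le (fst p) (snd p))"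
    and "\<And>s t. s \<in> I \<Longrightarrow> t \<in> I \<Longrightarrow> le s t \<or> le t s"
    and "\<And>s t r. s \<in> I \<Longrightarrow> t \<in> I \<Longrightarrow> r \<in> I \<Longrightarrow> le s t \<Longrightarrow> le t r \<Longrightarrow> le s r"
    and "\<And>s. s \<in> I \<Longrightarrow> \<exists>t\<in>I. \<not> le t s"
  shows "\<exists>b h. (b \<or> tame_inf) \<and> dtm UNIV (\<lambda>x. [x]) h \<and> (\<forall>t. length (h t) = l) \<and>
    (\<forall>\<^sub>F a in endf b. h (hd a) \<in> I) \<and> (\<forall>s\<in>I. \<forall>\<^sub>F a in endf b. le s (h (hd a)))"
  using assms
proof (induction l arbitrary: I le)
  case 0
  obtain s where s: "s \<in> I" using "0.prems"(2) by auto
  obtain t where t: "t \<in> I" "\<not> le t s" using "0.prems"(7)[OF s] by auto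
  have "s = []" "t = []" using S_length[OF "0.prems"(1)] s t by auto
  then show ?case using "0.prems"(5)[OF s t(1)] t(2) by auto
next
  case (Suc l)
  note I = Suc.prems(1) and K = Suc.prems(3) and leD = Suc.prems(4) and tot = Suc.prems(5)
    and tr = Suc.prems(6) and nomax = Suc.prems(7)
  have len: "length s = Suc l" if "s \<in> I" for s using S_length[OF I that] .
  \<comment> \<open>The first coordinates of elements above \<open>s\<close>; these sets shrink as
    \<open>s\<close> grows.\<close>
  define Y where "Y s \<rho> \<longleftrightarrow> (\<exists>r\<in>tup l. \<rho> # r \<in> I \<and> le s (\<rho> # r))" for s \<rho>
  show ?case
  proof (cases "\<exists>\<rho>. \<forall>s\<in>I. Y s \<rho>")
    case True
    then obtain \<rho> where \<rho>: "\<forall>s\<in>I. Y s \<rho>" by auto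
    define I' where "I' = {r. length r = l \<and> \<rho> # r \<in> I}"
    have "dfb (tup l) (\<lambda>x. x) (\<lambda>r. \<rho> # r \<in> I)" by (intro dfi dtm_mem[OF I])
    then have I': "I' \<in> S l" unfolding I'_def dfb_tup_iff .
    have cof: "\<exists>r\<in>I'. le s (\<rho> # r)" if "s \<in> I" for s
      using \<rho> that unfolding Y_def I'_def by fastforce
    have "\<exists>b h. (b \<or> tame_inf) \<and> dtm UNIV (\<lambda>x. [x]) h \<and> (\<forall>t. length (h t) = l) \<and>
      (\<forall>\<^sub>F a in endf b. h (hd a) \<in> I') \<and> (\<forall>s\<in>I'. \<forall>\<^sub>F a in endf b. le (\<rho> # s) (\<rho> # h (hd a)))"
    proof (rule Suc.IH[OF I'])
      show "I' \<noteq> {}" using cof Suc.prems(2) by auto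
      show "inK w x" if "s \<in> I'" "x \<in> set s" for s x using K[of "\<rho> # s" x] that unfolding I'_def by auto
      show "dfb (tup l \<times> tup l) (\<lambda>p. fst p @ snd p) (\<lambda>p. le (\<rho> # fst p) (\<rho> # snd p))"
        by (intro dfb_pair[OF leD] dfi) auto
      show "le (\<rho> # s) (\<rho> # t) \<or> le (\<rho> # t) (\<rho> # s)" if "s \<in> I'" "t \<in> I'" for s t
        using tot that unfolding I'_def by simp
      show "le (\<rho> # s) (\<rho> # r)" if "s \<in> I'" "t \<in> I'" "r \<in> I'" "le (\<rho> # s) (\<rho> # t)" "le (\<rho> # t) (\<rho> # r)" for s t r
        using tr[of "\<rho> # s" "\<rho> # t" "\<rho> # r"] that unfolding I'_def by simp
      show "\<exists>t\<in>I'. \<not> le (\<rho> # t) (\<rho> # s)" if s: "s \<in> I'" for s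
      proof -
        have s': "\<rho> # s \<in> I" using s unfolding I'_def by simp
        obtain t where t: "t \<in> I" "\<not> le t (\<rho> # s)" using nomax[OF s'] by auto
        obtain r where r: "r \<in> I'" "le t (\<rho> # r)" using cof[OF t(1)] by auto
        then have "\<not> le (\<rho> # r) (\<rho> # s)" using tr[of t "\<rho> # r" "\<rho> # s"] t s' unfolding I'_def by auto
        then show ?thesis using r(1) by auto
      qed
    qed
    then obtain b h where h: "b \<or> tame_inf" "dtm UNIV (\<lambda>x. [x]) h" "\<forall>t. length (h t) = l"
      "\<forall>\<^sub>F a in endf b. h (hd a) \<in> I'" "\<forall>s\<in>I'. \<forall>\<^sub>F a in endf b. le (\<rho> # s) (\<rho> # h (hd a))"
      by (elim exE conjE)
    have "\<forall>\<^sub>F a in endf b. le s (\<rho> # h (hd a))" if s: "s \<in> I" for s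
    proof -
      obtain r where r: "r \<in> I'" "le s (\<rho> # r)" using cof[OF s] by auto
      have "\<forall>\<^sub>F a in endf b. le (\<rho> # r) (\<rho> # h (hd a))" using h(5) r(1) by auto
      then show ?thesis using h(4)
        by eventually_elim (rule tr[OF s _ _ r(2)], use r(1) in \<open>auto simp: I'_def\<close>)
    qed
    moreover have "\<forall>\<^sub>F a in endf b. \<rho> # h (hd a) \<in> I"
      using h(4) by eventually_elim (simp add: I'_def)
    moreover have "dtm UNIV (\<lambda>x. [x]) (\<lambda>t. \<rho> # h t)" by (intro dfi h(2))
    ultimately show ?thesis using h(1,3) by (intro exI[of _ b] exI[of _ "\<lambda>t. \<rho> # h t"]) simp
  next
    case False
    have YD: "dfb (tup (Suc l) \<times> UNIV) (\<lambda>p. fst p @ [snd p]) (\<lambda>p. Y (fst p) (snd p))"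
      unfolding Y_def by (intro dfi dfb_bex[OF S_tup] dtm_mem[OF I] dfb_pair[OF leD]) auto
    have Y1: "D1 (Y s)" if "s \<in> I" for s
      by (rule dfb_lift[OF YD, where g = "\<lambda>_. s"]) (auto intro!: dfi simp: len that)
    have Yhd: "Y s (hd t)" if "s \<in> I" "t \<in> I" "le s t" for s t
      using that len[OF that(2)] unfolding Y_def by (cases t) auto
    have Yne: "Y s (hd s)" if "s \<in> I" for s using Yhd[OF that that] tot[OF that that] by auto
    have YK: "inK w \<rho>" if "s \<in> I" "Y s \<rho>" for s \<rho> using that K unfolding Y_def by fastforce
    have Ymono: "Y s \<rho>" if "s \<in> I" "s' \<in> I" "le s s'" "Y s' \<rho>" for s s' \<rho>
      using that tr[OF that(1,2) _ that(3)] unfolding Y_def by blast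
    \<comment> \<open>The infima \<open>i s\<close> increase with \<open>s\<close>. If they have a
      greatest value, \<open>\<rho>\<close> tends to it from the right; otherwise
      \<open>\<rho>\<close> tends to the upper end of their range.\<close>
    define i where "i s = glbp (Y s)" for s
    have i: "is_glb (Y s) (i s)" if s: "s \<in> I" for s
    proof -
      obtain g where "is_glb (Y s) g"
        using glb_ex[OF Y1[OF s] Yne[OF s], of 0] YK[OF s] unfolding inK_def by auto
      then show ?thesis unfolding i_def using glbp_eq by simp
    qed
    have imono: "i s \<le> i s'" if "s \<in> I" "s' \<in> I" "le s s'" for s s'
      using i[OF that(1)] i[OF that(2)] Ymono[OF that] unfolding is_glb_def by auto
    have ub2: "\<exists>r\<in>I. le s r \<and> le t r" if "s \<in> I" "t \<in> I" for s t
      using tot[OF that] tot[OF that(1,1)] tot[OF that(2,2)] that by auto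
    have "\<exists>b g. (b \<or> tame_inf) \<and> dts UNIV (\<lambda>x. [x]) g \<and> (\<forall>s\<in>I. \<forall>\<^sub>F a in endf b. Y s (g (hd a)))"
    proof (cases "\<exists>s1\<in>I. \<forall>s\<in>I. i s \<le> i s1")
      case True
      then obtain s1 where s1: "s1 \<in> I" "\<forall>s\<in>I. i s \<le> i s1" by auto
      \<comment> \<open>No slice is cofinal, so some \<open>Y s2\<close> omits the greatest infimum.
        For \<open>r\<close> above \<open>s1\<close> and \<open>s2\<close> the infimum of
        \<open>Y r\<close> is then not attained, and \<open>Y r\<close> contains a right germ
        there.\<close>
      obtain s2 where s2: "s2 \<in> I" "\<not> Y s2 (i s1)" using False by auto
      have "\<forall>\<^sub>F a in endf True. Y s (i s1 + hd a)" if s: "s \<in> I" for s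
      proof -
        obtain r1 where r1: "r1 \<in> I" "le s r1" "le s1 r1" using ub2[OF s s1(1)] by auto
        obtain r where r: "r \<in> I" "le r1 r" "le s2 r" using ub2[OF r1(1) s2(1)] by auto
        have sr: "le s r" "le s1 r"
          using tr[OF s r1(1) r(1) r1(2) r(2)] tr[OF s1(1) r1(1) r(1) r1(3) r(2)] .
        have ir: "i r = i s1" using imono[OF s1(1) r(1) sr(2)] s1(2) r(1) by (auto intro: order_antisym)
        have "\<not> Y r (i r)" using Ymono[OF s2(1) r(1) r(3)] s2(2) ir by auto
        then have "evr (i r) (Y r)" by (rule glb_evr[OF Y1[OF r(1)] i[OF r(1)]])
        then obtain q where q: "i r < q" "\<forall>z. i r < z \<and> z < q \<longrightarrow> Y r z" unfolding evr_def by auto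
        have "0 < - i r + q" using add_less_l[OF q(1), of "- i r"] by simp
        moreover have "Y s (i s1 + t)" if t: "0 < t" "t < - i r + q" for t
        proof -
          have "i r + t < q" using add_less_l[OF t(2), of "i r"] by (simp add: add.assoc[symmetric])
          moreover have "i r + 0 < i r + t" using t(1) by (intro add_less_l)
          ultimately have "Y r (i r + t)" using q(2) by simp
          then show ?thesis using Ymono[OF s r(1) sr(1)] ir by simp
        qed
        ultimately show ?thesis unfolding eventually_endf wb_def nb_def
          by (intro exI[of _ "- i r + q"]) simp
      qed
      moreover have "dts UNIV (\<lambda>x. [x]) (\<lambda>t. i s1 + t)" by (intro dfi)
      ultimately show ?thesis by (intro exI[of _ True] exI[of _ "\<lambda>t. i s1 + t"]) simp
    next
      case no: False
      define C where "C y \<longleftrightarrow> (\<exists>s\<in>I. i s = y)" for y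
      have iD: "dts (tup (Suc l)) (\<lambda>x. x) i" unfolding i_def by (rule dts_glbp[OF YD]) (intro dfi)
      have CD: "D1 C" unfolding C_def by (intro dfi dfb_bex[OF I] dts_app[OF iD]) auto
      obtain s0 where s0: "s0 \<in> I" using Suc.prems(2) by auto
      have CK: "inK w y" if Cy: "C y" for y
      proof -
        obtain s where s: "s \<in> I" "y = i s" using Cy unfolding C_def by auto
        have "0 \<le> i s" "i s \<le> hd s"
          using i[OF s(1)] YK[OF s(1)] Yne[OF s(1)] unfolding is_glb_def inK_def by auto
        then show ?thesis using YK[OF s(1) Yne[OF s(1)]] s(2) unfolding inK_def by auto
      qed
      have C0: "C (i s0)" using s0 unfolding C_def by auto
      have Cno: "\<exists>y'. C y' \<and> y < y'" if "C y" for y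
        using that no unfolding C_def by (auto simp: not_le)
      have "\<exists>b g. (b \<or> tame_inf) \<and> dts UNIV (\<lambda>x. [x]) g \<and>
        (\<forall>P. D1 P \<longrightarrow> (\<forall>y. C y \<longrightarrow> (\<exists>\<rho> y'. y \<le> \<rho> \<and> P \<rho> \<and> C y' \<and> \<rho> < y')) \<longrightarrow>
          (\<forall>\<^sub>F a in endf b. P (g (hd a))))"
        by (rule upper_end[OF CD CK C0 Cno])
      then obtain b g where g: "b \<or> tame_inf" "dts UNIV (\<lambda>x. [x]) g"
        "\<forall>P. D1 P \<longrightarrow> (\<forall>y. C y \<longrightarrow> (\<exists>\<rho> y'. y \<le> \<rho> \<and> P \<rho> \<and> C y' \<and> \<rho> < y')) \<longrightarrow>
          (\<forall>\<^sub>F a in endf b. P (g (hd a)))"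
        by (elim exE conjE)
      have "\<forall>\<^sub>F a in endf b. Y s (g (hd a))" if s: "s \<in> I" for s
      proof (rule g(3)[rule_format, OF Y1[OF s]])
        fix y assume "C y"
        then obtain s' where s': "s' \<in> I" "y = i s'" unfolding C_def by auto
        obtain r where r: "r \<in> I" "le s r" "le s' r" using ub2[OF s s'(1)] by auto
        have "C (i r)" using r unfolding C_def by auto
        then obtain y' where y': "C y'" "i r < y'" using Cno by auto
        obtain \<rho> where \<rho>: "Y r \<rho>" "\<rho> < y'" "i r \<le> \<rho>" using glb_less[OF i[OF r(1)] y'(2)] by auto
        show "\<exists>\<rho> y'. y \<le> \<rho> \<and> Y s \<rho> \<and> C y' \<and> \<rho> < y'"
        proof (intro exI conjI)
          show "y \<le> \<rho>" using imono[OF s'(1) r(1,3)] s'(2) \<rho>(3) by auto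
          show "Y s \<rho>" by (rule Ymono[OF s r(1,2) \<rho>(1)])
        qed fact+
      qed
      then show ?thesis using g(1,2) by auto
    qed
    then obtain b g where g: "b \<or> tame_inf" "dts UNIV (\<lambda>x. [x]) g"
      "\<forall>s\<in>I. \<forall>\<^sub>F a in endf b. Y s (g (hd a))" by (elim exE conjE)
    define h where "h \<rho> = choose_tup (Suc l) (\<lambda>s. s \<in> I \<and> (\<forall>r\<in>tup l. \<rho> # r \<in> I \<longrightarrow> le (\<rho> # r) s))" for \<rho>
    have hD: "dtm UNIV (\<lambda>x. [x]) h"
      unfolding h_def
      by (rule dtm_choose_tup)
        (intro dfi dtm_mem[OF I] dfb_ball[OF S_tup] dfb_pair[OF leD], auto intro: dfi)
    have h: "h \<rho> \<in> I" "\<forall>r\<in>tup l. \<rho> # r \<in> I \<longrightarrow> le (\<rho> # r) (h \<rho>)" for \<rho>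
    proof -
      obtain s where s: "s \<in> I" "\<not> Y s \<rho>" using False by auto
      have "le (\<rho> # r) s" if "length r = l" "\<rho> # r \<in> I" for r
        using s tot[OF s(1) that(2)] that unfolding Y_def by auto
      then have P: "s \<in> I \<and> (\<forall>r\<in>tup l. \<rho> # r \<in> I \<longrightarrow> le (\<rho> # r) s)" using s by simp
      have D: "dfb (tup (Suc l)) (\<lambda>x. x) (\<lambda>s. s \<in> I \<and> (\<forall>r\<in>tup l. \<rho> # r \<in> I \<longrightarrow> le (\<rho> # r) s))"
        by (intro dfi dtm_mem[OF I] dfb_ball[OF S_tup] dfb_pair[OF leD]) auto
      from choose_tup[OF D len[OF s(1)] P]
      show "h \<rho> \<in> I" "\<forall>r\<in>tup l. \<rho> # r \<in> I \<longrightarrow> le (\<rho> # r) (h \<rho>)" unfolding h_def by simp_all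
    qed
    have "\<forall>\<^sub>F a in endf b. le s (h (g (hd a)))" if s: "s \<in> I" for s
      using g(3)[rule_format, OF s]
    proof eventually_elim
      case (elim a)
      then obtain r where r: "length r = l" "g (hd a) # r \<in> I" "le s (g (hd a) # r)" unfolding Y_def by auto
      show ?case by (rule tr[OF s r(2) h(1) r(3)]) (use h(2) r in simp)
    qed
    moreover have "dtm UNIV (\<lambda>x. [x]) (\<lambda>t. h (g t))" by (rule dtm_app1[OF hD g(2)])
    moreover have "length (h t) = Suc l" for t unfolding h_def by (rule length_choose_tup)
    ultimately show ?thesis using g(1) h(1)
      by (intro exI[of _ b] exI[of _ "\<lambda>t. h (g t)"]) simp
  qed
qed

end

context dclom_space
begin

text \<open>
  The type is built coordinate by coordinate.  Given a type \<open>F\<close> for the first coordinates, the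
  members are ordered by the lower ends of their fibres, compared along \<open>F\<close>.  If there is a
  greatest lower end, the last coordinate is this end or tends to it from the right; otherwise it
  runs along the lower ends of a definable cofinal curve of members.
\<close>

lemma filter_extends_to_type:
  assumes cc: curve_complete and w: "0 \<le> w" and I: "I \<in> S l" "I \<noteq> {}"
    and IK: "\<And>s x. s \<in> I \<Longrightarrow> x \<in> set s \<Longrightarrow> inK w x"
    and "dfb (tup l \<times> tup m) (\<lambda>p. fst p @ snd p) (\<lambda>p. D (fst p) (snd p))"
    and "\<And>s. s \<in> I \<Longrightarrow> \<exists>x. length x = m \<and> D s x"
    and "\<And>s x y. s \<in> I \<Longrightarrow> length x = m \<Longrightarrow> D s x \<Longrightarrow> y \<in> set x \<Longrightarrow> inK w y"
    and "\<And>s t. s \<in> I \<Longrightarrow> t \<in> I \<Longrightarrow> \<exists>r\<in>I. \<forall>x. length x = m \<longrightarrow> D r x \<longrightarrow> D s x \<and> D t x"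
  shows "\<exists>F. nice m F \<and> (\<forall>s\<in>I. \<forall>\<^sub>F x in F. D s x)"
  using assms(6-9)
proof (induction m arbitrary: D)
  case 0
  have "D s []" if "s \<in> I" for s using "0.prems"(2)[OF that] by auto
  then show ?case using nice_nil
    by (intro exI[of _ "principal {[]}"]) (simp add: eventually_principal)
next
  case (Suc m)
  note DD = Suc.prems(1) and ne = Suc.prems(2) and DK = Suc.prems(3) and filt = Suc.prems(4)
  have len: "length s = l" if "s \<in> I" for s using S_length[OF I(1) that] .
  define D' where "D' s a \<longleftrightarrow> (\<exists>y. D s (a @ [y]))" for s a
  have "\<exists>F. nice m F \<and> (\<forall>s\<in>I. \<forall>\<^sub>F a in F. D' s a)"
  proof (rule Suc.IH)
    show "dfb (tup l \<times> tup m) (\<lambda>p. fst p @ snd p) (\<lambda>p. D' (fst p) (snd p))"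
      unfolding D'_def by (intro dfi dfb_pair[OF DD]) auto
    show "\<exists>a. length a = m \<and> D' s a" if s: "s \<in> I" for s
    proof -
      obtain x where x: "length x = Suc m" "D s x" using ne[OF s] by auto
      then have "x = butlast x @ [last x]" by (cases x) auto
      then show ?thesis unfolding D'_def using x by (intro exI[of _ "butlast x"]) (metis length_butlast diff_Suc_1)
    qed
    show "inK w y" if a: "s \<in> I" "length a = m" "D' s a" "y \<in> set a" for s a y
    proof -
      obtain z where "D s (a @ [z])" using a(3) unfolding D'_def by auto
      then show ?thesis using DK[OF a(1), of "a @ [z]" y] a by simp
    qed
    show "\<exists>r\<in>I. \<forall>a. length a = m \<longrightarrow> D' r a \<longrightarrow> D' s a \<and> D' t a" if st: "s \<in> I" "t \<in> I" for s t
    proof -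
      obtain r where r: "r \<in> I" "\<forall>x. length x = Suc m \<longrightarrow> D r x \<longrightarrow> D s x \<and> D t x" using filt[OF st] by auto
      have "D' s a \<and> D' t a" if a: "length a = m" "D' r a" for a
      proof -
        obtain y where "D r (a @ [y])" using a(2) unfolding D'_def by auto
        then have "D s (a @ [y]) \<and> D t (a @ [y])" using r(2) a(1) by simp
        then show ?thesis unfolding D'_def by auto
      qed
      then show ?thesis using r(1) by auto
    qed
  qed
  then obtain F where F: "nice m F" and evD': "\<And>s. s \<in> I \<Longrightarrow> \<forall>\<^sub>F a in F. D' s a" by auto
  have dF: "deftype m F" and PWF: "PW m F" using F unfolding nice_def by simp_all
  note evlen = deftype_length[OF dF]
  define f where "f s a = glbp (\<lambda>y. D s (a @ [y]))" for s a
  have fD: "dts (tup l \<times> tup m) (\<lambda>p. fst p @ snd p) (\<lambda>p. f (fst p) (snd p))"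
    unfolding f_def by (rule dts_glbp) (intro dfi dfb_pair[OF DD], auto intro: dfi)
  have D1s: "D1 (\<lambda>y. D s (a @ [y]))" if "s \<in> I" "length a = m" for s a
    by (intro dfb_pair[OF DD] dfi) (use that len in auto)
  have Dpos: "inK w y" if "s \<in> I" "length a = m" "D s (a @ [y])" for s a y
    using DK[OF that(1), of "a @ [y]" y] that by simp
  have glb: "is_glb (\<lambda>y. D s (a @ [y])) (f s a)" if s: "s \<in> I" "length a = m" "D' s a" for s a
  proof -
    obtain y where y: "D s (a @ [y])" using s(3) unfolding D'_def by auto
    obtain g where "is_glb (\<lambda>y. D s (a @ [y])) g"
      using glb_ex[OF D1s[OF s(1,2)], of y 0] y Dpos[OF s(1,2)] unfolding inK_def by auto
    then show ?thesis unfolding f_def using glbp_eq by simp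
  qed
  have fK: "inK w (f s a)" if s: "s \<in> I" "length a = m" for s a
  proof (cases "D' s a")
    case True
    then obtain y where y: "D s (a @ [y])" unfolding D'_def by auto
    have "0 \<le> f s a" "f s a \<le> y"
      using glb[OF s True] Dpos[OF s] y unfolding is_glb_def inK_def by auto
    then show ?thesis using Dpos[OF s y] unfolding inK_def by auto
  next
    case False
    have "\<not> is_glb (\<lambda>y. D s (a @ [y])) g" for g
      using False gt_ex[of g] unfolding is_glb_def D'_def by (auto simp: not_le)
    then have "\<not> (\<exists>g. is_glb (\<lambda>y. D s (a @ [y])) g)" by blast
    then have "f s a = 0" unfolding f_def glbp_def by (rule if_not_P)
    then show ?thesis using w unfolding inK_def by simp
  qed
  define L where "L s t \<longleftrightarrow> (\<forall>\<^sub>F a in F. f s a \<le> f t a)" for s t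
  have LD: "dfb (tup l \<times> tup l) (\<lambda>p. fst p @ snd p) (\<lambda>p. L (fst p) (snd p))"
    unfolding L_def by (rule dfb_ev[OF dF]) (intro dfi dts_pair[OF fD], auto)
  have notL: "\<forall>\<^sub>F a in F. f t a < f s a" if "s \<in> I" "t \<in> I" "\<not> L s t" for s t
  proof -
    have "dfb (tup m) (\<lambda>x. x) (\<lambda>a. f s a \<le> f t a)"
      by (intro dfi dts_pair[OF fD]) (use that len in auto)
    from deftype_cases[OF dF this] that(3) have "\<forall>\<^sub>F a in F. \<not> f s a \<le> f t a" unfolding L_def by auto
    then show ?thesis by (simp add: not_le)
  qed
  have tot: "L s t \<or> L t s" if "s \<in> I" "t \<in> I" for s t
  proof (rule disjCI)
    assume "\<not> L t s"
    from notL[OF that(2,1) this] show "L s t" unfolding L_def by eventually_elim simp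
  qed
  have tr: "L s r" if "L s t" "L t r" for s t r
    using that unfolding L_def by eventually_elim simp
  have Lsub: "L s r" if s: "s \<in> I" "r \<in> I" and sub: "\<forall>x. length x = Suc m \<longrightarrow> D r x \<longrightarrow> D s x" for s r
    unfolding L_def using evD'[OF s(2)] evlen
  proof eventually_elim
    case (elim a)
    have DD': "D s (a @ [y])" if "D r (a @ [y])" for y using sub elim(2) that by simp
    then have "D' s a" using elim(1) unfolding D'_def by auto
    then show ?case using glb[OF s(1) elim(2)] glb[OF s(2) elim(2,1)] DD' unfolding is_glb_def by auto
  qed
  have lower: "\<exists>r\<in>I. (\<forall>x. length x = Suc m \<longrightarrow> D r x \<longrightarrow> D s x \<and> D t x) \<and> L s r \<and> L t r" if st: "s \<in> I" "t \<in> I" for s t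
  proof -
    obtain r where r: "r \<in> I" "\<forall>x. length x = Suc m \<longrightarrow> D r x \<longrightarrow> D s x \<and> D t x" using filt[OF st] by auto
    then show ?thesis using Lsub[OF st(1) r(1)] Lsub[OF st(2) r(1)] by auto
  qed
  show ?case
  proof (cases "\<exists>s1\<in>I. \<forall>s\<in>I. L s s1")
    case True
    then obtain s1 where s1: "s1 \<in> I" "\<forall>s\<in>I. L s s1" by auto
    show ?thesis
    proof (cases "\<forall>s\<in>I. \<forall>\<^sub>F a in F. D s (a @ [f s1 a])")
      case True
      have "nice (Suc m) (filtermap (\<lambda>a. a @ [f s1 a]) F)"
        by (rule nice_filtermap[OF F]) (intro dfi dts_pair[OF fD], use len s1 in \<open>auto intro: dfi\<close>)
      then show ?thesis using True
        by (intro exI[of _ "filtermap (\<lambda>a. a @ [f s1 a]) F"]) (simp add: eventually_filtermap)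
    next
      case False
      \<comment> \<open>The fibre of \<open>s2\<close> almost always misses the common lower end,
        and so do the fibres of smaller members; these therefore contain a right germ at that
        end.\<close>
      then obtain s2 where s2: "s2 \<in> I" "\<not> (\<forall>\<^sub>F a in F. D s2 (a @ [f s1 a]))" by auto
      have "dfb (tup m) (\<lambda>x. x) (\<lambda>a. D s2 (a @ [f s1 a]))"
        by (intro dfb_pair[OF DD] dfi dts_pair[OF fD]) (use len s1 s2 in auto)
      from deftype_cases[OF dF this] s2(2) have ev2: "\<forall>\<^sub>F a in F. \<not> D s2 (a @ [f s1 a])" by auto
      \<comment> \<open>The new coordinate exceeds the lower end by \<open>t\<close>. The room above
        the lower end depends on \<open>a\<close>, so \<open>t\<close> must be generic over
        \<open>a\<close>: it is the inner variable of the product.\<close>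
      define g where "g z = take m (drop 0 z) @ [f s1 (take m (drop 0 z)) + z ! m]" for z :: "'a list"
      have gD: "dtm (tup (m + 1)) (\<lambda>x. x) g"
        unfolding g_def
        by (intro dtm_append dtm_single dts_plus dts_pair[OF fD] dtm_slice[where j = "m + 1"]
            dts_nth[where j = "m + 1"] dfi) (use len s1 in auto)
      have nice: "nice (Suc m) (filtermap g (prodf F (endf True)))"
        by (rule nice_filtermap[OF nice_prodf[OF F nice_endf[OF cc]] gD]) (auto simp: g_def)
      have "\<forall>\<^sub>F x in filtermap g (prodf F (endf True)). D s x" if s: "s \<in> I" for s
      proof -
        obtain r1 where r1: "r1 \<in> I" "\<forall>x. length x = Suc m \<longrightarrow> D r1 x \<longrightarrow> D s x \<and> D s1 x" "L s1 r1"
          using lower[OF s s1(1)] by auto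
        obtain r where r: "r \<in> I" "\<forall>x. length x = Suc m \<longrightarrow> D r x \<longrightarrow> D r1 x \<and> D s2 x" "L r1 r"
          using lower[OF r1(1) s2(1)] by auto
        have L1: "\<forall>\<^sub>F a in F. f s1 a \<le> f r a" using tr[OF r1(3) r(3)] unfolding L_def .
        have L2: "\<forall>\<^sub>F a in F. f r a \<le> f s1 a" using s1(2) r(1) unfolding L_def by auto
        show ?thesis unfolding eventually_filtermap eventually_prodf
          using L1 L2 ev2 evD'[OF r(1)] evlen
        proof eventually_elim
          case (elim a)
          have fr: "f s1 a = f r a" using elim(1,2) by simp
          then have "\<not> D r (a @ [f r a])" using elim(3,5) r(2) by auto
          then have "evr (f r a) (\<lambda>y. D r (a @ [y]))"
            by (rule glb_evr[OF D1s[OF r(1) elim(5)] glb[OF r(1) elim(5,4)]])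
          then obtain q where q: "f r a < q" "\<forall>z. f r a < z \<and> z < q \<longrightarrow> D r (a @ [z])" unfolding evr_def by auto
          have "0 < - f r a + q" using add_less_l[OF q(1), of "- f r a"] by simp
          moreover have "D s (g (a @ [t]))" if t: "0 < t" "t < - f r a + q" for t
          proof -
            have "f r a + t < q" using add_less_l[OF t(2), of "f r a"] by (simp add: add.assoc[symmetric])
            moreover have "f r a + 0 < f r a + t" using t(1) by (intro add_less_l)
            ultimately have "D r (a @ [f r a + t])" using q(2) by simp
            then have "D s (a @ [f r a + t])" using r(2) r1(2) elim(5) by simp
            moreover have "g (a @ [t]) = a @ [f r a + t]" unfolding g_def using elim(5) fr by (simp add: nth_append)
            ultimately show ?thesis by simp
          qed
          ultimately show ?case unfolding eventually_endf wb_def nb_def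
            by (intro exI[of _ "- f r a + q"]) simp
        qed
      qed
      then show ?thesis using nice by auto
    qed
  next
    case False
    have "\<exists>b h. (b \<or> tame_inf) \<and> dtm UNIV (\<lambda>x. [x]) h \<and> (\<forall>t. length (h t) = l) \<and>
      (\<forall>\<^sub>F a in endf b. h (hd a) \<in> I) \<and> (\<forall>s\<in>I. \<forall>\<^sub>F a in endf b. L s (h (hd a)))"
      by (rule cofinal_curve[OF I IK LD tot tr]) (use False in auto)
    then obtain b h where h: "b \<or> tame_inf" "dtm UNIV (\<lambda>x. [x]) h" "\<forall>t. length (h t) = l"
      "\<forall>\<^sub>F a in endf b. h (hd a) \<in> I" "\<forall>s\<in>I. \<forall>\<^sub>F a in endf b. L s (h (hd a))"
      by (elim exE conjE)
    \<comment> \<open>Here \<open>t\<close> is the outer variable: it selects the member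
      \<open>h t\<close>, and a comparison of lower ends by \<open>L\<close> concerns members that
      are fixed before \<open>a\<close> is taken generic.\<close>
    define g where "g z = take m (drop 1 z) @ [f (h (z ! 0)) (take m (drop 1 z))]" for z :: "'a list"
    have gD: "dtm (tup (1 + m)) (\<lambda>x. x) g"
      unfolding g_def
      by (intro dtm_append dtm_single dts_pair[OF fD] dtm_slice[where j = "1 + m"] dtm_app1[OF h(2)]
          dts_nth[where j = "1 + m"] dfi) (use h(3) in auto)
    have nice: "nice (Suc m) (filtermap g (prodf (endf b) F))"
      by (rule nice_filtermap[OF nice_prodf[OF nice_endf[OF cc h(1)] F] gD]) (auto simp: g_def)
    have "\<forall>\<^sub>F x in filtermap g (prodf (endf b) F). D s0 x" if s0: "s0 \<in> I" for s0
    proof -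
      \<comment> \<open>Along the moving lower ends the fibre of \<open>s0\<close> could alternate.
        In the limit of \<open>cmp\<close> with respect to this fibre, \<open>PW\<close> provides a
        greatest class; beyond a member \<open>s1\<close> of that class no alternation is
        left.\<close>
      define R where "R a s t \<longleftrightarrow> cmp (\<lambda>y. D s0 (a @ [y])) (f s a) (f t a)" for a s t
      have RD: "D3 m l l R"
        unfolding D3_def R_def cmp_def
        by (intro dfi dfb_pair[OF DD] dts_pair[OF fD]) (use len s0 in auto)
      have "\<forall>\<^sub>F a in F. pw l I (R a)" using evlen
      proof eventually_elim
        case (elim a)
        have "dts (tup l) (\<lambda>x. x) (\<lambda>s. f s a)" by (intro dts_pair[OF fD] dfi) (use elim in auto)
        from cmp_pw[OF I(1) this fK[OF _ elim] D1s[OF s0 elim]] show ?case unfolding R_def by simp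
      qed
      from pw_max[OF PWD[OF PWF I(1) RD this] I(1) order_refl I(2)]
      obtain s1 where s1: "s1 \<in> I" "\<forall>s\<in>I. \<forall>\<^sub>F a in F. R a s s1" by auto
      obtain r where r: "r \<in> I" "\<forall>x. length x = Suc m \<longrightarrow> D r x \<longrightarrow> D s0 x \<and> D s1 x" "L s1 r"
        using lower[OF s0 s1(1)] by auto
      \<comment> \<open>For \<open>q\<close> above \<open>r'\<close>, some point \<open>y\<close> of
        the fibre of \<open>r\<close> lies between the lower ends of \<open>s1\<close> and
        \<open>q\<close>. As \<open>y\<close> is in the fibre of \<open>s0\<close>, so is the whole
        constant stretch through it, up to the lower end of \<open>q\<close>.\<close>
      obtain r' where r': "r' \<in> I" "\<not> L r' r" using False r(1) by auto
      have rr': "\<forall>\<^sub>F a in F. f r a < f r' a" by (rule notL[OF r'(1) r(1) r'(2)])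
      have "\<forall>\<^sub>F a in F. D s0 (a @ [f q a])" if q: "q \<in> I" "L r' q" for q
        using s1(2)[rule_format, OF q(1)] q(2)[unfolded L_def] rr' r(3)[unfolded L_def] evD'[OF r(1)] evlen
      proof eventually_elim
        case (elim a)
        have lt: "f s1 a < f q a" using elim(2,3,4) by auto
        obtain y where y: "D r (a @ [y])" "y < f r' a" "f r a \<le> y"
          using glb_less[OF glb[OF r(1) elim(6,5)] elim(3)] by auto
        have Dy: "D s0 (a @ [y])" using y(1) r(2) elim(6) by simp
        have yin: "f s1 a \<le> y \<and> y \<le> f q a" using y elim(2,4) by auto
        have qin: "f s1 a \<le> f q a \<and> f q a \<le> f q a" using lt by simp
        have "(\<forall>x. f s1 a \<le> x \<and> x \<le> f q a \<longrightarrow> D s0 (a @ [x])) \<or>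
            (\<forall>x. f s1 a \<le> x \<and> x \<le> f q a \<longrightarrow> \<not> D s0 (a @ [x]))"
          using elim(1) lt unfolding R_def cmp_def by auto
        then show ?case
        proof
          assume "\<forall>x. f s1 a \<le> x \<and> x \<le> f q a \<longrightarrow> D s0 (a @ [x])"
          then show ?thesis using qin by blast
        next
          assume "\<forall>x. f s1 a \<le> x \<and> x \<le> f q a \<longrightarrow> \<not> D s0 (a @ [x])"
          then show ?thesis using yin Dy by blast
        qed
      qed
      then have "\<forall>\<^sub>F c in endf b. \<forall>\<^sub>F a in F. D s0 (a @ [f (h (hd c)) a])"
        using h(4) h(5)[rule_format, OF r'(1)] by (auto elim: eventually_elim2)
      with deftype_length[OF deftype_endf[OF h(1)]]
      show ?thesis unfolding eventually_filtermap eventually_prodf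
      proof eventually_elim
        case (elim c)
        then obtain t where t: "c = [t]" by (cases c) auto
        show ?case using elim(2) evlen
          by eventually_elim (simp add: g_def t)
      qed
    qed
    then show ?thesis using nice by auto
  qed
qed

end

section \<open>Patterns along closed discrete sets\<close>

context dclom
begin

text \<open>The germ condition is imposed at every point of the line and not just at points of
  \<open>Z\<close>, so \<open>Z\<close> is closed as well as discrete. Nonnegativity provides
  minima.\<close>

definition disc :: "('a \<Rightarrow> bool) \<Rightarrow> bool" where
  "disc Z \<longleftrightarrow> D1 Z \<and> (\<forall>z. Z z \<longrightarrow> 0 \<le> z) \<and> (\<forall>x. evr x (\<lambda>z. \<not> Z z) \<and> evl x (\<lambda>z. \<not> Z z))"

definition locconst :: "('a \<Rightarrow> bool) \<Rightarrow> 'a \<Rightarrow> bool" where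
  "locconst P x \<longleftrightarrow> (\<exists>p q. p < x \<and> x < q \<and> ((\<forall>z. p < z \<and> z < q \<longrightarrow> P z) \<or> (\<forall>z. p < z \<and> z < q \<longrightarrow> \<not> P z)))"

lemma evr_locconst: "D1 P \<Longrightarrow> evr x (locconst P)"
proof -
  assume "D1 P"
  from evr_cases[OF this, of x] obtain y where y: "x < y"
    "(\<forall>z. x < z \<and> z < y \<longrightarrow> P z) \<or> (\<forall>z. x < z \<and> z < y \<longrightarrow> \<not> P z)" unfolding evr_def by auto
  have "locconst P z" if "x < z" "z < y" for z
    unfolding locconst_def using y(2) that by (intro exI[of _ x] exI[of _ y]) simp
  then show ?thesis unfolding evr_def using y(1) by auto
qed

lemma evl_locconst: "D1 P \<Longrightarrow> evl x (locconst P)"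
proof -
  assume "D1 P"
  from evl_cases[OF this, of x] obtain y where y: "y < x"
    "(\<forall>z. y < z \<and> z < x \<longrightarrow> P z) \<or> (\<forall>z. y < z \<and> z < x \<longrightarrow> \<not> P z)" unfolding evl_def by auto
  have "locconst P z" if "y < z" "z < x" for z
    unfolding locconst_def using y(2) that by (intro exI[of _ y] exI[of _ x]) simp
  then show ?thesis unfolding evl_def using y(1) by auto
qed

lemma locconst_imp_const_less:
  assumes P: "D1 P" and loc: "\<And>x. c < x \<Longrightarrow> x < d \<Longrightarrow> locconst P x" and y: "c < y1" "y1 < y2" "y2 < d"
  shows "P y2 \<longleftrightarrow> P y1"
proof (rule locally_constant_imp_constant[of "\<lambda>x y. P x \<longleftrightarrow> P y", OF _ _ _ _ y])
  show "D2 (\<lambda>x y. P x \<longleftrightarrow> P y)" by (intro dfi dfb_D1[OF P])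
  show "\<exists>p q. p < y \<and> y < q \<and> (\<forall>z. p < z \<and> z < q \<longrightarrow> P z \<longleftrightarrow> P y)" if yy: "c < y" "y < d" for y
  proof -
    obtain p q where pq: "p < y" "y < q" "(\<forall>z. p < z \<and> z < q \<longrightarrow> P z) \<or> (\<forall>z. p < z \<and> z < q \<longrightarrow> \<not> P z)"
      using loc[OF yy] unfolding locconst_def by (elim exE conjE)
    have "P z \<longleftrightarrow> P y" if "p < z" "z < q" for z
      by (rule disjE[OF pq(3)]) (use pq(1,2) that in simp_all)
    then show ?thesis using pq(1,2) by blast
  qed
qed auto

lemma locconst_imp_const:
  assumes P: "D1 P" and loc: "\<And>x. c < x \<Longrightarrow> x < d \<Longrightarrow> locconst P x" and y: "c < y1" "y1 < d" "c < y2" "y2 < d"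
  shows "P y1 \<longleftrightarrow> P y2"
  using locconst_imp_const_less[OF P loc y(1) _ y(4)] locconst_imp_const_less[OF P loc y(3) _ y(2)]
  by (cases y1 y2 rule: linorder_cases) auto

text \<open>\<open>Z\<close> collects the nonnegative boundary points of a definable set that keeps
  changing towards infinity. Beyond a bound for \<open>Z\<close> that set would be locally constant,
  hence constant by connectedness.\<close>

lemma disc_ex:
  assumes "\<not> tame_inf"
  shows "\<exists>Z. disc Z \<and> (\<forall>u. \<exists>z. Z z \<and> u < z)"
proof -
  obtain P where P: "D1 P" "\<forall>u. (\<exists>t>u. \<not> P t) \<and> (\<exists>t>u. P t)" using assms unfolding tame_inf_def by auto
  define Z where "Z x \<longleftrightarrow> 0 \<le> x \<and> \<not> locconst P x" for x
  have "D1 Z" unfolding Z_def locconst_def by (intro dfi dfb_D1[OF P(1)])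
  moreover have "evr x (\<lambda>z. \<not> Z z)" for x by (rule evr_mono[OF evr_locconst[OF P(1)]]) (simp add: Z_def)
  moreover have "evl x (\<lambda>z. \<not> Z z)" for x by (rule evl_mono[OF evl_locconst[OF P(1)]]) (simp add: Z_def)
  ultimately have "disc Z" unfolding disc_def Z_def by simp
  moreover have "\<exists>z. Z z \<and> u < z" for u
  proof (rule ccontr)
    assume no: "\<not> (\<exists>z. Z z \<and> u < z)"
    define c where "c = max u 0"
    have loc: "locconst P x" if "c < x" for x
    proof -
      have "u < x" "0 \<le> x" using that unfolding c_def by auto
      then show ?thesis using no unfolding Z_def by auto
    qed
    obtain t1 where t1: "t1 > c" "P t1" using P(2) by blast
    obtain t2 where t2: "t2 > t1" "\<not> P t2" using P(2) by blast
    obtain d where "d > t2" using gt_ex by blast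
    from locconst_imp_const_less[OF P(1) loc t1(1) t2(1) this] t1 t2 show False by simp
  qed
  ultimately show ?thesis by auto
qed

lemma disc_D1: "disc Z \<Longrightarrow> D1 Z"
  unfolding disc_def by simp

lemma disc_min:
  assumes Z: "disc Z" and P: "D1 P" and z: "Z z0" "P z0"
  shows "\<exists>z. Z z \<and> P z \<and> (\<forall>z'. Z z' \<and> P z' \<longrightarrow> z \<le> z')"
proof -
  have D: "D1 (\<lambda>z. Z z \<and> P z)" by (intro dfi dfb_D1[OF P] disc_D1[OF Z])
  obtain g where g: "is_glb (\<lambda>z. Z z \<and> P z) g"
    using glb_ex[OF D, of z0 0] z Z unfolding disc_def by auto
  have "Z g \<and> P g"
  proof (rule ccontr)
    assume "\<not> (Z g \<and> P g)"
    then have "evr g (\<lambda>z. Z z \<and> P z)" by (rule glb_evr[OF D g])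
    moreover have "evr g (\<lambda>z. \<not> Z z)" using Z unfolding disc_def by simp
    ultimately have "evr g (\<lambda>z. (Z z \<and> P z) \<and> \<not> Z z)" by (rule evr_conj)
    then show False using evr_ex gt_ex[of g] by blast
  qed
  then show ?thesis using g unfolding is_glb_def by (intro exI[of _ g]) simp
qed

lemma disc_max:
  assumes Z: "disc Z" and P: "D1 P" and z: "Z z0" "P z0" and b: "\<And>z. P z \<Longrightarrow> z \<le> b"
  shows "\<exists>z. Z z \<and> P z \<and> (\<forall>z'. Z z' \<and> P z' \<longrightarrow> z' \<le> z)"
proof -
  have D: "D1 (\<lambda>z. Z z \<and> P z)" by (intro dfi dfb_D1[OF P] disc_D1[OF Z])
  obtain g where g: "is_lub (\<lambda>z. Z z \<and> P z) g" using lub_ex[OF D, of z0 b] z b by auto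
  have "Z g \<and> P g"
  proof (rule ccontr)
    assume "\<not> (Z g \<and> P g)"
    then have "evl g (\<lambda>z. Z z \<and> P z)" by (rule lub_evl[OF D g])
    moreover have "evl g (\<lambda>z. \<not> Z z)" using Z unfolding disc_def by simp
    ultimately have "evl g (\<lambda>z. (Z z \<and> P z) \<and> \<not> Z z)" by (rule evl_conj)
    then show False using evl_ex lt_ex[of g] by blast
  qed
  then show ?thesis using g unfolding is_lub_def by (intro exI[of _ g]) simp
qed

text \<open>Least counterexamples exist by \<open>disc_min\<close>, so definable predicates admit
  induction along \<open>Z\<close> as along the natural numbers; \<open>step\<close> may use the
  immediate predecessor, if there is one.\<close>

lemma disc_induct:
  assumes Z: "disc Z" and P: "D1 P"
    and step: "\<And>z. Z z \<Longrightarrow> (\<And>z'. Z z' \<Longrightarrow> z' < z \<Longrightarrow> (\<And>z''. Z z'' \<Longrightarrow> z'' < z \<Longrightarrow> z'' \<le> z') \<Longrightarrow> P z') \<Longrightarrow> P z"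
    and z: "Z z"
  shows "P z"
proof (rule ccontr)
  assume "\<not> P z"
  have "D1 (\<lambda>z. \<not> P z)" by (intro dfi P)
  from disc_min[OF Z this z \<open>\<not> P z\<close>] obtain y where y: "Z y" "\<not> P y" "\<forall>z'. Z z' \<and> \<not> P z' \<longrightarrow> y \<le> z'"
    by (elim exE conjE)
  have "P y"
  proof (rule step[OF y(1)])
    fix z' assume "Z z'" "z' < y"
    then show "P z'" using y(3) by (auto simp: not_le[symmetric])
  qed
  then show False using y(2) by simp
qed

text \<open>A bounded part of \<open>Z\<close> behaves like a finite set: induction along
  \<open>Z\<close> enlarges a common bound by one point at a time.\<close>

lemma disc_uniform:
  assumes Z: "disc Z" and P: "D2 P" and mono: "\<And>z b b'. P z b \<Longrightarrow> b \<le> b' \<Longrightarrow> P z b'"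
    and ex: "\<And>z. Z z \<Longrightarrow> z \<le> w \<Longrightarrow> \<exists>b. P z b"
  shows "\<exists>b. \<forall>z. Z z \<and> z \<le> w \<longrightarrow> P z b"
proof -
  note DZ = dfb_D1[OF disc_D1[OF Z]]
  define H where "H z \<longleftrightarrow> z \<le> w \<longrightarrow> (\<exists>b. \<forall>z'. Z z' \<and> z' \<le> z \<longrightarrow> P z' b)" for z
  have DH: "D1 H" unfolding H_def by (intro dfi dfb_D2[OF P] DZ)
  have H: "H z" if "Z z" for z
  proof (rule disc_induct[OF Z DH _ that])
    fix z assume z: "Z z"
      and pred: "\<And>z'. Z z' \<Longrightarrow> z' < z \<Longrightarrow> (\<And>z''. Z z'' \<Longrightarrow> z'' < z \<Longrightarrow> z'' \<le> z') \<Longrightarrow> H z'"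
    show "H z" unfolding H_def
    proof
      assume zw: "z \<le> w"
      obtain b where b: "P z b" using ex[OF z zw] by auto
      show "\<exists>b. \<forall>z'. Z z' \<and> z' \<le> z \<longrightarrow> P z' b"
      proof (cases "\<exists>z'. Z z' \<and> z' < z")
        case False
        then have "z' = z" if "Z z'" "z' \<le> z" for z' using that by (auto simp: le_less)
        then show ?thesis using b by (intro exI[of _ b]) auto
      next
        case True
        then obtain z0 where z0: "Z z0" "z0 < z" by auto
        have D: "D1 (\<lambda>y. y < z)" by (intro dfi)
        have "\<exists>y. Z y \<and> y < z \<and> (\<forall>z'. Z z' \<and> z' < z \<longrightarrow> z' \<le> y)"
          by (rule disc_max[OF Z D z0, of z]) simp
        then obtain y where y: "Z y" "y < z" "\<forall>z'. Z z' \<and> z' < z \<longrightarrow> z' \<le> y" by (elim exE conjE)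
        have "H y" using pred[OF y(1,2)] y(3) by simp
        then obtain b' where b': "\<forall>z'. Z z' \<and> z' \<le> y \<longrightarrow> P z' b'"
          using less_le_trans[OF y(2) zw] unfolding H_def by auto
        have "P z' (max b b')" if z': "Z z'" "z' \<le> z" for z'
        proof (cases "z' = z")
          case True
          then show ?thesis using mono[OF b, of "max b b'"] by simp
        next
          case False
          then have "z' \<le> y" using y(3) z' by (auto simp: le_less)
          then show ?thesis using mono[of z' b' "max b b'"] b' z'(1) by simp
        qed
        then show ?thesis by auto
      qed
    qed
  qed
  show ?thesis
  proof (cases "\<exists>z. Z z \<and> z \<le> w")
    case True
    then obtain z0 where z0: "Z z0" "z0 \<le> w" by auto
    have D: "D1 (\<lambda>y. y \<le> w)" by (intro dfi)
    have "\<exists>y. Z y \<and> y \<le> w \<and> (\<forall>z'. Z z' \<and> z' \<le> w \<longrightarrow> z' \<le> y)"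
      by (rule disc_max[OF Z D z0, of w]) simp
    then obtain y where y: "Z y" "y \<le> w" "\<forall>z'. Z z' \<and> z' \<le> w \<longrightarrow> z' \<le> y" by (elim exE conjE)
    obtain b where "\<forall>z'. Z z' \<and> z' \<le> y \<longrightarrow> P z' b" using H[OF y(1)] y(2) unfolding H_def by auto
    then show ?thesis using y(3) by (intro exI[of _ b]) simp
  qed auto
qed

text \<open>The substitute for finitely many classes of \<open>E\<close> on \<open>Z\<close>, with
  bounded parts of \<open>Z\<close> in the place of finite sets.\<close>

definition bddrep :: "('a \<Rightarrow> bool) \<Rightarrow> ('a \<Rightarrow> 'a \<Rightarrow> bool) \<Rightarrow> bool" where
  "bddrep Z E \<longleftrightarrow> (\<exists>w. \<forall>z. Z z \<longrightarrow> (\<exists>z'. Z z' \<and> z' \<le> w \<and> E z z'))"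

text \<open>Classes of the conjunction correspond to pairs of classes with representatives
  \<open>z1\<close> and \<open>z2\<close> in bounded parts of \<open>Z\<close>. Each realised pair
  has a bound, and two applications of \<open>disc_uniform\<close> make it common to all
  pairs.\<close>

lemma bddrep_conj:
  assumes Z: "disc Z" and E: "D2 E1" "D2 E2"
    and sym: "\<And>x y. E1 x y \<Longrightarrow> E1 y x" "\<And>x y. E2 x y \<Longrightarrow> E2 y x"
    and tr: "\<And>x y z. E1 x y \<Longrightarrow> E1 y z \<Longrightarrow> E1 x z" "\<And>x y z. E2 x y \<Longrightarrow> E2 y z \<Longrightarrow> E2 x z"
    and b: "bddrep Z E1" "bddrep Z E2"
  shows "bddrep Z (\<lambda>x y. E1 x y \<and> E2 x y)"
proof -
  note DZ = dfb_D1[OF disc_D1[OF Z]]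
  obtain w1 where w1: "\<forall>z. Z z \<longrightarrow> (\<exists>z'. Z z' \<and> z' \<le> w1 \<and> E1 z z')" using b(1) unfolding bddrep_def by auto
  obtain w2 where w2: "\<forall>z. Z z \<longrightarrow> (\<exists>z'. Z z' \<and> z' \<le> w2 \<and> E2 z z')" using b(2) unfolding bddrep_def by auto
  define P where "P z1 z2 b \<longleftrightarrow> (\<exists>z. Z z \<and> E1 z z1 \<and> E2 z z2) \<longrightarrow> (\<exists>z. Z z \<and> z \<le> b \<and> E1 z z1 \<and> E2 z z2)"
    for z1 z2 b
  have Pm: "P z1 z2 b'" if "P z1 z2 b" "b \<le> b'" for z1 z2 b b'
    using that order_trans[of _ b b'] unfolding P_def by blast
  have Pex: "\<exists>b. P z1 z2 b" for z1 z2 unfolding P_def by blast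
  have P2: "D2 (P z1)" for z1 unfolding P_def by (intro dfi DZ dfb_D2[OF E(1)] dfb_D2[OF E(2)])
  have Q1: "\<exists>b. \<forall>z2. Z z2 \<and> z2 \<le> w2 \<longrightarrow> P z1 z2 b" for z1
    by (rule disc_uniform[OF Z P2]) (use Pm Pex in blast)+
  have "\<exists>b. \<forall>z1. Z z1 \<and> z1 \<le> w1 \<longrightarrow> (\<forall>z2. Z z2 \<and> z2 \<le> w2 \<longrightarrow> P z1 z2 b)"
  proof (rule disc_uniform[OF Z])
    show "D2 (\<lambda>z1 b. \<forall>z2. Z z2 \<and> z2 \<le> w2 \<longrightarrow> P z1 z2 b)"
      unfolding P_def by (intro dfi DZ dfb_D2[OF E(1)] dfb_D2[OF E(2)])
  qed (use Pm Q1 in blast)+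
  then obtain b where b: "\<forall>z1. Z z1 \<and> z1 \<le> w1 \<longrightarrow> (\<forall>z2. Z z2 \<and> z2 \<le> w2 \<longrightarrow> P z1 z2 b)" by auto
  have "\<exists>z'. Z z' \<and> z' \<le> b \<and> (E1 z z' \<and> E2 z z')" if z: "Z z" for z
  proof -
    obtain z1 where z1: "Z z1" "z1 \<le> w1" "E1 z z1" using w1 z by auto
    obtain z2 where z2: "Z z2" "z2 \<le> w2" "E2 z z2" using w2 z by auto
    have "P z1 z2 b" using b z1 z2 by simp
    then obtain z' where z': "Z z'" "z' \<le> b" "E1 z' z1" "E2 z' z2" using z z1 z2 unfolding P_def by auto
    have "E1 z z'" "E2 z z'" using tr(1)[OF z1(3) sym(1)[OF z'(3)]] tr(2)[OF z2(3) sym(2)[OF z'(4)]] .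
    then show ?thesis using z' by auto
  qed
  then show ?thesis unfolding bddrep_def by auto
qed

lemma bddrep_mono: "bddrep Z E \<Longrightarrow> (\<And>x y. E x y \<Longrightarrow> E' x y) \<Longrightarrow> bddrep Z E'"
  unfolding bddrep_def by meson

text \<open>If the union contained an interval, \<open>monotone_cover\<close> would find one in the
  union over a bounded part of \<open>Z\<close>. Induction along \<open>Z\<close> excludes this: the
  union so far contains no interval, so its complement contains a right germ at every point, and
  there the next set leaves a point uncovered.\<close>

lemma disc_union_no_interval:
  assumes Z: "disc Z" and P: "D2 P" and no: "\<And>z p q. Z z \<Longrightarrow> p < q \<Longrightarrow> \<exists>x. p < x \<and> x < q \<and> \<not> P z x"
    and pq: "p < q"
  shows "\<exists>x. p < x \<and> x < q \<and> (\<forall>z. Z z \<longrightarrow> \<not> P z x)"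
proof (rule ccontr)
  assume cov: "\<not> ?thesis"
  note DZ = dfb_D1[OF disc_D1[OF Z]]
  define Q where "Q u x \<longleftrightarrow> (\<exists>z. Z z \<and> z \<le> u \<and> P z x)" for u x
  have DQ: "D2 Q" unfolding Q_def by (intro dfi DZ dfb_D2[OF P])
  have "\<exists>u p' q'. p \<le> p' \<and> p' < q' \<and> q' \<le> q \<and> (\<forall>x. p' < x \<and> x < q' \<longrightarrow> Q u x)"
  proof (rule monotone_cover[OF DQ _ pq])
    show "(\<forall>x. Q u x \<longrightarrow> Q v x) \<or> (\<forall>x. Q v x \<longrightarrow> Q u x)" for u v
      unfolding Q_def using order_trans[of _ u v] order_trans[of _ v u] by (cases "u \<le> v") force+
    show "\<exists>u. Q u x" if x: "p < x" "x < q" for x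
    proof -
      obtain z where "Z z" "P z x" using cov x by auto
      then have "Q z x" unfolding Q_def by auto
      then show ?thesis ..
    qed
  qed
  then obtain u p' q' where *: "p' < q'" "\<forall>x. p' < x \<and> x < q' \<longrightarrow> Q u x" by auto
  define B where "B v \<longleftrightarrow> (\<forall>p q. p < q \<longrightarrow> (\<exists>x. p < x \<and> x < q \<and> \<not> Q v x))" for v
  have DB: "D1 B" unfolding B_def by (intro dfi dfb_D2[OF DQ])
  have B: "B z" if "Z z" for z
  proof (rule disc_induct[OF Z DB _ that])
    fix z assume z: "Z z"
      and pred: "\<And>z'. Z z' \<Longrightarrow> z' < z \<Longrightarrow> (\<And>z''. Z z'' \<Longrightarrow> z'' < z \<Longrightarrow> z'' \<le> z') \<Longrightarrow> B z'"
    show "B z" unfolding B_def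
    proof (intro allI impI)
      fix p q :: 'a assume pq: "p < q"
      show "\<exists>x. p < x \<and> x < q \<and> \<not> Q z x"
      proof (cases "\<exists>z'. Z z' \<and> z' < z")
        case False
        then have "z' = z" if "Z z'" "z' \<le> z" for z' using that by (auto simp: le_less)
        then have "Q z x \<longleftrightarrow> P z x" for x using z unfolding Q_def by auto
        then show ?thesis using no[OF z pq] by auto
      next
        case True
        then obtain z0 where z0: "Z z0" "z0 < z" by auto
        have D: "D1 (\<lambda>y. y < z)" by (intro dfi)
        have "\<exists>y. Z y \<and> y < z \<and> (\<forall>z'. Z z' \<and> z' < z \<longrightarrow> z' \<le> y)"
          by (rule disc_max[OF Z D z0, of z]) simp
        then obtain y where y: "Z y" "y < z" "\<forall>z'. Z z' \<and> z' < z \<longrightarrow> z' \<le> y" by (elim exE conjE)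
        have By: "B y" using pred[OF y(1,2)] y(3) by simp
        have Qz: "Q y x \<or> P z x" if x: "Q z x" for x
        proof -
          obtain z' where z': "Z z'" "z' \<le> z" "P z' x" using x unfolding Q_def by auto
          show ?thesis
          proof (cases "z' = z")
            case False
            then have "z' \<le> y" using y(3) z' by (auto simp: le_less)
            then show ?thesis using z' unfolding Q_def by auto
          qed (use z' in auto)
        qed
        have "D1 (Q y)" by (intro dfi dfb_D2[OF DQ])
        moreover have "\<not> evr p (Q y)"
        proof
          assume "evr p (Q y)"
          then obtain r where "p < r" "\<forall>x. p < x \<and> x < r \<longrightarrow> Q y x" unfolding evr_def by auto
          then show False using By unfolding B_def by blast
        qed
        ultimately have "evr p (\<lambda>x. \<not> Q y x)" using evr_cases by auto
        then obtain r where r: "p < r" "\<forall>x. p < x \<and> x < r \<longrightarrow> \<not> Q y x" unfolding evr_def by auto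
        have "p < min r q" using r pq by simp
        then obtain x where x: "p < x" "x < min r q" "\<not> P z x" using no[OF z] by blast
        then have "\<not> Q z x" using Qz r(2) by auto
        then show ?thesis using x by auto
      qed
    qed
  qed
  obtain x0 where "p' < x0" "x0 < q'" using dense[OF *(1)] by auto
  then obtain z0 where z0: "Z z0" "z0 \<le> u" using *(2) unfolding Q_def by auto
  have D: "D1 (\<lambda>y. y \<le> u)" by (intro dfi)
  have "\<exists>y. Z y \<and> y \<le> u \<and> (\<forall>z'. Z z' \<and> z' \<le> u \<longrightarrow> z' \<le> y)"
    by (rule disc_max[OF Z D z0, of u]) simp
  then obtain y where y: "Z y" "y \<le> u" "\<forall>z'. Z z' \<and> z' \<le> u \<longrightarrow> z' \<le> y" by (elim exE conjE)
  have "Q y x" if "Q u x" for x using that y(3) unfolding Q_def by auto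
  moreover obtain x where "p' < x" "x < q'" "\<not> Q y x" using B[OF y(1)] *(1) unfolding B_def by auto
  ultimately show False using *(2) by auto
qed

section \<open>Recurrence of the fibres of a family inside a bounded box\<close>

definition box :: "'a \<Rightarrow> 'a list \<Rightarrow> bool" where
  "box w x \<longleftrightarrow> (\<forall>y\<in>set x. - w \<le> y \<and> y \<le> w)"

lemma box_mono: "box w x \<Longrightarrow> w \<le> w' \<Longrightarrow> box w' x"
  unfolding box_def using order_trans neg_le by metis

lemma box_ex: "\<exists>w. c \<le> w \<and> box w x"
proof (induction x)
  case (Cons a x)
  then obtain w where w: "c \<le> w" "box w x" by auto
  define v where "v = max w (max a (- a))"
  have "- a \<le> v" unfolding v_def by (intro max.coboundedI2) simp
  then have "- v \<le> a" using neg_le_iff(1)[of v a] by simp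
  moreover have "a \<le> v" unfolding v_def by (rule max.coboundedI2) simp
  moreover have "w \<le> v" unfolding v_def by simp
  ultimately show ?case using w box_mono[OF w(2)] by (intro exI[of _ v]) (auto simp: box_def)
qed (auto simp: box_def)

lemma dfb_box:
  assumes "dts U c \<tau>" "dtm U c \<sigma>" "\<And>e. e \<in> U \<Longrightarrow> length (\<sigma> e) = k"
  shows "dfb U c (\<lambda>e. box (\<tau> e) (\<sigma> e))"
proof -
  have "dfb U c (\<lambda>e. \<forall>i<k. - \<tau> e \<le> \<sigma> e ! i \<and> \<sigma> e ! i \<le> \<tau> e)"
    by (intro dfb_finite_all dfi assms(1) dts_nth[OF assms(2,3)] dts_ctx[OF assms(1)])
  then show ?thesis by (rule dfb_transfer) (auto simp: box_def all_set_conv_all_nth assms(3))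
qed

lemma dfb_ternary:
  assumes "dfb ((UNIV \<times> UNIV) \<times> UNIV) (\<lambda>p. ([fst (fst p)] @ [snd (fst p)]) @ [snd p])
      (\<lambda>p. R (fst (fst p)) (snd (fst p)) (snd p))"
    and "dts U c \<rho>" "dts U c \<sigma>" "dts U c \<tau>"
  shows "dfb U c (\<lambda>e. R (\<rho> e) (\<sigma> e) (\<tau> e))"
  using dfb_lift0[OF assms(1), of U c "\<lambda>e. ((\<rho> e, \<sigma> e), \<tau> e)"]
    dtm_cons[OF assms(2) dtm_cons[OF assms(3) dtm_single[OF assms(4)]]] by simp

text \<open>Induction on the dimension, scanning the first coordinate \<open>\<rho>\<close> from
  below the box to its top. Agreement of fibres at a single \<open>\<rho>\<close> is the induction
  hypothesis. For all pairs from \<open>Z\<close> it changes only at points of a set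
  \<open>W\<close> that is empty on both germs at every point, so finitely many values of
  \<open>\<rho>\<close> suffice to carry the scan past any point.\<close>

lemma pattern_disc:
  assumes Z: "disc Z"
    and "dfb (UNIV \<times> tup l) (\<lambda>p. [fst p] @ snd p) (\<lambda>p. A (fst p) (snd p))"
    and "\<And>z x. length x = l \<Longrightarrow> A z x \<Longrightarrow> box u x"
  shows "bddrep Z (\<lambda>z z'. \<forall>x\<in>tup l. A z x \<longleftrightarrow> A z' x)"
  using assms(2,3)
proof (induction l arbitrary: A)
  case 0
  have eq: "(\<forall>x\<in>tup 0. A z x \<longleftrightarrow> A z' x) \<longleftrightarrow> (A z [] \<longleftrightarrow> A z' [])" for z z' by auto
  have "\<exists>w. \<forall>z. Z z \<and> A z [] \<longrightarrow> (\<exists>z'. Z z' \<and> z' \<le> w \<and> A z' [])" by blast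
  then obtain w1 where w1: "\<forall>z. Z z \<and> A z [] \<longrightarrow> (\<exists>z'. Z z' \<and> z' \<le> w1 \<and> A z' [])" by auto
  have "\<exists>w. \<forall>z. Z z \<and> \<not> A z [] \<longrightarrow> (\<exists>z'. Z z' \<and> z' \<le> w \<and> \<not> A z' [])" by blast
  then obtain w2 where w2: "\<forall>z. Z z \<and> \<not> A z [] \<longrightarrow> (\<exists>z'. Z z' \<and> z' \<le> w2 \<and> \<not> A z' [])" by auto
  show ?case unfolding bddrep_def eq
  proof (rule exI[of _ "max w1 w2"], intro allI impI)
    fix z assume z: "Z z"
    show "\<exists>z'. Z z' \<and> z' \<le> max w1 w2 \<and> A z [] = A z' []"
    proof (cases "A z []")
      case True
      then obtain z' where "Z z'" "z' \<le> w1" "A z' []" using w1 z by auto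
      then show ?thesis using True by (intro exI[of _ z']) (auto simp: le_max_iff_disj)
    next
      case False
      then obtain z' where "Z z'" "z' \<le> w2" "\<not> A z' []" using w2 z by auto
      then show ?thesis using False by (intro exI[of _ z']) (auto simp: le_max_iff_disj)
    qed
  qed
next
  case (Suc l)
  note AD = Suc.prems(1) and Abox = Suc.prems(2)
  note DZ = dfb_D1[OF disc_D1[OF Z]]
  note AL = dfb_lift_tup[OF AD]
  define B where "B z z' \<rho> \<longleftrightarrow> (\<forall>r\<in>tup l. A z (\<rho> # r) \<longleftrightarrow> A z' (\<rho> # r))" for z z' \<rho>
  have B\<rho>: "bddrep Z (\<lambda>z z'. B z z' \<rho>)" for \<rho>
    unfolding B_def
  proof (rule Suc.IH[of "\<lambda>z r. A z (\<rho> # r)"])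
    show "dfb (UNIV \<times> tup l) (\<lambda>p. [fst p] @ snd p) (\<lambda>p. A (fst p) (\<rho> # snd p))"
      by (intro AL dfi) auto
    show "box u x" if "length x = l" "A z (\<rho> # x)" for z x
      using Abox[of "\<rho> # x" z] that by (auto simp: box_def)
  qed
  have Bsym: "B z' z \<rho>" if "B z z' \<rho>" for z z' \<rho> using that unfolding B_def by simp
  have Btr: "B z z'' \<rho>" if "B z z' \<rho>" "B z' z'' \<rho>" for z z' z'' \<rho> using that unfolding B_def by simp
  have "dfb ((UNIV \<times> UNIV) \<times> UNIV) (\<lambda>p. ([fst (fst p)] @ [snd (fst p)]) @ [snd p])
      (\<lambda>p. B (fst (fst p)) (snd (fst p)) (snd p))"
    unfolding B_def by (intro dfb_ball[OF S_tup] dfb_iff AL dfi) auto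
  note BD = dfb_ternary[OF this]
  have B2: "D2 (\<lambda>z z'. B z z' \<rho>)" for \<rho> by (intro BD dfi)
  have B1: "D1 (B z z')" for z z' by (intro BD dfi)
  define V where "V z \<rho> \<longleftrightarrow> (\<exists>z'. Z z' \<and> \<not> locconst (B z z') \<rho>)" for z \<rho>
  have V1: "\<exists>x. p < x \<and> x < q \<and> \<not> V z x" if pq: "p < q" for z p q
  proof -
    have "D2 (\<lambda>z' \<rho>. \<not> locconst (B z z') \<rho>)"
      unfolding locconst_def by (intro dfi BD)
    moreover have "\<exists>x. p < x \<and> x < q \<and> \<not> \<not> locconst (B z z') x" if "p < q" for z' p q
      using evr_ex[OF evr_locconst[OF B1] that] by simp
    ultimately have "\<exists>x. p < x \<and> x < q \<and> (\<forall>z'. Z z' \<longrightarrow> \<not> \<not> locconst (B z z') x)"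
      by (rule disc_union_no_interval[OF Z _ _ pq])
    then show ?thesis unfolding V_def by auto
  qed
  \<comment> \<open>The places where agreement changes for some pair from \<open>Z\<close>. Applying
    \<open>disc_union_no_interval\<close> to each member of the pair shows that \<open>W\<close>
    contains no interval, hence no germ.\<close>
  define W where "W \<rho> \<longleftrightarrow> (\<exists>z. Z z \<and> V z \<rho>)" for \<rho>
  have DW: "D1 W" unfolding W_def V_def locconst_def by (intro dfi DZ BD)
  have W1: "\<exists>x. p < x \<and> x < q \<and> \<not> W x" if pq: "p < q" for p q
  proof -
    have "D2 V" unfolding V_def locconst_def by (intro dfi DZ BD)
    from disc_union_no_interval[OF Z this V1 pq] show ?thesis unfolding W_def by auto
  qed
  have Wr: "evr x (\<lambda>z. \<not> W z)" and Wl: "evl x (\<lambda>z. \<not> W z)" for x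
  proof -
    have "\<not> evr x W"
    proof
      assume "evr x W"
      then obtain y where "x < y" "\<forall>z. x < z \<and> z < y \<longrightarrow> W z" unfolding evr_def by auto
      then show False using W1[of x y] by auto
    qed
    then show "evr x (\<lambda>z. \<not> W z)" using evr_cases[OF DW] by auto
    have "\<not> evl x W"
    proof
      assume "evl x W"
      then obtain y where "y < x" "\<forall>z. y < z \<and> z < x \<longrightarrow> W z" unfolding evl_def by auto
      then show False using W1[of y x] by auto
    qed
    then show "evl x (\<lambda>z. \<not> W z)" using evl_cases[OF DW] by auto
  qed
  have const: "B z z' y1 \<longleftrightarrow> B z z' y2"
    if z: "Z z" "Z z'" and W: "\<forall>x. c < x \<and> x < d \<longrightarrow> \<not> W x" and y: "c < y1" "y1 < d" "c < y2" "y2 < d"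
    for z z' c d y1 y2
  proof (rule locconst_imp_const[OF B1 _ y])
    fix x assume "c < x" "x < d"
    then have "\<not> W x" using W by simp
    then show "locconst (B z z') x" using z unfolding W_def V_def by auto
  qed
  define E where "E \<sigma> z z' \<longleftrightarrow> (\<forall>\<rho>. \<rho> \<le> \<sigma> \<longrightarrow> B z z' \<rho>)" for \<sigma> z z'
  have E2: "D2 (E \<sigma>)" for \<sigma> unfolding E_def by (intro dfi BD)
  define Sig where "Sig \<sigma> \<longleftrightarrow> bddrep Z (E \<sigma>)" for \<sigma>
  have DS: "D1 Sig" unfolding Sig_def bddrep_def E_def by (intro dfi DZ BD)
  have down: "Sig \<sigma>'" if "Sig \<sigma>" "\<sigma>' \<le> \<sigma>" for \<sigma> \<sigma>'
    using that(1) unfolding Sig_def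
  proof (rule bddrep_mono)
    show "E \<sigma>' x y" if "E \<sigma> x y" for x y using that \<open>\<sigma>' \<le> \<sigma>\<close> order_trans unfolding E_def by blast
  qed
  have out: "\<not> A z (\<rho> # r)" if "length r = l" "\<rho> < - u \<or> u < \<rho>" for z \<rho> r
  proof
    assume "A z (\<rho> # r)"
    then have "box u (\<rho> # r)" using Abox that(1) by simp
    then show False using that(2) unfolding box_def by auto
  qed
  have "Sig u"
  proof (rule ccontr)
    assume nS: "\<not> Sig u"
    obtain \<sigma>0 where \<sigma>0: "\<sigma>0 < - u" using lt_ex by blast
    have "E \<sigma>0 z z'" for z z'
      unfolding E_def B_def using out le_less_trans[OF _ \<sigma>0] by auto
    then have S0: "Sig \<sigma>0" unfolding Sig_def bddrep_def by blast
    have up: "\<sigma> \<le> u" if "Sig \<sigma>" for \<sigma> using nS down[OF that] by (meson le_cases)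
    \<comment> \<open>If the scan stopped at \<open>s\<close>, then agreement up to some
      \<open>\<sigma>\<close> close to \<open>s\<close>, at one point \<open>\<rho>1\<close> left of
      \<open>s\<close>, at \<open>s\<close>, and at one point \<open>\<rho>2\<close> right of
      \<open>s\<close> would give agreement up to \<open>\<rho>2\<close>, because nothing changes in
      between.\<close>
    obtain s where s: "is_lub Sig s" using lub_ex[OF DS S0 up] by auto
    obtain s1 where s1: "s1 < s" "\<forall>x. s1 < x \<and> x < s \<longrightarrow> \<not> W x" using Wl unfolding evl_def by blast
    obtain s2 where s2: "s < s2" "\<forall>x. s < x \<and> x < s2 \<longrightarrow> \<not> W x" using Wr unfolding evr_def by blast
    obtain \<sigma> where \<sigma>: "Sig \<sigma>" "s1 < \<sigma>" "\<sigma> \<le> s" using lub_less[OF s s1(1)] by auto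
    obtain \<rho>1 where \<rho>1: "s1 < \<rho>1" "\<rho>1 < s" using dense[OF s1(1)] by auto
    obtain \<rho>2 where \<rho>2: "s < \<rho>2" "\<rho>2 < s2" using dense[OF s2(1)] by auto
    have 1: "bddrep Z (\<lambda>z z'. B z z' \<rho>1 \<and> B z z' s)"
      by (rule bddrep_conj[OF Z B2 B2 Bsym Bsym Btr Btr B\<rho> B\<rho>])
    have 2: "bddrep Z (\<lambda>z z'. (B z z' \<rho>1 \<and> B z z' s) \<and> B z z' \<rho>2)"
      by (rule bddrep_conj[where ?E1.0 = "\<lambda>z z'. B z z' \<rho>1 \<and> B z z' s" and ?E2.0 = "\<lambda>z z'. B z z' \<rho>2",
            OF Z dfb_conj[OF B2 B2] B2 _ Bsym _ Btr 1 B\<rho>]) (use Bsym Btr in blast)+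
    have 3: "bddrep Z (\<lambda>z z'. ((B z z' \<rho>1 \<and> B z z' s) \<and> B z z' \<rho>2) \<and> E \<sigma> z z')"
    proof (rule bddrep_conj[where ?E1.0 = "\<lambda>z z'. (B z z' \<rho>1 \<and> B z z' s) \<and> B z z' \<rho>2" and
          ?E2.0 = "E \<sigma>", OF Z dfb_conj[OF dfb_conj[OF B2 B2] B2] E2 _ _ _ _ 2])
      show "bddrep Z (E \<sigma>)" using \<sigma>(1) unfolding Sig_def .
      show "E \<sigma> y x" if "E \<sigma> x y" for x y using that Bsym unfolding E_def by simp
      show "E \<sigma> x z" if "E \<sigma> x y" "E \<sigma> y z" for x y z
        using that Btr unfolding E_def by blast
    qed (use Bsym Btr in blast)+
    obtain w where w: "\<forall>z. Z z \<longrightarrow> (\<exists>z'. Z z' \<and> z' \<le> w \<and> ((B z z' \<rho>1 \<and> B z z' s) \<and> B z z' \<rho>2) \<and> E \<sigma> z z')"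
      using 3 unfolding bddrep_def by blast
    have "Sig \<rho>2" unfolding Sig_def bddrep_def
    proof (rule exI[of _ w], intro allI impI)
      fix z assume z: "Z z"
      then obtain z' where z': "Z z'" "z' \<le> w" "B z z' \<rho>1" "B z z' s" "B z z' \<rho>2" "E \<sigma> z z'" using w by auto
      have "B z z' \<rho>" if \<rho>: "\<rho> \<le> \<rho>2" for \<rho>
      proof (cases "\<rho> \<le> \<sigma>")
        case True
        then show ?thesis using z'(6) unfolding E_def by simp
      next
        case False
        then have "s1 < \<rho>" using order.strict_trans[OF \<sigma>(2), of \<rho>] by simp
        show ?thesis
        proof (cases \<rho> s rule: linorder_cases)
          case less
          then show ?thesis using const[OF z z'(1) s1(2) \<open>s1 < \<rho>\<close> less \<rho>1] z'(3) by simp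
        next
          case equal
          then show ?thesis using z'(4) by simp
        next
          case greater
          have "\<rho> < s2" using le_less_trans[OF \<rho> \<rho>2(2)] .
          then show ?thesis using const[OF z z'(1) s2(2) greater _ \<rho>2] z'(5) by simp
        qed
      qed
      then have "E \<rho>2 z z'" unfolding E_def by simp
      then show "\<exists>z'. Z z' \<and> z' \<le> w \<and> E \<rho>2 z z'" using z' by auto
    qed
    then have "\<rho>2 \<le> s" using s unfolding is_lub_def by simp
    then show False using \<rho>2(1) by simp
  qed
  then show ?case unfolding Sig_def
  proof (rule bddrep_mono)
    fix z z' assume E: "E u z z'"
    show "\<forall>x\<in>tup (Suc l). A z x \<longleftrightarrow> A z' x"
    proof
      fix x :: "'a list" assume "x \<in> tup (Suc l)"
      then obtain \<rho> r where x: "x = \<rho> # r" "length r = l" by (cases x) auto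
      show "A z x \<longleftrightarrow> A z' x"
      proof (cases "\<rho> \<le> u")
        case True
        then show ?thesis using E x unfolding E_def B_def by simp
      next
        case False
        then have "u < \<rho>" by simp
        then show ?thesis using out[OF x(2), of \<rho>] x(1) by simp
      qed
    qed
  qed
qed

text \<open>Otherwise choose for each \<open>z\<close> in an unbounded \<open>Z\<close> a parameter
  \<open>\<phi> z\<close> whose fibre does not occur over the box of size \<open>z\<close>. By
  \<open>pattern_disc\<close> all these fibres already occur for some \<open>z' \<le> w\<close>, and
  those \<open>\<phi> z'\<close> stay in one box; a \<open>z\<close> beyond its size contradicts the
  choice.\<close>

lemma pattern_bounded:
  assumes nt: "\<not> tame_inf" and X: "X \<in> S k"
    and A: "dfb (tup k \<times> tup l) (\<lambda>p. fst p @ snd p) (\<lambda>p. A (fst p) (snd p))"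
    and Abox: "\<And>x y. length x = k \<Longrightarrow> length y = l \<Longrightarrow> A x y \<Longrightarrow> box u y"
  shows "\<exists>w. 0 \<le> w \<and> (\<forall>x\<in>X. \<exists>x'\<in>X. box w x' \<and> (\<forall>y\<in>tup l. A x y \<longleftrightarrow> A x' y))"
proof (rule ccontr)
  assume no: "\<not> ?thesis"
  obtain Z where Z: "disc Z" "\<forall>u. \<exists>z. Z z \<and> u < z" using disc_ex[OF nt] by auto
  define P where "P z x \<longleftrightarrow> x \<in> X \<and> (\<forall>x'\<in>X. box z x' \<longrightarrow> \<not> (\<forall>y\<in>tup l. A x y \<longleftrightarrow> A x' y))" for z x
  have PD: "dfb (UNIV \<times> tup k) (\<lambda>p. [fst p] @ snd p) (\<lambda>p. P (fst p) (snd p))"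
    unfolding P_def
    by (intro dfi dtm_mem[OF X] dfb_ball[OF X] dfb_ball[OF S_tup] dfb_pair[OF A] dfb_box[where k = k]) auto
  define \<phi> where "\<phi> z = choose_tup k (P z)" for z
  have l\<phi>: "length (\<phi> z) = k" for z unfolding \<phi>_def by simp
  have \<phi>D: "dtm UNIV (\<lambda>x. [x]) \<phi>" unfolding \<phi>_def by (rule dtm_choose_tup[OF PD]) (intro dfi)
  have \<phi>: "P z (\<phi> z)" if z: "Z z" for z
  proof -
    have "0 \<le> z" using Z(1) z unfolding disc_def by simp
    then obtain x where x: "x \<in> X" "\<forall>x'\<in>X. \<not> (box z x' \<and> (\<forall>y\<in>tup l. A x y \<longleftrightarrow> A x' y))" using no by auto
    then have "P z x" unfolding P_def by simp
    moreover have "dfb (tup k) (\<lambda>x. x) (P z)"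
      by (rule dfb_lift_tup[OF PD, where g = "\<lambda>_. z"]) (intro dfi | simp)+
    ultimately show ?thesis unfolding \<phi>_def using choose_tup S_length[OF X x(1)] by blast
  qed
  have "bddrep Z (\<lambda>z z'. \<forall>y\<in>tup l. A (\<phi> z) y \<longleftrightarrow> A (\<phi> z') y)"
  proof (rule pattern_disc[OF Z(1)])
    show "dfb (UNIV \<times> tup l) (\<lambda>p. [fst p] @ snd p) (\<lambda>p. A (\<phi> (fst p)) (snd p))"
      by (intro dfb_pair[OF A] dtm_app1[OF \<phi>D] dfi) (auto simp: l\<phi>)
    show "box u y" if "length y = l" "A (\<phi> z) y" for z y using Abox[OF l\<phi> that] .
  qed
  then obtain w where w: "\<forall>z. Z z \<longrightarrow> (\<exists>z'. Z z' \<and> z' \<le> w \<and> (\<forall>y\<in>tup l. A (\<phi> z) y \<longleftrightarrow> A (\<phi> z') y))"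
    unfolding bddrep_def by blast
  have "\<exists>b. \<forall>z. Z z \<and> z \<le> w \<longrightarrow> box b (\<phi> z)"
  proof (rule disc_uniform[OF Z(1)])
    show "D2 (\<lambda>z b. box b (\<phi> z))"
      by (intro dfb_box[where k = k] dfi dtm_app1[OF \<phi>D]) (simp add: l\<phi>)
    show "\<exists>b. box b (\<phi> z)" for z using box_ex by auto
  qed (rule box_mono)
  then obtain b where b: "\<forall>z. Z z \<and> z \<le> w \<longrightarrow> box b (\<phi> z)" by auto
  obtain z where z: "Z z" "b < z" using Z(2) by auto
  obtain z' where z': "Z z'" "z' \<le> w" "\<forall>y\<in>tup l. A (\<phi> z) y \<longleftrightarrow> A (\<phi> z') y" using w z(1) by auto
  have "box z (\<phi> z')" using b z' z(2) box_mono by (meson less_imp_le)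
  moreover have "\<phi> z' \<in> X" using \<phi>[OF z'(1)] unfolding P_def by simp
  ultimately show False using \<phi>[OF z(1)] z'(3) unfolding P_def by blast
qed

end

section \<open>From curves to filtered families\<close>

context dclom
begin

lemma dtm_map:
  assumes "ctx U c" "\<And>i. i < k \<Longrightarrow> dts U c (\<sigma> i)"
  shows "dtm U c (\<lambda>e. map (\<lambda>i. \<sigma> i e) [0..<k])"
  using assms(2)
proof (induction k)
  case 0
  then show ?case by (simp add: dtm_nil[OF assms(1)])
next
  case (Suc k)
  have "dtm U c (\<lambda>e. map (\<lambda>i. \<sigma> i e) [0..<k] @ [\<sigma> k e])"
    by (intro dtm_append dtm_single Suc) simp_all
  then show ?case by simp
qed

text \<open>Positive and negative parts, since types are built in nonnegative coordinates only;
  \<open>dec\<close> recovers the tuple by subtraction.\<close>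

definition enc :: "'a list \<Rightarrow> 'a list" where
  "enc x = map (\<lambda>a. max a 0) x @ map (\<lambda>a. max (- a) 0) x"

definition dec :: "nat \<Rightarrow> 'a list \<Rightarrow> 'a list" where
  "dec k z = map (\<lambda>i. z ! i - z ! (k + i)) [0..<k]"

lemma length_dec [simp]: "length (dec k z) = k"
  unfolding dec_def by simp

lemma length_enc [simp]: "length (enc x) = length x + length x"
  unfolding enc_def by simp

lemma dtm_dec: "dtm (tup (k + k)) (\<lambda>x. x) (dec k)"
  unfolding dec_def by (intro dtm_map dfi dts_nth[where j = "k + k"]) auto

lemma dec_enc: "length x = k \<Longrightarrow> dec k (enc x) = x"
proof (rule nth_equalityI)
  fix i assume x: "length x = k" and "i < length (dec k (enc x))"
  then have i: "i < k" by simp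
  have "dec k (enc x) ! i = max (x ! i) 0 - max (- (x ! i)) 0"
    using i x unfolding dec_def enc_def by (simp add: nth_append)
  also have "\<dots> = x ! i"
  proof (cases "0 \<le> x ! i")
    case True
    moreover from True have "- (x ! i) \<le> 0" using neg_le[of "x ! i" 0] by simp
    ultimately show ?thesis by (simp add: max_def)
  next
    case False
    then have "0 < - (x ! i)" by (simp add: not_le)
    then have "max (- (x ! i)) 0 = - (x ! i)" "max (x ! i) 0 = 0" using False by simp_all
    then show ?thesis by simp
  qed
  finally show "dec k (enc x) ! i = x ! i" .
qed simp

lemma enc_inK:
  assumes "tame_inf \<or> box w x" "0 \<le> w" "y \<in> set (enc x)"
  shows "inK w y"
proof -
  obtain a where a: "a \<in> set x" "y = max a 0 \<or> y = max (- a) 0" using assms(3) unfolding enc_def by auto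
  have "tame_inf \<or> (a \<le> w \<and> - a \<le> w)"
    using assms(1) a(1) neg_le_iff(1)[of w a] unfolding box_def by auto
  then show ?thesis using a(2) assms(2) unfolding inK_def by auto
qed

lemma dfb_inK:
  assumes "dtm U c \<sigma>" "\<And>e. e \<in> U \<Longrightarrow> length (\<sigma> e) = k"
  shows "dfb U c (\<lambda>e. \<forall>y\<in>set (\<sigma> e). inK w y)"
proof -
  have "dfb U c (\<lambda>e. \<forall>i<k. 0 \<le> \<sigma> e ! i \<and> (tame_inf \<or> \<sigma> e ! i \<le> w))"
    by (intro dfb_finite_all dfi dts_nth[OF assms] dtm_ctx[OF assms(1)])
  then show ?thesis by (rule dfb_transfer) (auto simp: inK_def all_set_conv_all_nth assms(2))
qed

end

context dclom_space
begin

text \<open>Carries \<open>filter_extends_to_type\<close> over to coordinates of any sign: indices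
  and members are pulled back along \<open>dec\<close>, and the resulting type is pushed forward
  again. The point \<open>x0\<close> is the limit of the identity map.\<close>

lemma filter_limit:
  assumes cc: curve_complete and I: "I \<in> S l" "I \<noteq> {}"
    and DD: "dfb (tup l \<times> tup n) (\<lambda>p. fst p @ snd p) (\<lambda>p. D (fst p) (snd p))"
    and ne: "\<And>s. s \<in> I \<Longrightarrow> \<exists>x. length x = n \<and> D s x"
    and DX: "\<And>s x. s \<in> I \<Longrightarrow> length x = n \<Longrightarrow> D s x \<Longrightarrow> x \<in> X"
    and filt: "\<And>s t. s \<in> I \<Longrightarrow> t \<in> I \<Longrightarrow> \<exists>r\<in>I. \<forall>x. length x = n \<longrightarrow> D r x \<longrightarrow> D s x \<and> D t x"
    and w: "0 \<le> w" and Ib: "\<And>s. s \<in> I \<Longrightarrow> tame_inf \<or> box w s"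
    and Db: "\<And>s x. s \<in> I \<Longrightarrow> length x = n \<Longrightarrow> D s x \<Longrightarrow> tame_inf \<or> box w x"
  shows "\<exists>F x0. deftype n F \<and> x0 \<in> X \<and> (\<forall>s\<in>I. \<forall>\<^sub>F x in F. D s x) \<and> (\<forall>A. nbhd A x0 \<longrightarrow> (\<forall>\<^sub>F x in F. x \<in> A))"
proof -
  have len: "length s = l" if "s \<in> I" for s using S_length[OF I(1) that] .
  define I' where "I' = {s. length s = l + l \<and> ((\<forall>y\<in>set s. inK w y) \<and> dec l s \<in> I)}"
  have "dfb (tup (l + l)) (\<lambda>x. x) (\<lambda>s. (\<forall>y\<in>set s. inK w y) \<and> dec l s \<in> I)"
    by (intro dfi dfb_inK[where k = "l + l"] dtm_mem[OF I(1)] dtm_dec) simp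
  then have I': "I' \<in> S (l + l)" unfolding I'_def dfb_tup_iff .
  have encI: "enc s \<in> I'" if "s \<in> I" for s
    using enc_inK[OF Ib[OF that] w] dec_enc[OF len[OF that]] len[OF that] that unfolding I'_def by simp
  define D' where "D' s z \<longleftrightarrow> (\<forall>y\<in>set z. inK w y) \<and> D (dec l s) (dec n z)" for s z
  have "\<exists>F. nice (n + n) F \<and> (\<forall>s\<in>I'. \<forall>\<^sub>F z in F. D' s z)"
  proof (rule filter_extends_to_type[OF cc w I'])
    show "I' \<noteq> {}" using encI I(2) by auto
    show "inK w y" if "s \<in> I'" "y \<in> set s" for s y using that unfolding I'_def by auto
    show "dfb (tup (l + l) \<times> tup (n + n)) (\<lambda>p. fst p @ snd p) (\<lambda>p. D' (fst p) (snd p))"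
      unfolding D'_def
      by (intro dfi dfb_inK[where k = "n + n"] dfb_pair[OF DD] dtm_app[OF dtm_dec]) auto
    show "\<exists>z. length z = n + n \<and> D' s z" if s: "s \<in> I'" for s
    proof -
      have d: "dec l s \<in> I" using s unfolding I'_def by simp
      obtain x where x: "length x = n" "D (dec l s) x" using ne[OF d] by auto
      have "D' s (enc x)" unfolding D'_def using enc_inK[OF Db[OF d x] w] dec_enc[OF x(1)] x(2) by simp
      then show ?thesis using x(1) by (intro exI[of _ "enc x"]) simp
    qed
    show "inK w y" if "D' s z" "y \<in> set z" for s z y using that unfolding D'_def by auto
    show "\<exists>r\<in>I'. \<forall>z. length z = n + n \<longrightarrow> D' r z \<longrightarrow> D' s z \<and> D' t z" if st: "s \<in> I'" "t \<in> I'" for s t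
    proof -
      have "dec l s \<in> I" "dec l t \<in> I" using st unfolding I'_def by simp_all
      then obtain r where r: "r \<in> I" "\<forall>x. length x = n \<longrightarrow> D r x \<longrightarrow> D (dec l s) x \<and> D (dec l t) x"
        using filt by meson
      have "D' s z \<and> D' t z" if z: "D' (enc r) z" for z
        using z r(2) dec_enc[OF len[OF r(1)]] unfolding D'_def by simp
      then show ?thesis using encI[OF r(1)] by auto
    qed
  qed
  then obtain F' where F': "nice (n + n) F'" "\<forall>s\<in>I'. \<forall>\<^sub>F z in F'. D' s z" by auto
  define F where "F = filtermap (dec n) F'"
  have F: "nice n F" unfolding F_def by (rule nice_filtermap[OF F'(1) dtm_dec]) simp
  have evD: "\<forall>\<^sub>F x in F. D s x" if s: "s \<in> I" for s
    unfolding F_def eventually_filtermap using F'(2)[rule_format, OF encI[OF s]]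
    by eventually_elim (use dec_enc[OF len[OF s]] in \<open>simp add: D'_def\<close>)
  have dF: "deftype n F" and gF: "Good n F" using F unfolding nice_def by simp_all
  obtain s where s: "s \<in> I" using I(2) by auto
  have "\<forall>\<^sub>F x in F. x \<in> X" using evD[OF s] deftype_length[OF dF] by eventually_elim (rule DX[OF s])
  then have "\<exists>x\<in>X. \<forall>A. nbhd A x \<longrightarrow> (\<forall>\<^sub>F x in F. x \<in> A)"
    by (intro GoodD[OF gF, of "\<lambda>x. x"] dfi) simp_all
  then show ?thesis using dF evD by auto
qed

lemma closed_nbhd: "closedin T C \<Longrightarrow> C \<in> S n \<Longrightarrow> x \<in> X \<Longrightarrow> x \<notin> C \<Longrightarrow> nbhd (X - C) x"
  unfolding nbhd_def definable_nbhd_def using S_diff[OF X_S] topspace_X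
  by (auto intro!: exI[of _ "X - C"] openin_diff)

lemma limit_in_closed:
  assumes F: "deftype n F" and x: "x \<in> X" "\<forall>A. nbhd A x \<longrightarrow> (\<forall>\<^sub>F y in F. y \<in> A)"
    and C: "closedin T C" "C \<in> S n" "\<forall>\<^sub>F y in F. y \<in> C"
  shows "x \<in> C"
proof (rule ccontr)
  assume "x \<notin> C"
  then have "\<forall>\<^sub>F y in F. y \<in> X - C" using x closed_nbhd[OF C(1,2)] by blast
  then have "\<forall>\<^sub>F y in F. False" using C(3) by eventually_elim simp
  then show False using deftype_bot[OF F] by (simp add: trivial_limit_def[symmetric] eventually_False)
qed

text \<open>
  If definable sets are not tame at infinity, a definable family of subsets of a bounded box has
  all its members already over a bounded part of its index set.  This confines both the points and
  the indices of the filtered family to boxes, as long as only the constraints indexed by a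
  bounded set have to be met.
\<close>

lemma bounded_constraints_point:
  assumes cc: curve_complete and nt: "\<not> tame_inf" and I: "I \<in> S l" "I \<noteq> {}"
    and DD: "dfb (tup l \<times> tup n) (\<lambda>p. fst p @ snd p) (\<lambda>p. D (fst p) (snd p))"
    and ne: "\<And>s. s \<in> I \<Longrightarrow> \<exists>x. length x = n \<and> D s x"
    and DX: "\<And>s x. s \<in> I \<Longrightarrow> length x = n \<Longrightarrow> D s x \<Longrightarrow> x \<in> X"
    and filt: "\<And>s t. s \<in> I \<Longrightarrow> t \<in> I \<Longrightarrow> \<exists>r\<in>I. \<forall>x. length x = n \<longrightarrow> D r x \<longrightarrow> D s x \<and> D t x"
    and closed: "\<And>s. s \<in> I \<Longrightarrow> closedin T {x. length x = n \<and> D s x}"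
  shows "\<exists>x\<in>X. \<forall>s\<in>I. box u s \<longrightarrow> D s x"
proof -
  have len: "length s = l" if "s \<in> I" for s using S_length[OF I(1) that] .
  have DS: "{x. length x = n \<and> D s x} \<in> S n" if "s \<in> I" for s
    unfolding dfb_tup_iff[symmetric] by (intro dfb_pair[OF DD] dfi) (use len that in auto)
  \<comment> \<open>Points are distinguished only by the constraints of size \<open>u\<close> that
    they meet. With points as parameters, \<open>pattern_bounded\<close> represents every class
    inside a box of size \<open>w0\<close>.\<close>
  define eqv where "eqv x y \<longleftrightarrow> (\<forall>s\<in>I. box u s \<longrightarrow> (D s x \<longleftrightarrow> D s y))" for x y
  have eqvD: "dfb (tup n \<times> tup n) (\<lambda>p. fst p @ snd p) (\<lambda>p. eqv (fst p) (snd p))"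
    unfolding eqv_def by (intro dfi dfb_ball[OF I(1)] dfb_box[where k = l] dfb_pair[OF DD]) auto
  have "\<exists>w. 0 \<le> w \<and> (\<forall>x\<in>X. \<exists>x'\<in>X. box w x' \<and>
      (\<forall>s\<in>tup l. (s \<in> I \<and> box u s \<and> D s x) \<longleftrightarrow> (s \<in> I \<and> box u s \<and> D s x')))"
  proof (rule pattern_bounded[OF nt X_S, where u = u])
    show "dfb (tup n \<times> tup l) (\<lambda>p. fst p @ snd p) (\<lambda>p. snd p \<in> I \<and> box u (snd p) \<and> D (snd p) (fst p))"
      by (intro dfi dtm_mem[OF I(1)] dfb_box[where k = l] dfb_pair[OF DD]) auto
  qed simp
  then obtain w0 where w0: "0 \<le> w0" "\<forall>x\<in>X. \<exists>x'\<in>X. box w0 x' \<and>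
      (\<forall>s\<in>tup l. (s \<in> I \<and> box u s \<and> D s x) \<longleftrightarrow> (s \<in> I \<and> box u s \<and> D s x'))" by (elim exE conjE)
  have rep: "\<exists>x'\<in>X. box w0 x' \<and> eqv x' x" if "x \<in> X" for x
  proof -
    obtain x' where x': "x' \<in> X" "box w0 x'"
      "\<forall>s\<in>tup l. (s \<in> I \<and> box u s \<and> D s x) \<longleftrightarrow> (s \<in> I \<and> box u s \<and> D s x')" using w0(2) \<open>x \<in> X\<close> by auto
    have "eqv x' x" unfolding eqv_def
    proof (intro ballI impI)
      fix s assume "s \<in> I" "box u s"
      then show "D s x' \<longleftrightarrow> D s x" using bspec[OF x'(3), of s] len by simp
    qed
    then show ?thesis using x' by auto
  qed
  \<comment> \<open>Each member is replaced by the representatives of its points. The new sets lie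
    in one box and stay filtered, but need not be closed.\<close>
  define D1' where "D1' r x \<longleftrightarrow> x \<in> X \<and> box w0 x \<and> (\<exists>y\<in>X. D r y \<and> eqv x y)" for r x
  have DD1: "dfb (tup l \<times> tup n) (\<lambda>p. fst p @ snd p) (\<lambda>p. D1' (fst p) (snd p))"
    unfolding D1'_def
    by (intro dfi dtm_mem[OF X_S] dfb_box[where k = n] dfb_bex[OF X_S] dfb_pair[OF DD] dfb_pair[OF eqvD]) auto
  have ne1: "\<exists>x. length x = n \<and> D1' r x" if r: "r \<in> I" for r
  proof -
    obtain y where y: "length y = n" "D r y" using ne[OF r] by auto
    have yX: "y \<in> X" using DX[OF r y] .
    obtain x where x: "x \<in> X" "box w0 x" "eqv x y" using rep[OF yX] by auto
    then have "D1' r x" unfolding D1'_def using yX y by auto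
    then show ?thesis using S_length[OF X_S x(1)] by auto
  qed
  have sub1: "D1' s x" if "D1' r x" "\<forall>y. length y = n \<longrightarrow> D r y \<longrightarrow> D s y" for r s x
    using that S_length[OF X_S] unfolding D1'_def by blast
  \<comment> \<open>The same lemma with the roles exchanged: the parameters are now the indices, and
    every set already occurs for an index in a bounded box.\<close>
  have "\<exists>w. 0 \<le> w \<and> (\<forall>r\<in>I. \<exists>r'\<in>I. box w r' \<and> (\<forall>x\<in>tup n. D1' r x \<longleftrightarrow> D1' r' x))"
    by (rule pattern_bounded[OF nt I(1) DD1, where u = w0]) (simp add: D1'_def)
  then obtain w1 where w1: "0 \<le> w1"
    "\<forall>r\<in>I. \<exists>r'\<in>I. box w1 r' \<and> (\<forall>x\<in>tup n. D1' r x \<longleftrightarrow> D1' r' x)" by (elim exE conjE)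
  define J where "J = {r. length r = l \<and> (r \<in> I \<and> box w1 r)}"
  have "dfb (tup l) (\<lambda>x. x) (\<lambda>r. r \<in> I \<and> box w1 r)"
    by (intro dfi dtm_mem[OF I(1)] dfb_box[where k = l]) simp
  then have J: "J \<in> S l" unfolding J_def dfb_tup_iff .
  have JI: "J \<subseteq> I" unfolding J_def by auto
  have repJ: "\<exists>r'\<in>J. \<forall>x. length x = n \<longrightarrow> (D1' r x \<longleftrightarrow> D1' r' x)" if r: "r \<in> I" for r
  proof -
    obtain r' where r': "r' \<in> I" "box w1 r'" "\<forall>x\<in>tup n. D1' r x \<longleftrightarrow> D1' r' x" using w1(2) r by auto
    then have "r' \<in> J" using len unfolding J_def by simp
    then show ?thesis using r'(3) by auto
  qed
  have "\<exists>F x0. deftype n F \<and> x0 \<in> X \<and> (\<forall>s\<in>J. \<forall>\<^sub>F x in F. D1' s x) \<and> (\<forall>A. nbhd A x0 \<longrightarrow> (\<forall>\<^sub>F x in F. x \<in> A))"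
  proof (rule filter_limit[OF cc J _ DD1, where w = "max w0 w1"])
    show "J \<noteq> {}" using repJ I(2) by auto
    show "\<exists>x. length x = n \<and> D1' s x" if "s \<in> J" for s using ne1 that JI by auto
    show "x \<in> X" if "D1' s x" for s x using that unfolding D1'_def by simp
    show "\<exists>r\<in>J. \<forall>x. length x = n \<longrightarrow> D1' r x \<longrightarrow> D1' s x \<and> D1' t x" if st: "s \<in> J" "t \<in> J" for s t
    proof -
      have "s \<in> I" "t \<in> I" using st JI by auto
      then obtain r where r: "r \<in> I" "\<forall>x. length x = n \<longrightarrow> D r x \<longrightarrow> D s x \<and> D t x" using filt by meson
      obtain r' where r': "r' \<in> J" "\<forall>x. length x = n \<longrightarrow> (D1' r x \<longleftrightarrow> D1' r' x)" using repJ[OF r(1)] by auto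
      have "D1' s x \<and> D1' t x" if "length x = n" "D1' r' x" for x
        using sub1[of r x s] sub1[of r x t] r(2) r'(2) that by simp
      then show ?thesis using r'(1) by auto
    qed
    show "0 \<le> max w0 w1" using w0(1) by (simp add: le_max_iff_disj)
    show "tame_inf \<or> box (max w0 w1) s" if "s \<in> J" for s
      using that box_mono[of w1 s "max w0 w1"] unfolding J_def by simp
    show "tame_inf \<or> box (max w0 w1) x" if "D1' s x" for s x
      using that box_mono[of w0 x "max w0 w1"] unfolding D1'_def by simp
  qed
  then obtain F x0 where F: "deftype n F" "x0 \<in> X" "\<forall>s\<in>J. \<forall>\<^sub>F x in F. D1' s x"
    "\<forall>A. nbhd A x0 \<longrightarrow> (\<forall>\<^sub>F x in F. x \<in> A)" by (elim exE conjE)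
  have "D s x0" if s: "s \<in> I" "box u s" for s
  proof -
    \<comment> \<open>A representative meets the constraint \<open>s\<close> itself, because
      \<open>s\<close> has size at most \<open>u\<close> and is therefore respected by
      \<open>eqv\<close>; closedness passes the constraint on to \<open>x0\<close>.\<close>
    obtain r where r: "r \<in> J" "\<forall>x. length x = n \<longrightarrow> (D1' s x \<longleftrightarrow> D1' r x)" using repJ[OF s(1)] by auto
    have "\<forall>\<^sub>F x in F. x \<in> {x. length x = n \<and> D s x}"
      using F(3)[rule_format, OF r(1)] deftype_length[OF F(1)]
    proof eventually_elim
      case (elim x)
      then have "D1' s x" using r(2) by simp
      then obtain y where "D s y" "eqv x y" unfolding D1'_def by auto
      then show ?case using s elim(2) unfolding eqv_def by auto
    qed
    from limit_in_closed[OF F(1,2,4) closed[OF s(1)] DS[OF s(1)] this] show ?thesis by simp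
  qed
  then show ?thesis using F(2) by auto
qed

lemma curve_complete_imp_filtered:
  assumes cc: curve_complete and fam: "definable_filtered_closed S n T m I F"
  shows "(\<Inter>t\<in>I. F t) \<noteq> {}"
proof -
  define G where "G = {t @ x | t x. t \<in> I \<and> x \<in> F t}"
  have I: "I \<in> S m" "I \<noteq> {}" and G: "G \<in> S (m + n)" and Fn: "\<And>t x. t \<in> I \<Longrightarrow> x \<in> F t \<Longrightarrow> length x = n"
    and cl: "\<And>t. t \<in> I \<Longrightarrow> closedin T (F t)" and Fne: "\<And>t. t \<in> I \<Longrightarrow> F t \<noteq> {}"
    and filt: "\<And>s t. s \<in> I \<Longrightarrow> t \<in> I \<Longrightarrow> \<exists>r\<in>I. F r \<subseteq> F s \<inter> F t"
    using fam unfolding definable_filtered_closed_def definable_family_def G_def by auto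
  have len: "length t = m" if "t \<in> I" for t using S_length[OF I(1) that] .
  have GF: "t @ x \<in> G \<longleftrightarrow> x \<in> F t" if t: "t \<in> I" for t x
  proof
    assume "t @ x \<in> G"
    then obtain t' x' where *: "t @ x = t' @ x'" "t' \<in> I" "x' \<in> F t'" unfolding G_def by auto
    then have "t = t' \<and> x = x'" using len[OF t] len[OF *(2)] by simp
    then show "x \<in> F t" using * by simp
  qed (use t in \<open>auto simp: G_def\<close>)
  have set: "{x. length x = n \<and> t @ x \<in> G} = F t" if "t \<in> I" for t using GF[OF that] Fn[OF that] by auto
  have FX: "F t \<subseteq> X" if "t \<in> I" for t using closedin_subset[OF cl[OF that]] topspace_X by simp
  have FS: "F t \<in> S n" if "t \<in> I" for t
    unfolding set[OF that, symmetric] dfb_tup_iff[symmetric] by (intro dfi dtm_mem[OF G])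
  have DD: "dfb (tup m \<times> tup n) (\<lambda>p. fst p @ snd p) (\<lambda>p. fst p @ snd p \<in> G)" by (intro dfi dtm_mem[OF G])
  have ne: "\<exists>x. length x = n \<and> s @ x \<in> G" if "s \<in> I" for s using Fne[OF that] GF[OF that] Fn[OF that] by auto
  have DX: "x \<in> X" if "s \<in> I" "length x = n" "s @ x \<in> G" for s x using FX GF that by auto
  have filt': "\<exists>r\<in>I. \<forall>x. length x = n \<longrightarrow> r @ x \<in> G \<longrightarrow> s @ x \<in> G \<and> t @ x \<in> G" if st: "s \<in> I" "t \<in> I" for s t
  proof -
    obtain r where "r \<in> I" "F r \<subseteq> F s \<inter> F t" using filt[OF st] by auto
    then show ?thesis using GF st by (intro bexI[of _ r]) auto
  qed
  have "\<exists>x\<in>X. \<forall>s\<in>I. s @ x \<in> G"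
  proof (cases tame_inf)
    case True
    \<comment> \<open>Under \<open>tame_inf\<close> the upper bound in \<open>inK\<close> is void,
      so 0 serves as \<open>w\<close>.\<close>
    have "\<exists>H x0. deftype n H \<and> x0 \<in> X \<and> (\<forall>s\<in>I. \<forall>\<^sub>F x in H. s @ x \<in> G) \<and> (\<forall>A. nbhd A x0 \<longrightarrow> (\<forall>\<^sub>F x in H. x \<in> A))"
      by (rule filter_limit[OF cc I DD ne DX filt', where w = 0]) (use True in auto)
    then obtain H x0 where H: "deftype n H" "x0 \<in> X" "\<forall>s\<in>I. \<forall>\<^sub>F x in H. s @ x \<in> G"
      "\<forall>A. nbhd A x0 \<longrightarrow> (\<forall>\<^sub>F x in H. x \<in> A)" by (elim exE conjE)
    have "s @ x0 \<in> G" if s: "s \<in> I" for s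
    proof -
      have "\<forall>\<^sub>F x in H. x \<in> F s" using H(3)[rule_format, OF s] unfolding GF[OF s] .
      from limit_in_closed[OF H(1,2,4) cl[OF s] FS[OF s] this] show ?thesis by (simp add: GF[OF s])
    qed
    then show ?thesis using H(2) by auto
  next
    case nt: False
    define P where "P u x \<longleftrightarrow> x \<in> X \<and> (\<forall>s\<in>I. box u s \<longrightarrow> s @ x \<in> G)" for u x
    have PD: "dfb (UNIV \<times> tup n) (\<lambda>p. [fst p] @ snd p) (\<lambda>p. P (fst p) (snd p))"
      unfolding P_def
      by (intro dfi dtm_mem[OF X_S] dfb_ball[OF I(1)] dfb_box[where k = m] dtm_mem[OF G]) auto
    define \<xi> where "\<xi> u = choose_tup n (P u)" for u
    have \<xi>D: "dtm UNIV (\<lambda>x. [x]) \<xi>" unfolding \<xi>_def by (rule dtm_choose_tup[OF PD]) (intro dfi)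
    have \<xi>: "P u (\<xi> u)" for u
    proof -
      have cl': "closedin T {x. length x = n \<and> s @ x \<in> G}" if "s \<in> I" for s using cl[OF that] set[OF that] by simp
      have "\<exists>x\<in>X. \<forall>s\<in>I. box u s \<longrightarrow> s @ x \<in> G"
        by (rule bounded_constraints_point[OF cc nt I DD ne DX filt' cl'])
      then obtain x where x: "x \<in> X" "\<forall>s\<in>I. box u s \<longrightarrow> s @ x \<in> G" by auto
      then have "P u x" unfolding P_def by simp
      moreover have "dfb (tup n) (\<lambda>x. x) (P u)"
        by (rule dfb_lift_tup[OF PD, where g = "\<lambda>_. u"]) (intro dfi | simp)+
      ultimately show ?thesis unfolding \<xi>_def using choose_tup S_length[OF X_S x(1)] by blast
    qed
    have "\<exists>x\<in>X. \<forall>A. nbhd A x \<longrightarrow> (\<forall>v. wb False v \<longrightarrow> (\<exists>t. nb False v t \<and> \<xi> t \<in> A))"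
      by (rule curve_endf[OF cc _ \<xi>D, where u = 0]) (use \<xi> in \<open>auto simp: wb_def P_def \<xi>_def\<close>)
    then obtain x where x: "x \<in> X" "\<forall>A. nbhd A x \<longrightarrow> (\<forall>v. \<exists>t>v. \<xi> t \<in> A)"
      unfolding wb_def nb_def by auto
    \<comment> \<open>Once \<open>t\<close> exceeds the size of \<open>s\<close>, the point
      \<open>\<xi> t\<close> lies in the closed set \<open>F s\<close>, so a cluster point cannot
      lie outside it.\<close>
    have "s @ x \<in> G" if s: "s \<in> I" for s
    proof (rule ccontr)
      assume "s @ x \<notin> G"
      then have "nbhd (X - F s) x" using closed_nbhd[OF cl[OF s] FS[OF s] x(1)] GF[OF s] by simp
      obtain v where v: "box v s" using box_ex by blast
      obtain t where t: "v < t" "\<xi> t \<in> X - F s" using x(2) \<open>nbhd (X - F s) x\<close> by blast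
      have "box t s" using box_mono[OF v] t(1) by simp
      then have "s @ \<xi> t \<in> G" using \<xi>[of t] s unfolding P_def by simp
      then show False using t(2) GF[OF s] by simp
    qed
    then show ?thesis using x(1) by auto
  qed
  then obtain x where "\<forall>s\<in>I. s @ x \<in> G" by auto
  then have "\<forall>s\<in>I. x \<in> F s" using GF by simp
  then show ?thesis by auto
qed

end

section \<open>Nets, filtered families and curves\<close>

lemma finite_lower_bound:
  assumes "\<Omega> \<noteq> {}" "\<forall>u\<in>\<Omega>. \<forall>v\<in>\<Omega>. \<forall>w\<in>\<Omega>. le u v \<longrightarrow> le v w \<longrightarrow> le u w"
    "\<And>u v. u \<in> \<Omega> \<Longrightarrow> v \<in> \<Omega> \<Longrightarrow> \<exists>w\<in>\<Omega>. le w u \<and> le w v"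
  shows "finite E \<Longrightarrow> E \<subseteq> \<Omega> \<Longrightarrow> \<exists>w\<in>\<Omega>. \<forall>u\<in>E. le w u"
proof (induction E rule: finite_induct)
  case empty
  then show ?case using assms(1) by auto
next
  case (insert a E)
  then obtain v where v: "v \<in> \<Omega>" "\<forall>u\<in>E. le v u" by auto
  obtain w where w: "w \<in> \<Omega>" "le w a" "le w v" using assms(3)[of a v] insert.prems v(1) by auto
  have "le w u" if "u \<in> E" for u using assms(2) w v that insert.prems by blast
  then show ?case using w by auto
qed

context fo_structure
begin

lemma pair_S:
  assumes "dfb (tup k \<times> tup j) (\<lambda>p. fst p @ snd p) (\<lambda>p. P (fst p) (snd p))"
  shows "{t @ x | t x. length t = k \<and> length x = j \<and> P t x} \<in> S (k + j)"
proof -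
  have "dfb (tup (k + j)) (\<lambda>z. z) (\<lambda>z. P (take k (drop 0 z)) (take j (drop k z)))"
    by (intro dfb_pair[OF assms] dtm_slice[where j = "k + j"] dfi) auto
  then have "{z. length z = k + j \<and> P (take k z) (drop k z)} \<in> S (k + j)"
    unfolding dfb_tup_iff by (simp cong: conj_cong)
  moreover have "{z. length z = k + j \<and> P (take k z) (drop k z)} = {t @ x | t x. length t = k \<and> length x = j \<and> P t x}"
  proof (intro set_eqI iffI)
    fix z assume "z \<in> {z. length z = k + j \<and> P (take k z) (drop k z)}"
    then show "z \<in> {t @ x | t x. length t = k \<and> length x = j \<and> P t x}"
      by (intro CollectI exI[of _ "take k z"] exI[of _ "drop k z"]) simp
  qed auto
  ultimately show ?thesis by simp
qed

lemma dtm_take: "dtm U c \<tau> \<Longrightarrow> (\<And>e. e \<in> U \<Longrightarrow> length (\<tau> e) = k + j) \<Longrightarrow> dtm U c (\<lambda>e. take k (\<tau> e))"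
  using dtm_slice[of U c \<tau> "k + j" 0 k] by simp

lemma dtm_drop:
  assumes "dtm U c \<tau>" "\<And>e. e \<in> U \<Longrightarrow> length (\<tau> e) = k + j"
  shows "dtm U c (\<lambda>e. drop k (\<tau> e))"
proof (rule dtmI_graph)
  show "dfb (U \<times> tup j) (\<lambda>p. c (fst p) @ snd p) (\<lambda>p. snd p = take j (drop k (\<tau> (fst p))))"
    using dtm_dt[OF dtm_slice[OF assms, of k j], of j] assms(2) unfolding dt_def by auto
qed (use assms(2) in auto)

lemma rel_S:
  assumes A: "A \<in> S k" and D: "dfb (tup k \<times> tup k) (\<lambda>p. fst p @ snd p) (\<lambda>p. le (fst p) (snd p))"
  shows "{a @ b | a b. a \<in> A \<and> b \<in> A \<and> le a b} \<in> S (k + k)"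
proof -
  have "{a @ b | a b. length a = k \<and> length b = k \<and> a \<in> A \<and> b \<in> A \<and> le a b} \<in> S (k + k)"
    by (rule pair_S) (intro dfi dtm_mem[OF A] D)
  moreover have "length a = k \<and> length b = k \<and> a \<in> A \<and> b \<in> A \<and> le a b \<longleftrightarrow> a \<in> A \<and> b \<in> A \<and> le a b" for a b
    using S_length[OF A] by blast
  ultimately show ?thesis by simp
qed

lemma definable_mapI:
  assumes A: "A \<in> S k" and f: "dtm (tup k) (\<lambda>x. x) f" "\<And>a. length a = k \<Longrightarrow> length (f a) = j"
  shows "definable_map S k j A f"
proof -
  have "{a @ u | a u. length a = k \<and> length u = j \<and> a \<in> A \<and> u = f a} \<in> S (k + j)"
    by (rule pair_S) (intro dfi dtm_mem[OF A] dtm_app[OF f(1)], auto)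
  moreover have "{a @ u | a u. length a = k \<and> length u = j \<and> a \<in> A \<and> u = f a} = {a @ f a | a. a \<in> A}"
    by (intro Collect_cong ex_cong1) (use S_length[OF A] f(2) in auto)
  ultimately show ?thesis unfolding definable_map_def using A S_length[OF A] f(2) by simp
qed

end

context dclom_space
begin

definition filter_complete :: bool where
  "filter_complete \<longleftrightarrow> (\<forall>m I F. definable_filtered_closed S n T m I F \<longrightarrow> (\<Inter>t\<in>I. F t) \<noteq> {})"

definition net_complete :: bool where
  "net_complete \<longleftrightarrow> (\<forall>k \<Omega> le \<gamma>. definable_net S n X k \<Omega> le \<gamma> \<longrightarrow>
      (\<exists>k' \<Omega>' le' f x. definable_directed S k' \<Omega>' le' \<and> definable_map S k' k \<Omega>' f \<and>
         downward_cofinal \<Omega>' le' \<Omega> le f \<and> x \<in> X \<and> net_converges S n T \<Omega>' le' (\<gamma> \<circ> f) x))"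

text \<open>Passing to closures admits families that are not closed, such as the tails of curves and
  nets.\<close>

lemma filtered_cluster_point:
  assumes fc: filter_complete and I: "I \<in> S k" "I \<noteq> {}" and E: "E \<in> S (k + n)"
    and EX: "\<And>t x. t \<in> I \<Longrightarrow> t @ x \<in> E \<Longrightarrow> x \<in> X" and ne: "\<And>t. t \<in> I \<Longrightarrow> \<exists>x. t @ x \<in> E"
    and filt: "\<And>s t. s \<in> I \<Longrightarrow> t \<in> I \<Longrightarrow> \<exists>r\<in>I. \<forall>x. r @ x \<in> E \<longrightarrow> s @ x \<in> E \<and> t @ x \<in> E"
  shows "\<exists>x\<in>X. \<forall>t\<in>I. \<forall>A. nbhd A x \<longrightarrow> (\<exists>y\<in>A. t @ y \<in> E)"
proof -
  obtain m J B where J: "J \<in> S m" and B: "B \<in> S (m + n)" and op: "\<forall>t\<in>J. openin T {x. t @ x \<in> B}"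
    and base: "\<forall>U x. openin T U \<longrightarrow> x \<in> U \<longrightarrow> (\<exists>t\<in>J. t @ x \<in> B \<and> {x. t @ x \<in> B} \<subseteq> U)" by (rule base_ex)
  define F where "F t = T closure_of {x. t @ x \<in> E}" for t
  have sub: "{x. t @ x \<in> E} \<subseteq> F t" if "t \<in> I" for t
    unfolding F_def by (rule closure_of_subset) (use EX[OF that] topspace_X in auto)
  \<comment> \<open>Testing against basic open sets makes the closures definable uniformly in
    \<open>t\<close>.\<close>
  have F: "x \<in> F t \<longleftrightarrow> x \<in> X \<and> (\<forall>s\<in>J. s @ x \<in> B \<longrightarrow> (\<exists>y\<in>X. s @ y \<in> B \<and> t @ y \<in> E))" if t: "t \<in> I" for t x
  proof
    assume "x \<in> F t"
    then have x: "x \<in> X" "\<forall>U. x \<in> U \<and> openin T U \<longrightarrow> (\<exists>y. y \<in> {x. t @ x \<in> E} \<and> y \<in> U)"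
      unfolding F_def in_closure_of topspace_X by auto
    have "\<exists>y\<in>X. s @ y \<in> B \<and> t @ y \<in> E" if "s \<in> J" "s @ x \<in> B" for s
      using x(2)[rule_format, of "{x. s @ x \<in> B}"] op that EX[OF t] by auto
    then show "x \<in> X \<and> (\<forall>s\<in>J. s @ x \<in> B \<longrightarrow> (\<exists>y\<in>X. s @ y \<in> B \<and> t @ y \<in> E))" using x(1) by simp
  next
    assume x: "x \<in> X \<and> (\<forall>s\<in>J. s @ x \<in> B \<longrightarrow> (\<exists>y\<in>X. s @ y \<in> B \<and> t @ y \<in> E))"
    have "\<exists>y. y \<in> {x. t @ x \<in> E} \<and> y \<in> U" if U: "x \<in> U" "openin T U" for U
    proof -
      obtain s where "s \<in> J" "s @ x \<in> B" "{x. s @ x \<in> B} \<subseteq> U" using base U by meson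
      then show ?thesis using x by blast
    qed
    then show "x \<in> F t" unfolding F_def in_closure_of topspace_X using x by blast
  qed
  have lenX: "length x = n" if "x \<in> X" for x using S_length[OF X_S that] .
  have lenI: "length t = k" if "t \<in> I" for t using S_length[OF I(1) that] .
  have "{t @ x | t x. length t = k \<and> length x = n \<and> t \<in> I \<and> x \<in> X \<and>
      (\<forall>s\<in>J. s @ x \<in> B \<longrightarrow> (\<exists>y\<in>X. s @ y \<in> B \<and> t @ y \<in> E))} \<in> S (k + n)"
    by (rule pair_S) (intro dfi dtm_mem[OF I(1)] dtm_mem[OF X_S] dfb_ball[OF J] dfb_bex[OF X_S] dtm_mem[OF B] dtm_mem[OF E])
  moreover have "{t @ x | t x. length t = k \<and> length x = n \<and> t \<in> I \<and> x \<in> X \<and>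
      (\<forall>s\<in>J. s @ x \<in> B \<longrightarrow> (\<exists>y\<in>X. s @ y \<in> B \<and> t @ y \<in> E))} = {t @ x | t x. t \<in> I \<and> x \<in> F t}"
    using F lenX lenI by (intro Collect_cong ex_cong1) meson
  ultimately have "definable_family S k n I F"
    unfolding definable_family_def using I(1) F lenX by auto
  moreover have "\<exists>r\<in>I. F r \<subseteq> F s \<inter> F t" if st: "s \<in> I" "t \<in> I" for s t
  proof -
    obtain r where r: "r \<in> I" "\<forall>x. r @ x \<in> E \<longrightarrow> s @ x \<in> E \<and> t @ x \<in> E" using filt[OF st] by auto
    have "F r \<subseteq> F s" "F r \<subseteq> F t" unfolding F_def by (intro closure_of_mono; use r(2) in auto)+
    then show ?thesis using r(1) by auto
  qed
  moreover have "closedin T (F t)" for t unfolding F_def by (rule closedin_closure_of)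
  moreover have "F t \<noteq> {}" if "t \<in> I" for t using ne[OF that] sub[OF that] by auto
  ultimately have "definable_filtered_closed S n T k I F"
    unfolding definable_filtered_closed_def using I(2) by simp
  then have "(\<Inter>t\<in>I. F t) \<noteq> {}" using fc unfolding filter_complete_def by simp
  then obtain x where x: "\<And>t. t \<in> I \<Longrightarrow> x \<in> F t" by auto
  have "x \<in> X" using x F I(2) by auto
  moreover have "\<exists>y\<in>A. t @ y \<in> E" if t: "t \<in> I" and A: "nbhd A x" for t A
  proof -
    obtain U where "openin T U" "x \<in> U" "U \<subseteq> A" using A unfolding nbhd_def definable_nbhd_def by auto
    then show ?thesis using x[OF t] unfolding F_def in_closure_of by blast
  qed
  ultimately show ?thesis by auto
qed

text \<open>\<open>R\<close> stands for \<open><\<close> or for \<open>>\<close>, so that the right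
  and the left tails of a curve are treated together.\<close>

lemma filter_complete_imp_curve_cluster:
  fixes R :: "'a \<Rightarrow> 'a \<Rightarrow> bool"
  assumes fc: filter_complete and \<gamma>: "definable_curve S n X a b \<gamma>"
    and RD: "dfb (tup 1 \<times> tup 1) (\<lambda>p. fst p @ snd p) (\<lambda>p. R (fst p ! 0) (snd p ! 0))"
    and ne: "\<And>t. t \<in> oint a b \<Longrightarrow> \<exists>u\<in>oint a b. R t u"
    and dir: "\<And>s t. s \<in> oint a b \<Longrightarrow> t \<in> oint a b \<Longrightarrow> \<exists>r\<in>oint a b. \<forall>u. R r u \<longrightarrow> R s u \<and> R t u"
  shows "\<exists>x\<in>X. \<forall>t\<in>oint a b. \<forall>A. nbhd A x \<longrightarrow> \<gamma> ` {u \<in> oint a b. R t u} \<inter> A \<noteq> {}"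
proof -
  define G where "G = {[t] @ \<gamma> t | t. t \<in> oint a b}"
  define I where "I = {[t] | t. t \<in> oint a b}"
  have G: "G \<in> S (1 + n)" and \<gamma>X: "\<And>t. t \<in> oint a b \<Longrightarrow> \<gamma> t \<in> X" and one: "oint a b \<noteq> {}"
    using \<gamma> unfolding definable_curve_def G_def by auto
  have Gm: "[t] @ y \<in> G \<longleftrightarrow> t \<in> oint a b \<and> y = \<gamma> t" for t y unfolding G_def by auto
  have "dfb (tup 1) (\<lambda>x. x) (\<lambda>x. \<exists>y\<in>X. x @ y \<in> G)" by (intro dfi dfb_bex[OF X_S] dtm_mem[OF G])
  moreover have "{x. length x = 1 \<and> (\<exists>y\<in>X. x @ y \<in> G)} = I"
    unfolding I_def using Gm \<gamma>X by (auto simp: length_Suc_conv)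
  ultimately have I: "I \<in> S 1" unfolding dfb_tup_iff by simp
  define E where "E = {t @ y | t y. length t = 1 \<and> length y = n \<and> t \<in> I \<and> (\<exists>u\<in>I. u @ y \<in> G \<and> R (t ! 0) (u ! 0))}"
  have E: "E \<in> S (1 + n)" unfolding E_def
    by (rule pair_S) (intro dfi dtm_mem[OF I] dfb_bex[OF I] dtm_mem[OF G] dfb_pair[OF RD], auto)
  have Em: "[t] @ y \<in> E \<longleftrightarrow> t \<in> oint a b \<and> (\<exists>u\<in>oint a b. R t u \<and> y = \<gamma> u)" for t y
  proof
    assume "[t] @ y \<in> E"
    then obtain t' y' where *: "[t] @ y = t' @ y'" "length t' = 1" "t' \<in> I" "\<exists>u\<in>I. u @ y' \<in> G \<and> R (t' ! 0) (u ! 0)"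
      unfolding E_def by (elim CollectE exE conjE)
    then have "t' = [t] \<and> y' = y" using append_eq_append_conv[of "[t]" t' y y'] by simp
    then have "[t] \<in> I" "\<exists>u\<in>I. u @ y \<in> G \<and> R t (u ! 0)" using *(3,4) by simp_all
    then show "t \<in> oint a b \<and> (\<exists>u\<in>oint a b. R t u \<and> y = \<gamma> u)"
      unfolding I_def using Gm by fastforce
  next
    assume "t \<in> oint a b \<and> (\<exists>u\<in>oint a b. R t u \<and> y = \<gamma> u)"
    then obtain u where u: "t \<in> oint a b" "u \<in> oint a b" "R t u" "y = \<gamma> u" by auto
    then have "[t] \<in> I" "[u] \<in> I" "[u] @ y \<in> G" unfolding I_def Gm by auto
    then have "\<exists>u\<in>I. u @ y \<in> G \<and> R ([t] ! 0) (u ! 0)" using u(3) by (intro bexI[of _ "[u]"]) auto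
    then show "[t] @ y \<in> E" unfolding E_def
      using \<open>[t] \<in> I\<close> S_length[OF X_S \<gamma>X[OF u(2)]] u(4)
      by (intro CollectI exI[of _ "[t]"] exI[of _ y] conjI) auto
  qed
  have "\<exists>x\<in>X. \<forall>t\<in>I. \<forall>A. nbhd A x \<longrightarrow> (\<exists>y\<in>A. t @ y \<in> E)"
  proof (rule filtered_cluster_point[OF fc I _ E])
    show "I \<noteq> {}" using one unfolding I_def by auto
    show "x \<in> X" if "t \<in> I" "t @ x \<in> E" for t x using that Em \<gamma>X unfolding I_def by auto
    show "\<exists>x. t @ x \<in> E" if t: "t \<in> I" for t
    proof -
      obtain t' where t': "t = [t']" "t' \<in> oint a b" using t unfolding I_def by auto
      obtain u where "u \<in> oint a b" "R t' u" using ne[OF t'(2)] by auto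
      then have "[t'] @ \<gamma> u \<in> E" using Em t'(2) by blast
      then show ?thesis using t'(1) by blast
    qed
    show "\<exists>r\<in>I. \<forall>x. r @ x \<in> E \<longrightarrow> s @ x \<in> E \<and> t @ x \<in> E" if st: "s \<in> I" "t \<in> I" for s t
    proof -
      obtain s' t' where st': "s = [s']" "t = [t']" "s' \<in> oint a b" "t' \<in> oint a b" using st unfolding I_def by auto
      obtain r where r: "r \<in> oint a b" "\<forall>u. R r u \<longrightarrow> R s' u \<and> R t' u" using dir[OF st'(3,4)] by auto
      have "\<forall>x. [r] @ x \<in> E \<longrightarrow> [s'] @ x \<in> E \<and> [t'] @ x \<in> E" unfolding Em using r st' by auto
      then show ?thesis using r(1) st' unfolding I_def by auto
    qed
  qed
  then obtain x where x0: "x \<in> X" "\<forall>t\<in>I. \<forall>A. nbhd A x \<longrightarrow> (\<exists>y\<in>A. t @ y \<in> E)" by (elim bexE)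
  have x: "\<exists>y\<in>A. [t] @ y \<in> E" if "t \<in> oint a b" "nbhd A x" for t A
    by (rule x0(2)[rule_format]) (use that in \<open>auto simp: I_def\<close>)
  show ?thesis
  proof (rule bexI[OF _ x0(1)], intro ballI allI impI)
    fix t A assume "t \<in> oint a b" "nbhd A x"
    then obtain y where "y \<in> A" "[t] @ y \<in> E" using x by blast
    then show "\<gamma> ` {u \<in> oint a b. R t u} \<inter> A \<noteq> {}" unfolding Em by auto
  qed
qed

lemma filter_complete_imp_curve_complete:
  assumes fc: filter_complete
  shows curve_complete
  unfolding curve_complete_def
proof (intro allI impI conjI)
  fix a b \<gamma> assume \<gamma>: "definable_curve S n X a b \<gamma>"
  have 1: "dfb (tup 1 \<times> tup 1) (\<lambda>p. fst p @ snd p) (\<lambda>p. fst p ! 0 < (snd p ! 0 :: 'a))"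
    by (intro dfi dts_nth[where j = 1]) auto
  have 2: "dfb (tup 1 \<times> tup 1) (\<lambda>p. fst p @ snd p) (\<lambda>p. fst p ! 0 > (snd p ! 0 :: 'a))"
    by (intro dfi dts_nth[where j = 1]) auto
  have up: "\<exists>u\<in>oint a b. t < u" if t: "t \<in> oint a b" for t
  proof (cases b)
    case None
    obtain u where "t < u" using gt_ex by blast
    then show ?thesis using t None unfolding oint_def by (intro bexI[of _ u]) (auto split: option.splits)
  next
    case (Some b')
    then obtain u where "t < u" "u < b'" using t dense unfolding oint_def by auto
    then show ?thesis using t Some unfolding oint_def by (intro bexI[of _ u]) (auto split: option.splits)
  qed
  have dn: "\<exists>u\<in>oint a b. u < t" if t: "t \<in> oint a b" for t
  proof (cases a)
    case None
    obtain u where "u < t" using lt_ex by blast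
    then show ?thesis using t None unfolding oint_def by (intro bexI[of _ u]) (auto split: option.splits)
  next
    case (Some a')
    then obtain u where "a' < u" "u < t" using t dense unfolding oint_def by auto
    then show ?thesis using t Some unfolding oint_def by (intro bexI[of _ u]) (auto split: option.splits)
  qed
  have "\<exists>x\<in>X. \<forall>t\<in>oint a b. \<forall>A. nbhd A x \<longrightarrow> \<gamma> ` {u \<in> oint a b. t < u} \<inter> A \<noteq> {}"
  proof (rule filter_complete_imp_curve_cluster[OF fc \<gamma> 1 up])
    show "\<exists>r\<in>oint a b. \<forall>u. r < u \<longrightarrow> s < u \<and> t < u" if "s \<in> oint a b" "t \<in> oint a b" for s t
      by (rule bexI[of _ "max s t"]) (use that in \<open>auto simp: max_def\<close>)
  qed
  moreover have "{u \<in> oint a b. t < u} = oint (Some t) b" if "t \<in> oint a b" for t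
    using that unfolding oint_def by (auto split: option.splits)
  ultimately show "conv_right S n T a b \<gamma> \<noteq> {}"
    unfolding conv_right_def topspace_X nbhd_def by (auto simp del: image_is_empty)
  have "\<exists>x\<in>X. \<forall>t\<in>oint a b. \<forall>A. nbhd A x \<longrightarrow> \<gamma> ` {u \<in> oint a b. t > u} \<inter> A \<noteq> {}"
  proof (rule filter_complete_imp_curve_cluster[OF fc \<gamma> 2 dn])
    show "\<exists>r\<in>oint a b. \<forall>u. r > u \<longrightarrow> s > u \<and> t > u" if "s \<in> oint a b" "t \<in> oint a b" for s t
      by (rule bexI[of _ "min s t"]) (use that in \<open>auto simp: min_def\<close>)
  qed
  moreover have "{u \<in> oint a b. t > u} = oint a (Some t)" if "t \<in> oint a b" for t
    using that unfolding oint_def by (auto split: option.splits)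
  ultimately show "conv_left S n T a b \<gamma> \<noteq> {}"
    unfolding conv_left_def topspace_X nbhd_def by (auto simp del: image_is_empty)
qed

lemma filter_complete_imp_net_complete:
  assumes fc: filter_complete
  shows net_complete
  unfolding net_complete_def
proof (intro allI impI)
  fix k \<Omega> le \<gamma> assume net: "definable_net S n X k \<Omega> le \<gamma>"
  define G where "G = {u @ \<gamma> u | u. u \<in> \<Omega>}"
  define L where "L = {u @ v | u v. u \<in> \<Omega> \<and> v \<in> \<Omega> \<and> le u v}"
  have dd: "definable_directed S k \<Omega> le" and dm: "definable_map S k n \<Omega> \<gamma>" and \<gamma>X': "\<gamma> ` \<Omega> \<subseteq> X"
    using net unfolding definable_net_def by simp_all
  note q = dd[unfolded definable_directed_def, folded L_def]
  note \<Omega> = q[THEN conjunct1] q[THEN conjunct2, THEN conjunct1]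
  note L = q[THEN conjunct2, THEN conjunct2, THEN conjunct1]
  note refl = q[THEN conjunct2, THEN conjunct2, THEN conjunct2, THEN conjunct1]
  note trans = q[THEN conjunct2, THEN conjunct2, THEN conjunct2, THEN conjunct2, THEN conjunct1]
  note dir = q[THEN conjunct2, THEN conjunct2, THEN conjunct2, THEN conjunct2, THEN conjunct2]
  have G: "G \<in> S (k + n)" using dm unfolding definable_map_def G_def by simp
  have \<gamma>X: "\<gamma> u \<in> X" if "u \<in> \<Omega>" for u using \<gamma>X' that by auto
  have len: "length u = k" if "u \<in> \<Omega>" for u using S_length[OF \<Omega>(1) that] .
  have Lm: "u @ v \<in> L \<longleftrightarrow> le u v" if "u \<in> \<Omega>" "v \<in> \<Omega>" for u v
    unfolding L_def using that len by auto
  have Gm: "u @ y \<in> G \<longleftrightarrow> y = \<gamma> u" if "u \<in> \<Omega>" for u y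
    unfolding G_def using that len by auto
  have pair: "\<exists>w\<in>\<Omega>. le w u \<and> le w v" if "u \<in> \<Omega>" "v \<in> \<Omega>" for u v
    using dir[rule_format, of "{u, v}"] that by auto
  \<comment> \<open>The fibres are the tails of the net, filtered because the index set is directed.
    The point obtained from them is a cluster point of the net.\<close>
  define E where "E = {u @ y | u y. length u = k \<and> length y = n \<and> u \<in> \<Omega> \<and> (\<exists>v\<in>\<Omega>. v @ y \<in> G \<and> v @ u \<in> L)}"
  have E: "E \<in> S (k + n)" unfolding E_def
    by (rule pair_S) (intro dfi dtm_mem[OF \<Omega>(1)] dfb_bex[OF \<Omega>(1)] dtm_mem[OF G] dtm_mem[OF L])
  have Em: "u @ y \<in> E \<longleftrightarrow> (\<exists>v\<in>\<Omega>. le v u \<and> y = \<gamma> v)" if u: "u \<in> \<Omega>" for u y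
  proof
    assume "u @ y \<in> E"
    then obtain u' y' where "u @ y = u' @ y'" "u' \<in> \<Omega>" "\<exists>v\<in>\<Omega>. v @ y' \<in> G \<and> v @ u' \<in> L" unfolding E_def by auto
    moreover have "u = u' \<and> y = y'" using calculation len[OF u] len[of u'] by simp
    ultimately show "\<exists>v\<in>\<Omega>. le v u \<and> y = \<gamma> v" using Gm Lm by auto
  next
    assume "\<exists>v\<in>\<Omega>. le v u \<and> y = \<gamma> v"
    then obtain v where v: "v \<in> \<Omega>" "le v u" "y = \<gamma> v" by auto
    then have "\<exists>v\<in>\<Omega>. v @ y \<in> G \<and> v @ u \<in> L" using Gm Lm u by (intro bexI[of _ v]) auto
    then show "u @ y \<in> E" unfolding E_def using u len[OF u] S_length[OF X_S \<gamma>X[OF v(1)]] v(3) by blast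
  qed
  have "\<exists>x\<in>X. \<forall>u\<in>\<Omega>. \<forall>A. nbhd A x \<longrightarrow> (\<exists>y\<in>A. u @ y \<in> E)"
  proof (rule filtered_cluster_point[OF fc \<Omega> E])
    show "x \<in> X" if "t \<in> \<Omega>" "t @ x \<in> E" for t x using that Em \<gamma>X by auto
    show "\<exists>x. t @ x \<in> E" if "t \<in> \<Omega>" for t
      by (rule exI[of _ "\<gamma> t"], subst Em[OF that]) (use that refl in auto)
    show "\<exists>r\<in>\<Omega>. \<forall>x. r @ x \<in> E \<longrightarrow> s @ x \<in> E \<and> t @ x \<in> E" if st: "s \<in> \<Omega>" "t \<in> \<Omega>" for s t
    proof -
      obtain w where w: "w \<in> \<Omega>" "le w s" "le w t" using pair[OF st] by auto
      have "s @ x \<in> E \<and> t @ x \<in> E" if "w @ x \<in> E" for x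
      proof -
        obtain v where v: "v \<in> \<Omega>" "le v w" "x = \<gamma> v" using \<open>w @ x \<in> E\<close> Em[OF w(1)] by auto
        then have "le v s" "le v t" using trans w st by blast+
        then show ?thesis using v Em st by auto
      qed
      then show ?thesis using w(1) by auto
    qed
  qed
  then obtain x where x: "x \<in> X" "\<And>u A. u \<in> \<Omega> \<Longrightarrow> nbhd A x \<Longrightarrow> \<exists>y\<in>A. u @ y \<in> E" by auto
  obtain m J B where J: "J \<in> S m" and B: "B \<in> S (m + n)" and op: "\<forall>t\<in>J. openin T {x. t @ x \<in> B}"
    and base: "\<forall>U x. openin T U \<longrightarrow> x \<in> U \<longrightarrow> (\<exists>t\<in>J. t @ x \<in> B \<and> {x. t @ x \<in> B} \<subseteq> U)" by (rule base_ex)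
  have below: "\<exists>v\<in>\<Omega>. le v u \<and> t @ \<gamma> v \<in> B" if "u \<in> \<Omega>" "t \<in> J" "t @ x \<in> B" for u t
    using x(2)[OF that(1) nbhd_base[OF J B op that(2,3)]] Em[OF that(1)] by auto
  have BX: "y \<in> X" if "t \<in> J" "t @ y \<in> B" for t y using openin_subset[OF op[rule_format, OF that(1)]] that(2) topspace_X by auto
  have lenJ: "length t = m" if "t \<in> J" for t using S_length[OF J that] .
  \<comment> \<open>The usual subnet through a cluster point: pairs of an index \<open>u\<close> and
    a basic neighbourhood of \<open>x\<close> that contains \<open>\<gamma> u\<close>.
    Neighbourhoods are named by their index \<open>t\<close> in the base, which makes the set
    definable, and compared by inclusion.\<close>
  define \<Omega>' where "\<Omega>' = {u @ t | u t. length u = k \<and> length t = m \<and> u \<in> \<Omega> \<and> t \<in> J \<and> t @ x \<in> B \<and> (\<exists>y\<in>X. u @ y \<in> G \<and> t @ y \<in> B)}"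
  define le' where "le' a b \<longleftrightarrow> take k a @ take k b \<in> L \<and> (\<forall>y\<in>X. drop k a @ y \<in> B \<longrightarrow> drop k b @ y \<in> B)" for a b
  have \<Omega>': "\<Omega>' \<in> S (k + m)" unfolding \<Omega>'_def
    by (rule pair_S) (intro dfi dtm_mem[OF \<Omega>(1)] dtm_mem[OF J] dtm_mem[OF B] dfb_bex[OF X_S] dtm_mem[OF G])
  have \<Omega>'m: "u @ t \<in> \<Omega>'" if "u \<in> \<Omega>" "t \<in> J" "t @ x \<in> B" "t @ \<gamma> u \<in> B" for u t
  proof -
    have "\<exists>y\<in>X. u @ y \<in> G \<and> t @ y \<in> B" using that Gm[OF that(1)] \<gamma>X[OF that(1)] by (intro bexI[of _ "\<gamma> u"]) auto
    then show ?thesis unfolding \<Omega>'_def using that len[OF that(1)] lenJ[OF that(2)] by blast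
  qed
  have \<Omega>'e: "\<exists>u t. a = u @ t \<and> u \<in> \<Omega> \<and> t \<in> J \<and> t @ x \<in> B \<and> t @ \<gamma> u \<in> B \<and> length u = k" if "a \<in> \<Omega>'" for a
  proof -
    from \<open>a \<in> \<Omega>'\<close> obtain u t y where ut: "a = u @ t" "length u = k" "u \<in> \<Omega>" "t \<in> J" "t @ x \<in> B"
      "u @ y \<in> G" "t @ y \<in> B"
      unfolding \<Omega>'_def by (elim CollectE exE conjE bexE)
    have "y = \<gamma> u" using ut(6) Gm[OF ut(3)] by simp
    then show ?thesis using ut by (intro exI[of _ u] exI[of _ t]) simp
  qed
  have le'm: "le' (u @ s) (v @ t) \<longleftrightarrow> le u v \<and> {y. s @ y \<in> B} \<subseteq> {y. t @ y \<in> B}"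
    if "u \<in> \<Omega>" "v \<in> \<Omega>" "s \<in> J" "t \<in> J" for u v s t
  proof -
    have "le' (u @ s) (v @ t) \<longleftrightarrow> le u v \<and> (\<forall>y\<in>X. s @ y \<in> B \<longrightarrow> t @ y \<in> B)"
      unfolding le'_def using len[OF that(1)] len[OF that(2)] Lm[OF that(1,2)] by simp
    also have "(\<forall>y\<in>X. s @ y \<in> B \<longrightarrow> t @ y \<in> B) \<longleftrightarrow> {y. s @ y \<in> B} \<subseteq> {y. t @ y \<in> B}"
      using BX[OF that(3)] by auto
    finally show ?thesis .
  qed
  have xU: "\<exists>t\<in>J. t @ x \<in> B \<and> {x. t @ x \<in> B} \<subseteq> U" if "openin T U" "x \<in> U" for U using base that by blast
  obtain t0 where t0: "t0 \<in> J" "t0 @ x \<in> B" using xU[OF openin_topspace] x(1) topspace_X by auto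
  have dir': "definable_directed S (k + m) \<Omega>' le'"
  proof -
    have "\<Omega>' \<noteq> {}"
    proof -
      obtain u where "u \<in> \<Omega>" using \<Omega>(2) by auto
      from below[OF this t0] show ?thesis using \<Omega>'m t0 by blast
    qed
    moreover have "{a @ b | a b. a \<in> \<Omega>' \<and> b \<in> \<Omega>' \<and> le' a b} \<in> S (k + m + (k + m))"
      unfolding le'_def
      by (rule rel_S[OF \<Omega>']) (intro dfi dtm_mem[OF L] dfb_ball[OF X_S] dtm_mem[OF B]
            dtm_take[where j = m] dtm_drop[where j = m], auto)
    moreover have "\<forall>a\<in>\<Omega>'. le' a a"
    proof
      fix a assume "a \<in> \<Omega>'"
      from \<Omega>'e[OF this] show "le' a a" using refl le'm by auto
    qed
    moreover have tr: "\<forall>a\<in>\<Omega>'. \<forall>b\<in>\<Omega>'. \<forall>c\<in>\<Omega>'. le' a b \<longrightarrow> le' b c \<longrightarrow> le' a c"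
    proof (intro ballI impI)
      fix a b c assume *: "a \<in> \<Omega>'" "b \<in> \<Omega>'" "c \<in> \<Omega>'" "le' a b" "le' b c"
      obtain u1 t1 where 1: "a = u1 @ t1" "u1 \<in> \<Omega>" "t1 \<in> J" using \<Omega>'e[OF *(1)] by auto
      obtain u2 t2 where 2: "b = u2 @ t2" "u2 \<in> \<Omega>" "t2 \<in> J" using \<Omega>'e[OF *(2)] by auto
      obtain u3 t3 where 3: "c = u3 @ t3" "u3 \<in> \<Omega>" "t3 \<in> J" using \<Omega>'e[OF *(3)] by auto
      have "le u1 u2" "le u2 u3" "{y. t1 @ y \<in> B} \<subseteq> {y. t2 @ y \<in> B}" "{y. t2 @ y \<in> B} \<subseteq> {y. t3 @ y \<in> B}"
        using *(4,5) 1 2 3 le'm by auto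
      moreover have "le u1 u3" using trans[rule_format, OF 1(2) 2(2) 3(2)] calculation by simp
      ultimately show "le' a c" using 1 3 le'm by auto
    qed
    moreover have "\<exists>w\<in>\<Omega>'. le' w a \<and> le' w b" if ab: "a \<in> \<Omega>'" "b \<in> \<Omega>'" for a b
    proof -
      obtain u1 t1 where 1: "a = u1 @ t1" "u1 \<in> \<Omega>" "t1 \<in> J" "t1 @ x \<in> B" using \<Omega>'e[OF ab(1)] by auto
      obtain u2 t2 where 2: "b = u2 @ t2" "u2 \<in> \<Omega>" "t2 \<in> J" "t2 @ x \<in> B" using \<Omega>'e[OF ab(2)] by auto
      have "openin T ({x. t1 @ x \<in> B} \<inter> {x. t2 @ x \<in> B})" using op 1 2 by (intro openin_Int) auto
      from xU[OF this] obtain t where t: "t \<in> J" "t @ x \<in> B" "{x. t @ x \<in> B} \<subseteq> {x. t1 @ x \<in> B} \<inter> {x. t2 @ x \<in> B}"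
        using 1 2 by auto
      obtain u where u: "u \<in> \<Omega>" "le u u1" "le u u2" using pair[OF 1(2) 2(2)] by auto
      \<comment> \<open>The value of the net at the lower bound \<open>u\<close> may lie outside the
        smaller neighbourhood; as \<open>x\<close> is a cluster point, some index below
        \<open>u\<close> has its value inside.\<close>
      obtain v where v: "v \<in> \<Omega>" "le v u" "t @ \<gamma> v \<in> B" using below[OF u(1) t(1,2)] by auto
      have "le v u1" "le v u2"
        using trans[rule_format, OF v(1) u(1) 1(2) v(2) u(2)] trans[rule_format, OF v(1) u(1) 2(2) v(2) u(3)] .
      then have "le' (v @ t) a \<and> le' (v @ t) b" using 1 2 v t le'm by auto
      then show ?thesis using \<Omega>'m[OF v(1) t(1,2) v(3)] by blast
    qed
    ultimately show ?thesis unfolding definable_directed_def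
      by (intro conjI \<Omega>' allI impI finite_lower_bound[of \<Omega>' le']; assumption?)
  qed
  have map': "definable_map S (k + m) k \<Omega>' (take k)"
    by (rule definable_mapI[OF \<Omega>']) (intro dtm_take[where j = m] dfi, auto)
  have tk: "take k a \<in> \<Omega>" if "a \<in> \<Omega>'" for a using \<Omega>'e[OF that] by auto
  have cof: "downward_cofinal \<Omega>' le' \<Omega> le (take k)"
    unfolding downward_cofinal_def
  proof (intro conjI ballI)
    show "take k ` \<Omega>' \<subseteq> \<Omega>" using tk by auto
    fix u assume u: "u \<in> \<Omega>"
    obtain v where v: "v \<in> \<Omega>" "le v u" "t0 @ \<gamma> v \<in> B" using below[OF u t0] by auto
    have "le (take k w) u" if w: "w \<in> \<Omega>'" "le' w (v @ t0)" for w
    proof -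
      have "le (take k w) v" using w(2) Lm[OF tk[OF w(1)] v(1)] len[OF v(1)] unfolding le'_def by simp
      then show ?thesis using trans[rule_format, OF tk[OF w(1)] v(1) u] v(2) by simp
    qed
    then show "\<exists>v\<in>\<Omega>'. \<forall>w\<in>\<Omega>'. le' w v \<longrightarrow> le (take k w) u" using \<Omega>'m[OF v(1) t0 v(3)] by auto
  qed
  have conv: "net_converges S n T \<Omega>' le' (\<gamma> \<circ> take k) x"
    unfolding net_converges_def
  proof (intro allI impI)
    fix A assume "definable_nbhd S n T A x"
    then obtain U where U: "openin T U" "x \<in> U" "U \<subseteq> A" unfolding definable_nbhd_def by auto
    obtain t where t: "t \<in> J" "t @ x \<in> B" "{x. t @ x \<in> B} \<subseteq> U" using xU[OF U(1,2)] by auto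
    obtain u where "u \<in> \<Omega>" using \<Omega>(2) by auto
    from below[OF this t(1,2)] obtain v where v: "v \<in> \<Omega>" "t @ \<gamma> v \<in> B" by auto
    have "\<gamma> (take k a) \<in> A" if a: "a \<in> \<Omega>'" "le' a (v @ t)" for a
    proof -
      obtain w s where ws: "a = w @ s" "w \<in> \<Omega>" "s \<in> J" "s @ \<gamma> w \<in> B" "length w = k" using \<Omega>'e[OF a(1)] by auto
      then have "{y. s @ y \<in> B} \<subseteq> {y. t @ y \<in> B}" using a(2) le'm v(1) t(1) by auto
      then show ?thesis using ws t(3) U(3) by auto
    qed
    then show "\<exists>uA\<in>\<Omega>'. \<forall>u\<in>\<Omega>'. le' u uA \<longrightarrow> (\<gamma> \<circ> take k) u \<in> A"
      using \<Omega>'m[OF v(1) t(1,2) v(2)] by auto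
  qed
  show "\<exists>k' \<Omega>' le' f x. definable_directed S k' \<Omega>' le' \<and> definable_map S k' k \<Omega>' f \<and>
         downward_cofinal \<Omega>' le' \<Omega> le f \<and> x \<in> X \<and> net_converges S n T \<Omega>' le' (\<gamma> \<circ> f) x"
    by (rule exI[of _ "k + m"], rule exI[of _ \<Omega>'], rule exI[of _ le'], rule exI[of _ "take k"], rule exI[of _ x])
      (intro conjI dir' map' cof conv x(1))
qed

text \<open>The net runs through the pairs of an index and a point of its member, ordered by
  inclusion of members, and returns the point. Along a subnet the values are eventually in each
  member, so closedness puts the limit there.\<close>

lemma net_complete_imp_filter_complete:
  assumes nc: net_complete
  shows filter_complete
  unfolding filter_complete_def
proof (intro allI impI)
  fix m I F assume fam: "definable_filtered_closed S n T m I F"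
  define G where "G = {t @ x | t x. t \<in> I \<and> x \<in> F t}"
  have I: "I \<in> S m" "I \<noteq> {}" and G: "G \<in> S (m + n)"
    and cl: "\<And>t. t \<in> I \<Longrightarrow> closedin T (F t)" and Fne: "\<And>t. t \<in> I \<Longrightarrow> F t \<noteq> {}"
    and filt: "\<And>s t. s \<in> I \<Longrightarrow> t \<in> I \<Longrightarrow> \<exists>r\<in>I. F r \<subseteq> F s \<inter> F t"
    using fam unfolding definable_filtered_closed_def definable_family_def G_def by auto
  have len: "length t = m" if "t \<in> I" for t using S_length[OF I(1) that] .
  have GF: "t @ x \<in> G \<longleftrightarrow> x \<in> F t" if t: "t \<in> I" for t x
    unfolding G_def using t len by auto
  have FX: "F t \<subseteq> X" if "t \<in> I" for t using closedin_subset[OF cl[OF that]] topspace_X by simp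
  have FS: "F t \<in> S n" if "t \<in> I" for t using S_slice[OF G len[OF that]] GF[OF that] by simp
  have Ge: "take m a \<in> I" "drop m a \<in> F (take m a)" if "a \<in> G" for a using that len unfolding G_def by auto
  define le where "le a b \<longleftrightarrow> (\<forall>y\<in>X. take m a @ y \<in> G \<longrightarrow> take m b @ y \<in> G)" for a b
  have le: "le a b \<longleftrightarrow> F (take m a) \<subseteq> F (take m b)" if "a \<in> G" "b \<in> G" for a b
    unfolding le_def using GF[OF Ge(1)[OF that(1)]] GF[OF Ge(1)[OF that(2)]] FX[OF Ge(1)[OF that(1)]] by auto
  have dir: "definable_directed S (m + n) G le"
  proof -
    have ne: "G \<noteq> {}" using I(2) Fne unfolding G_def by blast
    have LS: "{a @ b | a b. a \<in> G \<and> b \<in> G \<and> le a b} \<in> S (m + n + (m + n))"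
      unfolding le_def
      by (rule rel_S[OF G]) (intro dfi dtm_mem[OF G] dfb_ball[OF X_S] dtm_take[where j = n], auto)
    have tr: "\<forall>a\<in>G. \<forall>b\<in>G. \<forall>c\<in>G. le a b \<longrightarrow> le b c \<longrightarrow> le a c" using le by auto
    have "\<exists>w\<in>G. le w a \<and> le w b" if ab: "a \<in> G" "b \<in> G" for a b
    proof -
      obtain r where r: "r \<in> I" "F r \<subseteq> F (take m a) \<inter> F (take m b)" using filt Ge(1) ab by meson
      obtain x where "x \<in> F r" using Fne[OF r(1)] by auto
      then have "r @ x \<in> G" using GF[OF r(1)] by simp
      moreover have "take m (r @ x) = r" using len[OF r(1)] by simp
      ultimately show ?thesis using le[OF _ ab(1)] le[OF _ ab(2)] r(2) by (intro bexI[of _ "r @ x"]) auto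
    qed
    then have fin: "\<exists>w\<in>G. \<forall>u\<in>E. le w u" if "finite E" "E \<subseteq> G" for E
      by (rule finite_lower_bound[OF ne tr _ that])
    have "\<forall>a\<in>G. le a a" using le by auto
    then show ?thesis unfolding definable_directed_def
      by (intro conjI G ne LS tr allI impI fin)
  qed
  have "definable_map S (m + n) n G (drop m)"
    by (rule definable_mapI[OF G]) (intro dtm_drop[where j = n] dfi, auto)
  moreover have "drop m ` G \<subseteq> X" using Ge FX by blast
  ultimately have "definable_net S n X (m + n) G le (drop m)" unfolding definable_net_def using dir by simp
  then have "\<exists>k' \<Omega>' le' f x. definable_directed S k' \<Omega>' le' \<and> definable_map S k' (m + n) \<Omega>' f \<and>
         downward_cofinal \<Omega>' le' G le f \<and> x \<in> X \<and> net_converges S n T \<Omega>' le' (drop m \<circ> f) x"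
    using nc unfolding net_complete_def by simp
  then obtain k' \<Omega>' le' f x where dir': "definable_directed S k' \<Omega>' le'" and cof: "downward_cofinal \<Omega>' le' G le f"
    and x: "x \<in> X" and conv: "net_converges S n T \<Omega>' le' (drop m \<circ> f) x" by (elim exE conjE)
  have "x \<in> F t" if t: "t \<in> I" for t
  proof (rule ccontr)
    assume "x \<notin> F t"
    then have "definable_nbhd S n T (X - F t) x" using closed_nbhd[OF cl[OF t] FS[OF t] x] unfolding nbhd_def by simp
    then obtain u where u: "u \<in> \<Omega>'" "\<forall>v\<in>\<Omega>'. le' v u \<longrightarrow> drop m (f v) \<in> X - F t"
      using conv unfolding net_converges_def by auto
    \<comment> \<open>Any point of \<open>F t\<close> will do: the order on \<open>G\<close> ignores
      the second component.\<close>
    obtain z where "z \<in> F t" using Fne[OF t] by auto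
    then have tz: "t @ z \<in> G" using GF[OF t] by simp
    obtain v where v: "v \<in> \<Omega>'" "\<forall>w\<in>\<Omega>'. le' w v \<longrightarrow> le (f w) (t @ z)"
      using cof tz unfolding downward_cofinal_def by blast
    have "\<forall>E. finite E \<longrightarrow> E \<subseteq> \<Omega>' \<longrightarrow> (\<exists>w\<in>\<Omega>'. \<forall>a\<in>E. le' w a)"
      using dir' unfolding definable_directed_def by (elim conjE)
    from this[rule_format, of "{u, v}"] have "\<exists>w\<in>\<Omega>'. \<forall>a\<in>{u, v}. le' w a" using u(1) v(1) by simp
    then obtain w where w: "w \<in> \<Omega>'" "le' w u" "le' w v" by auto
    have fw: "f w \<in> G" using cof w(1) unfolding downward_cofinal_def by auto
    have "drop m (f w) \<in> F t" using le[OF fw tz] v(2) w len[OF t] Ge[OF fw] by auto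
    then show False using u(2) w by auto
  qed
  then show "(\<Inter>t\<in>I. F t) \<noteq> {}" by auto
qed

end

theorem theorem4p6:
  fixes S :: "nat \<Rightarrow> ('a::{group_add, dense_linorder, no_top, no_bot}) list set set"
    and n :: nat and X :: "'a list set" and T :: "'a list topology"
  assumes "is_structure S"
    and "expands_ordered_group S"
    and "\<forall>x y z::'a. x < y \<longrightarrow> x + z < y + z \<and> z + x < z + y"
    and "locally_o_minimal S"
    and "definably_complete S"
    and "definable_top_space S n X T"
  shows "((\<forall>a b \<gamma>. definable_curve S n X a b \<gamma> \<longrightarrow>
              conv_right S n T a b \<gamma> \<noteq> {} \<and> conv_left S n T a b \<gamma> \<noteq> {})
          \<longleftrightarrow>
          (\<forall>k \<Omega> le \<gamma>. definable_net S n X k \<Omega> le \<gamma> \<longrightarrow>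
              (\<exists>k' \<Omega>' le' f x. definable_directed S k' \<Omega>' le' \<and> definable_map S k' k \<Omega>' f \<and>
                 downward_cofinal \<Omega>' le' \<Omega> le f \<and> x \<in> X \<and>
                 net_converges S n T \<Omega>' le' (\<gamma> \<circ> f) x)))
       \<and>
         ((\<forall>k \<Omega> le \<gamma>. definable_net S n X k \<Omega> le \<gamma> \<longrightarrow>
              (\<exists>k' \<Omega>' le' f x. definable_directed S k' \<Omega>' le' \<and> definable_map S k' k \<Omega>' f \<and>
                 downward_cofinal \<Omega>' le' \<Omega> le f \<and> x \<in> X \<and>
                 net_converges S n T \<Omega>' le' (\<gamma> \<circ> f) x))
          \<longleftrightarrow>
          (\<forall>m I F. definable_filtered_closed S n T m I F \<longrightarrow> (\<Inter>t\<in>I. F t) \<noteq> {}))"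
proof -
  interpret dclom_space S n X T
    using assms by unfold_locales
  have "curve_complete \<longleftrightarrow> filter_complete"
    using curve_complete_imp_filtered filter_complete_imp_curve_complete unfolding filter_complete_def by blast
  moreover have "net_complete \<longleftrightarrow> filter_complete"
    using filter_complete_imp_net_complete net_complete_imp_filter_complete by blast
  ultimately show ?thesis
    unfolding curve_complete_def net_complete_def filter_complete_def by simp
qed

end
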